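(* Let $1<p<\infty$ and let $h_0:\overline{\mathbb{D}}\to\overline{\mathbb{D}}$ be quasiconformal boundary data, with $f_0=h_0^{-1}$. Let $h\in\mathsf{H}_p$ with $\mathbb{K}(w,h)\in L^1(\mathbb{D})$. Then $h$ is a homeomorphism.
   Context: $\mathbb{D}$ is the open unit disk. A mapping $f$ on $\mathbb{D}$ has finite distortion if $f\in W^{1,1}_{loc}(\mathbb{D})$, $J(z,f)\in L^1_{loc}(\mathbb{D})$, and there is a measurable $\mathbf{K}(z)\ge1$, finite almost everywhere, with $|Df(z)|^2\le\mathbf{K}(z)J(z,f)$ almost everywhere. $\mathbb{K}(z,f)=\frac{|f_z|^2+|f_{\bar z}|^2}{|f_z|^2-|f_{\bar z}|^2}$ where $J(z,f)=|f_z|^2-|f_{\bar z}|^2\ne0$ and $\mathbb{K}(z,f)=1$ where $J(z,f)=0$. $\mathsf{E}_p^\ast(h)=\int_{\mathbb{D}}\mathbb{K}^p(w,h)J(w,h)\,dw$ (area measure). Put $q=\frac{2p}{p+1}$. $\mathsf{H}_p$ is the set of functions $h:\overline{\mathbb{D}}\to\overline{\mathbb{D}}$ satisfying: (i) $h\in C(\overline{\mathbb{D}})$, $h|_{\partial\mathbb{D}}=h_0|_{\partial\mathbb{D}}$, $h$ has finite distortion and $\mathsf{E}_p^\ast(h)\le\mathsf{E}_p^\ast(h_0)+1$; (ii) there is an $f\in W^{1,q}(\mathbb{D},\mathbb{D})$ with $\|Df\|_{L^q(\mathbb{D})}\le\big(\pi^p\int_{\mathbb{D}}\mathbb{K}^p(z,f_0)\,dz\big)^{\frac1{p+1}}+1$;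 (iii) there is a measurable set $X\subset\mathbb{D}$ with $|\mathbb{D}-X|=0$, $h\circ f(z)=z$ for every $z\in X$, and $J(w,h)=0$ for almost every $w\in\mathbb{D}-f(X)$. *)

theory Defs
  imports "HOL-Analysis.Analysis"
begin

text \<open>All functions are total on the complex plane; only their values on the set in question matter.
  Area measure is \<^const>\<open>lebesgue\<close> on the complex plane.\<close>

abbreviation disk :: "complex set" where "disk \<equiv> ball 0 1"

abbreviation closed_disk :: "complex set" where "closed_disk \<equiv> cball 0 1"


subsection \<open>Lebesgue and Sobolev spaces\<close>

definition Lq_on :: "real \<Rightarrow> complex set \<Rightarrow> (complex \<Rightarrow> 'b::real_normed_vector) \<Rightarrow> bool" where
  "Lq_on q U f \<longleftrightarrow> f \<in> borel_measurable (lebesgue_on U) \<and>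
     integrable (lebesgue_on U) (\<lambda>z. norm (f z) powr q)"

definition Lq_loc :: "real \<Rightarrow> complex set \<Rightarrow> (complex \<Rightarrow> 'b::real_normed_vector) \<Rightarrow> bool" where
  "Lq_loc q U f \<longleftrightarrow> (\<forall>C. compact C \<and> C \<subseteq> U \<longrightarrow> Lq_on q C f)"

primrec C_k :: "nat \<Rightarrow> (complex \<Rightarrow> real) \<Rightarrow> bool" where
  "C_k 0 \<phi> \<longleftrightarrow> continuous_on UNIV \<phi>"
| "C_k (Suc k) \<phi> \<longleftrightarrow> (\<exists>\<phi>x \<phi>y.
     (\<forall>z. (\<phi> has_derivative (\<lambda>v. Re v * \<phi>x z + Im v * \<phi>y z)) (at z)) \<and> C_k k \<phi>x \<and> C_k k \<phi>y)"

definition test_function :: "complex set \<Rightarrow> (complex \<Rightarrow> real) \<Rightarrow> bool" where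
  "test_function U \<phi> \<longleftrightarrow> (\<forall>k. C_k k \<phi>) \<and>
     compact (closure {z. \<phi> z \<noteq> 0}) \<and> closure {z. \<phi> z \<noteq> 0} \<subseteq> U"

definition has_weak_deriv ::
    "complex set \<Rightarrow> complex \<Rightarrow> (complex \<Rightarrow> complex) \<Rightarrow> (complex \<Rightarrow> complex) \<Rightarrow> bool" where
  "has_weak_deriv U e f g \<longleftrightarrow> Lq_loc 1 U f \<and> Lq_loc 1 U g \<and>
     (\<forall>\<phi>. test_function U \<phi> \<longrightarrow>
        (LINT z:U|lebesgue. frechet_derivative \<phi> (at z) e *\<^sub>R f z) =
        - (LINT z:U|lebesgue. \<phi> z *\<^sub>R g z))"

text \<open>On an open set a weak derivative is unique up to a null set. The choice operator picks a
  representative; every notion below is insensitive to which one.\<close>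

definition weak_deriv :: "complex set \<Rightarrow> complex \<Rightarrow> (complex \<Rightarrow> complex) \<Rightarrow> complex \<Rightarrow> complex" where
  "weak_deriv U e f = (SOME g. has_weak_deriv U e f g)"

definition weakly_differentiable :: "complex set \<Rightarrow> (complex \<Rightarrow> complex) \<Rightarrow> bool" where
  "weakly_differentiable U f \<longleftrightarrow> (\<forall>e\<in>{1, \<i>}. \<exists>g. has_weak_deriv U e f g)"

definition W1q :: "real \<Rightarrow> complex set \<Rightarrow> (complex \<Rightarrow> complex) \<Rightarrow> bool" where
  "W1q q U f \<longleftrightarrow> weakly_differentiable U f \<and> Lq_on q U f \<and>
     (\<forall>e\<in>{1, \<i>}. Lq_on q U (weak_deriv U e f))"

definition W1q_loc :: "real \<Rightarrow> complex set \<Rightarrow> (complex \<Rightarrow> complex) \<Rightarrow> bool" where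
  "W1q_loc q U f \<longleftrightarrow> weakly_differentiable U f \<and> Lq_loc q U f \<and>
     (\<forall>e\<in>{1, \<i>}. Lq_loc q U (weak_deriv U e f))"


subsection \<open>Differential, Jacobian and distortion of a map of the disk\<close>

definition d_z :: "(complex \<Rightarrow> complex) \<Rightarrow> complex \<Rightarrow> complex" where
  "d_z f z = (weak_deriv disk 1 f z - \<i> * weak_deriv disk \<i> f z) / 2"

definition d_zbar :: "(complex \<Rightarrow> complex) \<Rightarrow> complex \<Rightarrow> complex" where
  "d_zbar f z = (weak_deriv disk 1 f z + \<i> * weak_deriv disk \<i> f z) / 2"

text \<open>The operator norm of the differential; it equals \<open>|f_z| + |f_zbar|\<close>.\<close>

definition norm_D :: "(complex \<Rightarrow> complex) \<Rightarrow> complex \<Rightarrow> real" where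
  "norm_D f z = onorm (\<lambda>v. d_z f z * v + d_zbar f z * cnj v)"

definition Jac :: "(complex \<Rightarrow> complex) \<Rightarrow> complex \<Rightarrow> real" where
  "Jac f z = (cmod (d_z f z))\<^sup>2 - (cmod (d_zbar f z))\<^sup>2"

definition dist_K :: "(complex \<Rightarrow> complex) \<Rightarrow> complex \<Rightarrow> real" where
  "dist_K f z = (if Jac f z \<noteq> 0
     then ((cmod (d_z f z))\<^sup>2 + (cmod (d_zbar f z))\<^sup>2) / ((cmod (d_z f z))\<^sup>2 - (cmod (d_zbar f z))\<^sup>2)
     else 1)"

definition finite_distortion :: "(complex \<Rightarrow> complex) \<Rightarrow> bool" where
  "finite_distortion f \<longleftrightarrow> W1q_loc 1 disk f \<and> Lq_loc 1 disk (Jac f) \<and>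
     (\<exists>K :: complex \<Rightarrow> ereal. K \<in> borel_measurable (lebesgue_on disk) \<and> (\<forall>z\<in>disk. 1 \<le> K z) \<and>
        (AE z in lebesgue_on disk. K z < \<infinity>) \<and>
        (AE z in lebesgue_on disk. ereal ((norm_D f z)\<^sup>2) \<le> K z * ereal (Jac f z)))"

text \<open>The analytic definition; the inequality forces \<open>Jac f \<ge> 0\<close> a.e., so these maps preserve
  orientation.\<close>

definition quasiconformal :: "(complex \<Rightarrow> complex) \<Rightarrow> bool" where
  "quasiconformal f \<longleftrightarrow> (\<exists>g. homeomorphism disk (f ` disk) f g) \<and> W1q_loc 2 disk f \<and>
     (\<exists>K\<ge>1. AE z in lebesgue_on disk. (norm_D f z)\<^sup>2 \<le> K * Jac f z)"

definition qc_boundary_data :: "(complex \<Rightarrow> complex) \<Rightarrow> bool" where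
  "qc_boundary_data h0 \<longleftrightarrow>
     (\<exists>g. homeomorphism closed_disk closed_disk h0 g) \<and> quasiconformal h0"


subsection \<open>Energies and the class of admissible maps\<close>

definition energy :: "real \<Rightarrow> (complex \<Rightarrow> complex) \<Rightarrow> ennreal" where
  "energy p h = (\<integral>\<^sup>+ w. ennreal (dist_K h w powr p * Jac h w) \<partial>lebesgue_on disk)"

definition Lq_norm_D :: "real \<Rightarrow> (complex \<Rightarrow> complex) \<Rightarrow> real" where
  "Lq_norm_D q f = (LINT z:disk|lebesgue. norm_D f z powr q) powr (1 / q)"

text \<open>The real-valued integrals below are genuine: \<open>f\<close> lies in a Sobolev space, and the inverse of a
  quasiconformal \<open>h0\<close> is again quasiconformal, hence has bounded distortion.\<close>

definition H_class :: "real \<Rightarrow> (complex \<Rightarrow> complex) \<Rightarrow> (complex \<Rightarrow> complex) set" where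
  "H_class p h0 = {h.
     h ` closed_disk \<subseteq> closed_disk \<and>
     continuous_on closed_disk h \<and> (\<forall>z\<in>sphere 0 1. h z = h0 z) \<and>
     finite_distortion h \<and> energy p h \<le> energy p h0 + 1 \<and>
     (let q = 2 * p / (p + 1); f0 = the_inv_into closed_disk h0 in
       \<exists>f. f ` disk \<subseteq> disk \<and> W1q q disk f \<and>
         Lq_norm_D q f \<le>
           (pi powr p * (LINT z:disk|lebesgue. dist_K f0 z powr p)) powr (1 / (p + 1)) + 1 \<and>
         (\<exists>X. X \<in> sets lebesgue \<and> X \<subseteq> disk \<and> emeasure lebesgue (disk - X) = 0 \<and>
            (\<forall>z\<in>X. h (f z) = z) \<and>
            (AE w in lebesgue_on disk. w \<notin> f ` X \<longrightarrow> Jac h w = 0)))}"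

end

theory Submission
  imports Defs
begin

text \<open>Since the distortion is at least \<open>1\<close>, finiteness of the energy gives \<open>Dh \<in> L\<^sup>2\<close>. Mollifying \<open>h\<close> one
  finds \<open>\<integral> \<partial>\<Phi>(h) J = 0\<close> for test functions \<open>\<Phi>\<close> of the target, so that the push-forward of \<open>J dw\<close> is
  translation invariant and hence bounded by a multiple of Lebesgue measure; applied to \<open>h\<^sub>0\<close> this
  also shows that the energy bound is finite. By Cauchy-Schwarz, \<open>K \<in> L\<^sup>1\<close> and this bound make
  \<open>|Dh| / (|h - y| log (1 / |h - y|))\<close> integrable, which is incompatible with a set of positive
  measure of horizontal or vertical lines meeting the fibre over \<open>y\<close>.

  If two points had the same image \<open>y\<close>, one such line would therefore miss the fibre and separate
  them. The Sobolev function \<open>f\<close> maps almost all of a small disk around \<open>y\<close> into the complement of a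
  strip around this line, hence to one side of it. On the other side \<open>J = 0\<close>, thus \<open>Dh = 0\<close>, and
  \<open>h\<close> is locally constant there, contradicting the smallness of its fibres. Surjectivity is clear
  from \<open>h \<circ> f = id\<close>.\<close>

subsection \<open>Smooth bump functions\<close>

text \<open>The logarithm comes from balancing two sums. On the shell where \<open>|h - y|\<close>
  lies between 2^-(n+1) and 2^-n, the push-forward bound makes the integral of \<open>J\<close> of
  order 4^-n. For a weight w_n, w_n |Dh| is at most K + w_n^2 J up to constants, so its integrals
  over the shells are summable once w_n^2 4^-n is. A line that meets the fibre crosses all small
  shells and collects at least w_n 2^-(n+1) from each. The weight 2^n makes both sums diverge; 2^n /
  (n + 1) gives 1 / (n + 1)^2 against 1 / (2 (n + 1)).

  Two obstacles shape the rest. Since \<open>h\<close> is not known to be injective, no change of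
  variables controls \<open>J\<close>; its divergence structure is used instead, and a push-forward
  bound with some finite constant is enough. Since \<open>f\<close> need not be continuous, the
  image of a ball under \<open>f\<close> need not be connected; instead, composing a coordinate of
  \<open>f\<close> with a smooth step shows that almost all values lie on one side of an avoided
  strip.\<close>

definition flat_exp :: "real poly \<Rightarrow> real \<Rightarrow> real" where
  "flat_exp p s = (if 0 < s then poly p (1 / s) * exp (- (1 / s)) else 0)"

lemma poly_times_exp_minus_tendsto_0: "((\<lambda>x::real. poly p x * exp (- x)) \<longlongrightarrow> 0) at_top"
proof -
  have "((\<lambda>x::real. \<Sum>i\<le>degree p. coeff p i * (x ^ i / exp x)) \<longlongrightarrow> (\<Sum>i\<le>degree p. coeff p i * 0)) at_top"
    by (intro tendsto_intros tendsto_power_div_exp_0)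
  moreover have "(\<lambda>x::real. \<Sum>i\<le>degree p. coeff p i * (x ^ i / exp x)) = (\<lambda>x. poly p x * exp (- x))"
    by (auto simp: poly_altdef sum_distrib_right exp_minus divide_inverse mult.assoc)
  ultimately show ?thesis by simp
qed

lemma flat_exp_tendsto_0: "(flat_exp p \<longlongrightarrow> 0) (at_right 0)"
proof -
  have "((\<lambda>s::real. poly p (inverse s) * exp (- inverse s)) \<longlongrightarrow> 0) (at_right 0)"
    by (rule filterlim_compose[OF poly_times_exp_minus_tendsto_0 filterlim_inverse_at_top_right])
  then show ?thesis
    by (rule Lim_transform_eventually)
      (auto simp: flat_exp_def eventually_at_right_field inverse_eq_divide intro!: exI[of _ 1])
qed

text \<open>With t = 1/s, the derivative of p(t) exp(-t) in s is t^2 (p(t) - p'(t)) exp(-t). The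
  family indexed by polynomials is therefore closed under differentiation, and derivatives of all
  orders come from this single rule.\<close>

lemma has_real_derivative_flat_exp:
  "(flat_exp p has_real_derivative flat_exp (monom 1 2 * (p - pderiv p)) s) (at s)"
proof (cases "s = 0")
  case False
  show ?thesis
  proof (cases "0 < s")
    case True
    have "((\<lambda>s. poly p (1 / s) * exp (- (1 / s))) has_real_derivative
        flat_exp (monom 1 2 * (p - pderiv p)) s) (at s)"
      using True
      by (auto intro!: derivative_eq_intros poly_DERIV[THEN DERIV_chain2]
          simp: flat_exp_def poly_monom field_simps power2_eq_square)
    moreover have "\<forall>\<^sub>F x in nhds s. poly p (1 / x) * exp (- (1 / x)) = flat_exp p x"
      by (rule eventually_mono[OF eventually_nhds_in_open[of "{0<..}" s]])
         (use True in \<open>auto simp: flat_exp_def\<close>)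
    ultimately show ?thesis
      by (rule DERIV_cong_ev[OF refl _ refl, THEN iffD1, rotated])
  next
    case F: False
    then have "s < 0" using False by auto
    have "((\<lambda>s. 0) has_real_derivative flat_exp (monom 1 2 * (p - pderiv p)) s) (at s)"
      using F by (auto simp: flat_exp_def)
    moreover have "\<forall>\<^sub>F x in nhds s. 0 = flat_exp p x"
      by (rule eventually_mono[OF eventually_nhds_in_open[of "{..<0}" s]])
         (use \<open>s < 0\<close> in \<open>auto simp: flat_exp_def\<close>)
    ultimately show ?thesis
      by (rule DERIV_cong_ev[OF refl _ refl, THEN iffD1, rotated])
  qed
next
  case True
  \<comment> \<open>To the right of 0 the difference quotient is itself a \<open>flat_exp\<close>,
    for the polynomial x * p(x), so the limit already proved applies to it.\<close>
  have "((\<lambda>h. flat_exp p h / h) \<longlongrightarrow> 0) (at_right 0)"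
    using flat_exp_tendsto_0[of "monom 1 1 * p"]
    by (rule Lim_transform_eventually)
       (auto simp: flat_exp_def eventually_at_right_field poly_monom intro!: exI[of _ 1])
  moreover have "((\<lambda>h. flat_exp p h / h) \<longlongrightarrow> 0) (at_left 0)"
    by (rule tendsto_eventually)
       (auto simp: flat_exp_def eventually_at_left_field intro!: exI[of _ "-1"])
  ultimately have "((\<lambda>h. flat_exp p h / h) \<longlongrightarrow> 0) (at 0)"
    by (simp add: filterlim_split_at)
  then show ?thesis using True by (simp add: DERIV_def flat_exp_def)
qed

text \<open>The argument d^2 - |z|^2 is positive exactly inside the disk of radius \<open>d\<close>,
  so vanishing outside it is built in. Keeping the polynomial as a parameter makes each derivative a
  coordinate expression times another \<open>bump\<close>.\<close>

definition bump :: "real poly \<Rightarrow> real \<Rightarrow> complex \<Rightarrow> real" where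
  "bump p d z = flat_exp p (d\<^sup>2 - ((Re z)\<^sup>2 + (Im z)\<^sup>2))"

definition flat_deriv_poly :: "real poly \<Rightarrow> real poly" where
  "flat_deriv_poly p = monom 1 2 * (p - pderiv p)"

lemma has_derivative_bump:
  "(bump p d has_derivative
     (\<lambda>v. Re v * (- 2 * Re z * bump (flat_deriv_poly p) d z) + Im v * (- 2 * Im z * bump (flat_deriv_poly p) d z))) (at z)"
proof -
  have 1: "(flat_exp p has_derivative (*) (flat_exp (flat_deriv_poly p) (d\<^sup>2 - ((Re z)\<^sup>2 + (Im z)\<^sup>2))))
      (at (d\<^sup>2 - ((Re z)\<^sup>2 + (Im z)\<^sup>2)))"
    using has_real_derivative_flat_exp[of p "d\<^sup>2 - ((Re z)\<^sup>2 + (Im z)\<^sup>2)"]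
    by (simp add: has_field_derivative_def flat_deriv_poly_def)
  have 2: "((\<lambda>z. d\<^sup>2 - ((Re z)\<^sup>2 + (Im z)\<^sup>2)) has_derivative
      (\<lambda>v. - 2 * (Re z * Re v) - 2 * (Im z * Im v))) (at z)"
    by (auto intro!: derivative_eq_intros simp: algebra_simps)
  show ?thesis
    unfolding bump_def[abs_def]
    by (rule has_derivative_eq_rhs[OF has_derivative_compose[OF 2 1]])
       (simp add: algebra_simps bump_def fun_eq_iff)
qed

lemma continuous_on_bump [continuous_intros]:
  "continuous_on S f \<Longrightarrow> continuous_on S (\<lambda>x. bump p d (f x))"
  using continuous_on_compose2[of UNIV "bump p d" S f]
  by (meson UNIV_I continuous_at_imp_continuous_on has_derivative_bump has_derivative_continuous subsetI)

lemma borel_measurable_bump [measurable]: "bump p d \<in> borel_measurable borel"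
  by (intro borel_measurable_continuous_onI continuous_intros)

lemma bump_eq_0: "0 < d \<Longrightarrow> d \<le> cmod z \<Longrightarrow> bump p d z = 0"
proof -
  assume "0 < d" "d \<le> cmod z"
  then have "d\<^sup>2 \<le> (cmod z)\<^sup>2" by (intro power_mono) auto
  then show ?thesis by (simp add: bump_def flat_exp_def cmod_power2[symmetric] del: power_mono_iff)
qed

text \<open>A class closed under both partial derivatives. \<open>C_k\<close> passes to new
  functions at each level, so the induction on \<open>k\<close> has to range over such a class
  rather than over a single bump.\<close>

inductive smooth_expr :: "(complex \<Rightarrow> real) \<Rightarrow> bool" where
  bump: "smooth_expr (\<lambda>z. bump p d (x - z))"
| Re: "smooth_expr Re"
| Im: "smooth_expr Im"
| const: "smooth_expr (\<lambda>z. c)"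
| add: "smooth_expr f \<Longrightarrow> smooth_expr g \<Longrightarrow> smooth_expr (\<lambda>z. f z + g z)"
| mult: "smooth_expr f \<Longrightarrow> smooth_expr g \<Longrightarrow> smooth_expr (\<lambda>z. f z * g z)"

lemma has_derivative_bump_shift:
  "((\<lambda>z. bump p d (x - z)) has_derivative
     (\<lambda>v. Re v * (2 * (Re x - Re z) * bump (flat_deriv_poly p) d (x - z)) +
          Im v * (2 * (Im x - Im z) * bump (flat_deriv_poly p) d (x - z)))) (at z)"
proof -
  have "((\<lambda>z. x - z) has_derivative (\<lambda>v. - v)) (at z)"
    by (auto intro!: derivative_eq_intros)
  from has_derivative_compose[OF this has_derivative_bump]
  show ?thesis by (rule has_derivative_eq_rhs) (simp add: algebra_simps fun_eq_iff)
qed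

lemma smooth_expr_partial_derivs:
  assumes "smooth_expr f"
  shows "\<exists>fx fy. smooth_expr fx \<and> smooth_expr fy \<and>
           (\<forall>z. (f has_derivative (\<lambda>v. Re v * fx z + Im v * fy z)) (at z))"
  using assms
proof induction
  case (bump p d x)
  \<comment> \<open>The factor \<open>Re x - Re z\<close> is spelled as a sum with a product,
    matching the constructors of the class.\<close>
  have [intro]: "smooth_expr (\<lambda>z. 2 * (Re x + (-1) * Re z) * bump (flat_deriv_poly p) d (x - z))"
      "smooth_expr (\<lambda>z. 2 * (Im x + (-1) * Im z) * bump (flat_deriv_poly p) d (x - z))"
    by (intro smooth_expr.intros)+
  have "Re x + (-1) * Re z = Re x - Re z" "Im x + (-1) * Im z = Im x - Im z" for z by simp_all
  then have "((\<lambda>z. bump p d (x - z)) has_derivative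
     (\<lambda>v. Re v * (2 * (Re x + (-1) * Re z) * bump (flat_deriv_poly p) d (x - z)) +
          Im v * (2 * (Im x + (-1) * Im z) * bump (flat_deriv_poly p) d (x - z)))) (at z)" for z
    using has_derivative_bump_shift[of p d x z] by presburger
  then show ?case by blast
next
  case Re
  show ?case
    by (intro exI[of _ "\<lambda>z. 1"] exI[of _ "\<lambda>z. 0"])
       (auto intro!: smooth_expr.const derivative_eq_intros)
next
  case Im
  show ?case
    by (intro exI[of _ "\<lambda>z. 0"] exI[of _ "\<lambda>z. 1"])
       (auto intro!: smooth_expr.const derivative_eq_intros)
next
  case (const c)
  show ?case
    by (intro exI[of _ "\<lambda>z. 0"]) (auto intro!: smooth_expr.const derivative_eq_intros)
next
  case (add f g)
  then obtain fx fy gx gy where *: "smooth_expr fx" "smooth_expr fy" "smooth_expr gx" "smooth_expr gy"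
    "\<And>z. (f has_derivative (\<lambda>v. Re v * fx z + Im v * fy z)) (at z)"
    "\<And>z. (g has_derivative (\<lambda>v. Re v * gx z + Im v * gy z)) (at z)"
    by blast
  have d: "((\<lambda>z. f z + g z) has_derivative (\<lambda>v. Re v * (fx z + gx z) + Im v * (fy z + gy z))) (at z)" for z
    by (rule has_derivative_eq_rhs[OF has_derivative_add[OF *(5)[of z] *(6)[of z]]])
       (simp add: algebra_simps fun_eq_iff)
  show ?case
    by (intro exI[of _ "\<lambda>z. fx z + gx z"] exI[of _ "\<lambda>z. fy z + gy z"]
        conjI allI smooth_expr.intros * d)
next
  case (mult f g)
  then obtain fx fy gx gy where *: "smooth_expr fx" "smooth_expr fy" "smooth_expr gx" "smooth_expr gy"
    "\<And>z. (f has_derivative (\<lambda>v. Re v * fx z + Im v * fy z)) (at z)"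
    "\<And>z. (g has_derivative (\<lambda>v. Re v * gx z + Im v * gy z)) (at z)"
    by blast
  have d: "((\<lambda>z. f z * g z) has_derivative (\<lambda>v. Re v * (f z * gx z + fx z * g z) + Im v * (f z * gy z + fy z * g z))) (at z)" for z
    by (rule has_derivative_eq_rhs[OF has_derivative_mult[OF *(5)[of z] *(6)[of z]]])
       (simp add: algebra_simps fun_eq_iff)
  show ?case
    by (intro exI[of _ "\<lambda>z. f z * gx z + fx z * g z"] exI[of _ "\<lambda>z. f z * gy z + fy z * g z"]
        conjI allI smooth_expr.intros * mult.hyps d)
qed

lemma smooth_expr_C_k: "smooth_expr f \<Longrightarrow> C_k k f"
proof (induction k arbitrary: f)
  case 0
  from smooth_expr_partial_derivs[OF this] show ?case
    by (auto intro!: continuous_at_imp_continuous_on intro: has_derivative_continuous)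
next
  case (Suc k)
  from smooth_expr_partial_derivs[OF Suc.prems] Suc.IH show ?case by auto
qed

lemma test_function_bump:
  assumes "0 < d" "cball x d \<subseteq> U"
  shows "test_function U (\<lambda>z. bump p d (x - z))"
proof -
  have "{z. bump p d (x - z) \<noteq> 0} \<subseteq> cball x d"
    using bump_eq_0[OF assms(1)] by (force simp: dist_norm)
  then have "closure {z. bump p d (x - z) \<noteq> 0} \<subseteq> cball x d"
    by (rule closure_minimal) simp
  moreover from this have "compact (closure {z. bump p d (x - z) \<noteq> 0})"
    by (meson bounded_cball bounded_subset closed_closure compact_eq_bounded_closed)
  ultimately show ?thesis
    using assms smooth_expr_C_k[OF smooth_expr.bump] by (auto simp: test_function_def)
qed

lemma frechet_derivative_bump_shift:
  shows "frechet_derivative (\<lambda>z. bump p d (x - z)) (at z) 1 = 2 * (Re x - Re z) * bump (flat_deriv_poly p) d (x - z)"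
    and "frechet_derivative (\<lambda>z. bump p d (x - z)) (at z) \<i> = 2 * (Im x - Im z) * bump (flat_deriv_poly p) d (x - z)"
  using fun_cong[OF frechet_derivative_at[OF has_derivative_bump_shift[of p d x z], symmetric], of 1]
    fun_cong[OF frechet_derivative_at[OF has_derivative_bump_shift[of p d x z], symmetric], of "\<i>"]
  by auto

subsection \<open>Mollification\<close>

lemma continuous_compact_support_bounded:
  fixes k :: "complex \<Rightarrow> real"
  assumes "continuous_on UNIV k" "\<And>z. d \<le> cmod z \<Longrightarrow> k z = 0"
  obtains L where "\<And>z. \<bar>k z\<bar> \<le> L"
proof -
  have "compact (k ` cball 0 d)"
    using assms(1) by (intro compact_continuous_image) (auto intro: continuous_on_subset)
  then obtain L where L: "\<forall>z\<in>cball 0 d. \<bar>k z\<bar> \<le> L"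
    unfolding compact_eq_bounded_closed bounded_iff by auto
  have "\<bar>k z\<bar> \<le> max L 0" for z
    using L assms(2)[of z] by (cases "cmod z \<le> d") force+
  then show ?thesis by (rule that)
qed

text \<open>The inner map \<open>m\<close> is the identity for convolutions, negation for
  translations, and the planar map itself when a density is pushed forward. The kernel lemmas are
  shared by all three.\<close>

lemma integrable_kernel:
  fixes k :: "complex \<Rightarrow> real" and g :: "'a \<Rightarrow> 'b::{banach, second_countable_topology}"
  assumes "continuous_on UNIV k" "\<And>z. \<bar>k z\<bar> \<le> L" "m \<in> borel_measurable M" "integrable M g"
  shows "integrable M (\<lambda>z. k (x - m z) *\<^sub>R g z)"
proof (rule Bochner_Integration.integrable_bound)
  have [measurable]: "k \<in> borel_measurable borel" using assms(1) by (rule borel_measurable_continuous_onI)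
  note [measurable] = assms(3) borel_measurable_integrable[OF assms(4)]
  show "(\<lambda>z. k (x - m z) *\<^sub>R g z) \<in> borel_measurable M" by measurable
  show "integrable M (\<lambda>z. L * norm (g z))" using assms by simp
  show "AE z in M. norm (k (x - m z) *\<^sub>R g z) \<le> norm (L * norm (g z))"
    using assms(2) by (auto simp: abs_mult intro!: mult_right_mono AE_I2) (meson abs_ge_self order_trans)
qed

lemma continuous_integral_kernel:
  fixes k :: "complex \<Rightarrow> real" and g :: "'a \<Rightarrow> 'b::{banach, second_countable_topology}"
  assumes "continuous_on UNIV k" "\<And>z. \<bar>k z\<bar> \<le> L" "m \<in> borel_measurable M" "integrable M g"
  shows "continuous_on S (\<lambda>x. \<integral>z. k (x - m z) *\<^sub>R g z \<partial>M)"
proof -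
  have [measurable]: "k \<in> borel_measurable borel" using assms(1) by (rule borel_measurable_continuous_onI)
  note [measurable] = assms(3) borel_measurable_integrable[OF assms(4)]
  have "isCont (\<lambda>x. \<integral>z. k (x - m z) *\<^sub>R g z \<partial>M) x" for x
  proof (rule continuous_at_sequentiallyI)
    fix u assume u: "u \<longlonglongrightarrow> x"
    show "(\<lambda>n. \<integral>z. k (u n - m z) *\<^sub>R g z \<partial>M) \<longlonglongrightarrow> (\<integral>z. k (x - m z) *\<^sub>R g z \<partial>M)"
    proof (rule integral_dominated_convergence[where w = "\<lambda>z. L * norm (g z)"])
      show "integrable M (\<lambda>z. L * norm (g z))" using assms by simp
      show "AE z in M. (\<lambda>n. k (u n - m z) *\<^sub>R g z) \<longlonglongrightarrow> k (x - m z) *\<^sub>R g z"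
        by (intro AE_I2 tendsto_intros continuous_on_tendsto_compose[OF assms(1)] u) auto
      show "AE z in M. norm (k (u n - m z) *\<^sub>R g z) \<le> L * norm (g z)" for n
        using assms(2) by (auto intro!: mult_right_mono)
    qed auto
  qed
  then show ?thesis by (simp add: continuous_at_imp_continuous_on)
qed

text \<open>Dominated convergence along sequences: \<open>k\<close> is Lipschitz with constant
  \<open>2 * L\<close>, so the normalised remainder of the difference quotient is bounded by
  \<open>4 * L\<close> and tends to 0 pointwise.\<close>

lemma has_derivative_integral_kernel:
  fixes k kx ky :: "complex \<Rightarrow> real" and g :: "'a \<Rightarrow> 'b::{banach, second_countable_topology}"
  assumes k: "\<And>z. (k has_derivative (\<lambda>v. Re v * kx z + Im v * ky z)) (at z)"
    and cont: "continuous_on UNIV kx" "continuous_on UNIV ky"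
    and bd: "\<And>z. \<bar>k z\<bar> \<le> L" "\<And>z. \<bar>kx z\<bar> \<le> L" "\<And>z. \<bar>ky z\<bar> \<le> L"
    and m: "m \<in> borel_measurable M" and g: "integrable M g"
  shows "((\<lambda>x. \<integral>z. k (x - m z) *\<^sub>R g z \<partial>M) has_derivative
     (\<lambda>v. Re v *\<^sub>R (\<integral>z. kx (x - m z) *\<^sub>R g z \<partial>M) + Im v *\<^sub>R (\<integral>z. ky (x - m z) *\<^sub>R g z \<partial>M))) (at x)"
    (is "(?I has_derivative ?D) _")
proof -
  have contk: "continuous_on UNIV k"
    using k by (meson continuous_at_imp_continuous_on has_derivative_continuous)
  have [measurable]: "k \<in> borel_measurable borel" "kx \<in> borel_measurable borel" "ky \<in> borel_measurable borel"
    using contk cont by (auto intro: borel_measurable_continuous_onI)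
  note [measurable] = m borel_measurable_integrable[OF g]
  have lin: "\<bar>Re v * kx z + Im v * ky z\<bar> \<le> 2 * L * cmod v" for v z
  proof -
    have "\<bar>Re v * kx z + Im v * ky z\<bar> \<le> \<bar>Re v\<bar> * \<bar>kx z\<bar> + \<bar>Im v\<bar> * \<bar>ky z\<bar>"
      by (metis abs_mult abs_triangle_ineq)
    also have "\<dots> \<le> cmod v * L + cmod v * L"
      by (intro add_mono mult_mono bd abs_Re_le_cmod abs_Im_le_cmod) auto
    finally show ?thesis by simp
  qed
  have lip: "\<bar>k a - k b\<bar> \<le> 2 * L * cmod (a - b)" for a b
  proof -
    have "norm (k a - k b) \<le> 2 * L * norm (a - b)"
    proof (rule differentiable_bound[of UNIV])
      show "onorm (\<lambda>v. Re v * kx z + Im v * ky z) \<le> 2 * L" for z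
        by (rule onorm_le) (use lin[of _ z] in simp)
    qed (use k in auto)
    then show ?thesis by simp
  qed
  have int: "integrable M (\<lambda>z. k (x - m z) *\<^sub>R g z)" for x
    using integrable_kernel[OF contk bd(1) m g] .
  have intx: "integrable M (\<lambda>z. kx (x - m z) *\<^sub>R g z)" for x
    using integrable_kernel[OF cont(1) bd(2) m g] .
  have inty: "integrable M (\<lambda>z. ky (x - m z) *\<^sub>R g z)" for x
    using integrable_kernel[OF cont(2) bd(3) m g] .
  show ?thesis
    unfolding has_derivative_iff_norm
  proof
    show "bounded_linear ?D"
      by (intro bounded_linear_add bounded_linear_compose[OF bounded_linear_scaleR_left]
          bounded_linear_Re bounded_linear_Im)
    show "((\<lambda>y. norm ((?I y - ?I x) - ?D (y - x)) / norm (y - x)) \<longlongrightarrow> 0) (at x)"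
      unfolding tendsto_at_iff_sequentially
    proof (intro allI impI)
      fix X :: "nat \<Rightarrow> complex" assume ne: "\<forall>i. X i \<in> UNIV - {x}" and X: "X \<longlonglongrightarrow> x"
      define q where "q i w = (k (X i - w) - k (x - w) - (Re (X i - x) * kx (x - w) + Im (X i - x) * ky (x - w)))
          / cmod (X i - x)" for i w
      have [measurable]: "q i \<in> borel_measurable borel" for i unfolding q_def by measurable
      have lincomb: "(\<integral>z. c *\<^sub>R (A z - B z - (a *\<^sub>R C z + b *\<^sub>R D z)) \<partial>M) =
          c *\<^sub>R (integral\<^sup>L M A - integral\<^sup>L M B - (a *\<^sub>R integral\<^sup>L M C + b *\<^sub>R integral\<^sup>L M D))"
        if "integrable M A" "integrable M B" "integrable M C" "integrable M D"
        for a b c :: real and A B C D :: "'a \<Rightarrow> 'b"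
        using that by simp
      have eq: "norm ((?I (X i) - ?I x) - ?D (X i - x)) / norm (X i - x) = norm (\<integral>z. q i (m z) *\<^sub>R g z \<partial>M)" for i
      proof -
        have "q i (m z) *\<^sub>R g z = (1 / cmod (X i - x)) *\<^sub>R
           (k (X i - m z) *\<^sub>R g z - k (x - m z) *\<^sub>R g z -
            (Re (X i - x) *\<^sub>R (kx (x - m z) *\<^sub>R g z) + Im (X i - x) *\<^sub>R (ky (x - m z) *\<^sub>R g z)))" for z
        proof -
          have "q i w = (1 / cmod (X i - x)) * (k (X i - w) - k (x - w) - (Re (X i - x) * kx (x - w) + Im (X i - x) * ky (x - w)))" for w
            unfolding q_def by simp
          then show ?thesis
            by (simp only: scaleR_scaleR[symmetric] scaleR_diff_left scaleR_add_left)
        qed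
        then have "(\<integral>z. q i (m z) *\<^sub>R g z \<partial>M) = (1 / cmod (X i - x)) *\<^sub>R ((?I (X i) - ?I x) - ?D (X i - x))"
          by (simp only: lincomb[OF int int intx inty])
        then show ?thesis by (simp add: divide_inverse mult.commute)
      qed
      have qb: "\<bar>q i w\<bar> \<le> 4 * L" for i w
      proof -
        have "\<bar>k (X i - w) - k (x - w) - (Re (X i - x) * kx (x - w) + Im (X i - x) * ky (x - w))\<bar>
            \<le> 2 * L * cmod (X i - x) + 2 * L * cmod (X i - x)"
          using lip[of "X i - w" "x - w"] lin[of "X i - x" "x - w"] by simp
        then show ?thesis
          using ne by (auto simp: q_def divide_le_eq)
      qed
      have ql: "(\<lambda>i. q i w) \<longlonglongrightarrow> 0" for w
      proof -
        have "((\<lambda>y. norm ((k y - k (x - w)) - (Re (y - (x - w)) * kx (x - w) + Im (y - (x - w)) * ky (x - w)))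
            / norm (y - (x - w))) \<longlongrightarrow> 0) (at (x - w))"
          using k[of "x - w"] unfolding has_derivative_iff_norm by simp
        moreover have "filterlim (\<lambda>i. X i - w) (at (x - w)) sequentially"
          using ne by (auto simp: filterlim_at intro!: tendsto_intros X)
        ultimately have "(\<lambda>i. norm ((k (X i - w) - k (x - w)) - (Re (X i - w - (x - w)) * kx (x - w) +
            Im (X i - w - (x - w)) * ky (x - w))) / norm (X i - w - (x - w))) \<longlonglongrightarrow> 0"
          by (rule filterlim_compose)
        moreover have "norm ((k (X i - w) - k (x - w)) - (Re (X i - w - (x - w)) * kx (x - w) +
            Im (X i - w - (x - w)) * ky (x - w))) / norm (X i - w - (x - w)) = norm (q i w)" for i
          unfolding q_def by simp
        ultimately have "(\<lambda>i. norm (q i w)) \<longlonglongrightarrow> 0"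
          by (simp only:)
        then show ?thesis by (rule tendsto_norm_zero_cancel)
      qed
      have "(\<lambda>i. \<integral>z. q i (m z) *\<^sub>R g z \<partial>M) \<longlonglongrightarrow> (\<integral>z. 0 \<partial>M)"
      proof (rule integral_dominated_convergence[where w = "\<lambda>z. 4 * L * norm (g z)"])
        show "integrable M (\<lambda>z. 4 * L * norm (g z))" using g by simp
        show "AE z in M. (\<lambda>n. q n (m z) *\<^sub>R g z) \<longlonglongrightarrow> 0"
          using tendsto_scaleR[OF ql tendsto_const] by auto
        show "AE z in M. norm (q n (m z) *\<^sub>R g z) \<le> 4 * L * norm (g z)" for n
          using qb by (auto intro!: mult_right_mono)
      qed auto
      then show "((\<lambda>y. norm ((?I y - ?I x) - ?D (y - x)) / norm (y - x)) \<circ> X) \<longlonglongrightarrow> 0"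
        unfolding comp_def eq by (simp add: tendsto_norm_zero)
    qed
  qed
qed

section \<open>Reflection invariance and the standard mollifier\<close>

lemma distr_lborel_reflect: "distr lborel borel (\<lambda>z. x - z) = (lborel :: complex measure)"
proof -
  show ?thesis
    using lborel_affine[of "-1" x] by (simp add: density_1)
qed

lemma nn_integral_lborel_reflect:
  fixes f :: "complex \<Rightarrow> ennreal"
  assumes "f \<in> borel_measurable borel"
  shows "(\<integral>\<^sup>+z. f (x - z) \<partial>lborel) = (\<integral>\<^sup>+z. f z \<partial>lborel)"
  by (subst (2) distr_lborel_reflect[symmetric, of x], subst nn_integral_distr) (use assms in auto)

lemma integral_lborel_reflect:
  fixes f :: "complex \<Rightarrow> 'b::{banach, second_countable_topology}"
  assumes "f \<in> borel_measurable borel"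
  shows "(LBINT z. f (x - z)) = (LBINT z. f z)"
  by (subst (2) distr_lborel_reflect[symmetric, of x], subst integral_distr) (use assms in auto)

text \<open>The normalising constant is stored in the polynomial, so that the mollifier is again a
  \<open>bump\<close> and inherits its derivative formulas.\<close>

definition mollifier_poly :: "real \<Rightarrow> real poly" where
  "mollifier_poly d = [: 1 / (LBINT z. bump 1 d z) :]"

definition mollifier :: "real \<Rightarrow> complex \<Rightarrow> real" where
  "mollifier d = bump (mollifier_poly d) d"

definition moll :: "real \<Rightarrow> (complex \<Rightarrow> 'b::{banach, second_countable_topology}) \<Rightarrow> complex \<Rightarrow> 'b" where
  "moll d g x = (LBINT z. mollifier d (x - z) *\<^sub>R g z)"

lemma integrable_compact_support:
  fixes k :: "complex \<Rightarrow> 'b::euclidean_space"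
  assumes "continuous_on UNIV k" "\<And>z. d \<le> cmod z \<Longrightarrow> k z = 0"
  shows "integrable lborel k"
proof -
  have "integrable lborel (\<lambda>z. indicator (cball 0 d) z *\<^sub>R k z)"
    using assms(1) by (intro borel_integrable_compact) (auto intro: continuous_on_subset)
  moreover have "(\<lambda>z. indicator (cball 0 d) z *\<^sub>R k z) = k"
    using assms(2) by (auto simp: fun_eq_iff indicator_def)
  ultimately show ?thesis by simp
qed

lemma integrable_bump: "0 < d \<Longrightarrow> integrable lborel (bump p d)"
  by (rule integrable_compact_support[of _ d]) (auto intro!: continuous_intros bump_eq_0)

lemma bump_1_integral_pos:
  assumes "0 < d" shows "0 < (LBINT z. bump 1 d z)"
proof -
  have ne: "bump 1 d z \<noteq> 0" if "z \<in> ball 0 d" for z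
  proof -
    have "(cmod z)\<^sup>2 < d\<^sup>2" using that by (intro power_strict_mono) auto
    then show ?thesis by (simp add: bump_def flat_exp_def cmod_power2[symmetric] del: power_strict_mono)
  qed
  have "\<not> (AE z in lborel. bump 1 d z = 0)"
  proof
    assume "AE z in lborel. bump 1 d z = 0"
    then have "AE z in lborel. z \<notin> ball (0::complex) d" by eventually_elim (use ne in blast)
    then have "emeasure lborel (ball (0::complex) d) = 0"
      by (subst (asm) AE_iff_measurable[of "ball 0 d"]) auto
    then show False using assms by (simp add: emeasure_ball unit_ball_vol_2)
  qed
  moreover have nn: "0 \<le> bump 1 d z" for z by (auto simp: bump_def flat_exp_def)
  ultimately show ?thesis
    using integral_nonneg_eq_0_iff_AE[OF integrable_bump[OF assms, of 1]]
    by (metis (no_types, lifting) AE_I2 integral_nonneg_AE less_eq_real_def)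
qed

lemma mollifier_altdef: "mollifier d z = bump 1 d z / (LBINT z. bump 1 d z)"
  by (simp add: mollifier_def mollifier_poly_def bump_def flat_exp_def)

lemma mollifier_nonneg: "0 < d \<Longrightarrow> 0 \<le> mollifier d z"
  using bump_1_integral_pos[of d] by (auto simp: mollifier_altdef) (auto simp: bump_def flat_exp_def)

lemma mollifier_eq_0: "0 < d \<Longrightarrow> d \<le> cmod z \<Longrightarrow> mollifier d z = 0"
  by (simp add: mollifier_def bump_eq_0)

lemma continuous_on_mollifier [continuous_intros]:
  "continuous_on S f \<Longrightarrow> continuous_on S (\<lambda>x. mollifier d (f x))"
  unfolding mollifier_def by (intro continuous_intros)

lemma borel_measurable_mollifier [measurable]: "mollifier d \<in> borel_measurable borel"
  unfolding mollifier_def by simp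

lemma integrable_mollifier: "0 < d \<Longrightarrow> integrable lborel (mollifier d)"
  unfolding mollifier_def by (rule integrable_bump)

lemma integral_mollifier: "0 < d \<Longrightarrow> (LBINT z. mollifier d (x - z)) = 1"
  using bump_1_integral_pos[of d] by (subst integral_lborel_reflect) (auto simp: mollifier_altdef[abs_def])

lemma nn_integral_mollifier: "0 < d \<Longrightarrow> (\<integral>\<^sup>+z. mollifier d (x - z) \<partial>lborel) = 1"
proof -
  assume d: "0 < d"
  have "(\<integral>\<^sup>+z. mollifier d (x - z) \<partial>lborel) = (\<integral>\<^sup>+z. mollifier d z \<partial>lborel)"
    by (rule nn_integral_lborel_reflect[of "\<lambda>z. ennreal (mollifier d z)"]) simp
  also have "\<dots> = ennreal (LBINT z. mollifier d z)"
    using integrable_mollifier[OF d] mollifier_nonneg[OF d] by (intro nn_integral_eq_integral) auto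
  also have "(LBINT z. mollifier d z) = 1"
    using integral_mollifier[OF d, of 0] by (subst (asm) integral_lborel_reflect) auto
  finally show ?thesis by simp
qed

lemma nn_integral_mollifier': "0 < d \<Longrightarrow> (\<integral>\<^sup>+x. mollifier d (x - z) \<partial>lborel) = 1"
proof -
  assume d: "0 < d"
  have "mollifier d (x - z) = mollifier d (z - x)" for x
    by (simp add: mollifier_def bump_def power2_commute)
  then show ?thesis using nn_integral_mollifier[OF d, of z] by simp
qed

lemma mollifier_bounded: assumes "0 < d" obtains L where "\<And>z. \<bar>mollifier d z\<bar> \<le> L"
  using continuous_compact_support_bounded[OF continuous_on_mollifier[OF continuous_on_id] mollifier_eq_0[OF assms]]
  by blast

lemma integrable_mollifier_mult:
  fixes g :: "complex \<Rightarrow> 'b::{banach, second_countable_topology}"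
  assumes "0 < d" "integrable lborel g"
  shows "integrable lborel (\<lambda>z. mollifier d (x - z) *\<^sub>R g z)"
proof -
  obtain L where "\<And>z. \<bar>mollifier d z\<bar> \<le> L" using mollifier_bounded[OF assms(1)] by blast
  from integrable_kernel[where k = "mollifier d", OF continuous_on_mollifier[OF continuous_on_id] this, where m = "\<lambda>z. z" and M = lborel and g = g] assms(2) show ?thesis
    by simp
qed

lemma continuous_on_moll:
  fixes g :: "complex \<Rightarrow> 'b::{banach, second_countable_topology}"
  assumes "0 < d" "integrable lborel g"
  shows "continuous_on S (moll d g)"
proof -
  obtain L where "\<And>z. \<bar>mollifier d z\<bar> \<le> L" using mollifier_bounded[OF assms(1)] by blast
  from continuous_integral_kernel[where k = "mollifier d", OF continuous_on_mollifier[OF continuous_on_id] this, where m = "\<lambda>z. z" and M = lborel and g = g] assms(2) show ?thesis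
    unfolding moll_def[abs_def] by simp
qed

lemma borel_measurable_moll:
  fixes g :: "complex \<Rightarrow> 'b::{banach, second_countable_topology}"
  assumes "0 < d" "integrable lborel g"
  shows "moll d g \<in> borel_measurable borel"
  using continuous_on_moll[OF assms] by (rule borel_measurable_continuous_onI)

lemma moll_add:
  fixes f g :: "complex \<Rightarrow> 'b::{banach, second_countable_topology}"
  assumes "0 < d" "integrable lborel f" "integrable lborel g"
  shows "moll d (\<lambda>z. f z + g z) x = moll d f x + moll d g x"
  using integrable_mollifier_mult[OF assms(1,2)] integrable_mollifier_mult[OF assms(1,3)]
  by (simp add: moll_def scaleR_add_right)

lemma moll_diff:
  fixes f g :: "complex \<Rightarrow> 'b::{banach, second_countable_topology}"
  assumes "0 < d" "integrable lborel f" "integrable lborel g"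
  shows "moll d (\<lambda>z. f z - g z) x = moll d f x - moll d g x"
  using integrable_mollifier_mult[OF assms(1,2)] integrable_mollifier_mult[OF assms(1,3)]
  by (simp add: moll_def scaleR_diff_right)

text \<open>Tonelli and the unit mass of the kernel. This contraction property is what allows
  approximation arguments in L^1.\<close>

lemma nn_integral_moll_le:
  fixes g :: "complex \<Rightarrow> 'b::{banach, second_countable_topology}"
  assumes d: "0 < d" and g: "integrable lborel g"
  shows "(\<integral>\<^sup>+x. norm (moll d g x) \<partial>lborel) \<le> (\<integral>\<^sup>+x. norm (g x) \<partial>lborel)"
proof -
  have [measurable]: "g \<in> borel_measurable borel" using g by auto
  have "ennreal (norm (moll d g x)) \<le> (\<integral>\<^sup>+z. ennreal (mollifier d (x - z)) * norm (g z) \<partial>lborel)" for x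
  proof -
    have "ennreal (norm (moll d g x)) \<le> ennreal (LBINT z. norm (mollifier d (x - z) *\<^sub>R g z))"
      unfolding moll_def by (intro ennreal_leI integral_norm_bound)
    also have "\<dots> = (\<integral>\<^sup>+z. norm (mollifier d (x - z) *\<^sub>R g z) \<partial>lborel)"
      by (intro nn_integral_eq_integral[symmetric] integrable_norm integrable_mollifier_mult[OF d g]) auto
    also have "\<dots> = (\<integral>\<^sup>+z. ennreal (mollifier d (x - z)) * norm (g z) \<partial>lborel)"
      using mollifier_nonneg[OF d] by (simp add: ennreal_mult)
    finally show ?thesis .
  qed
  then have "(\<integral>\<^sup>+x. norm (moll d g x) \<partial>lborel) \<le>
      (\<integral>\<^sup>+x. (\<integral>\<^sup>+z. ennreal (mollifier d (x - z)) * norm (g z) \<partial>lborel) \<partial>lborel)"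
    by (intro nn_integral_mono)
  also have "\<dots> = (\<integral>\<^sup>+z. (\<integral>\<^sup>+x. ennreal (mollifier d (x - z)) * norm (g z) \<partial>lborel) \<partial>lborel)"
    by (rule lborel_pair.Fubini') measurable
  also have "\<dots> = (\<integral>\<^sup>+z. norm (g z) \<partial>lborel)"
    by (simp add: nn_integral_multc nn_integral_mollifier'[OF d])
  finally show ?thesis .
qed

text \<open>The difference is an average of \<open>g - c\<close> against a probability density that
  lives on the ball of radius \<open>d\<close> around \<open>x\<close>, so a bound on that ball is
  enough. It gives uniform convergence on compact sets, and exact agreement where \<open>g\<close>
  is locally constant.\<close>

lemma norm_moll_minus_le:
  fixes g :: "complex \<Rightarrow> 'b::{banach, second_countable_topology}"
  assumes d: "0 < d" and g: "integrable lborel g" and e: "\<And>z. dist z x < d \<Longrightarrow> norm (g z - c) \<le> e"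
  shows "norm (moll d g x - c) \<le> e"
proof -
  have int: "integrable lborel (\<lambda>z. mollifier d (x - z))"
  proof -
    have "integrable lborel (\<lambda>z. mollifier d (z - x))"
    proof (rule integrable_compact_support)
      show "mollifier d (z - x) = 0" if "d + cmod x \<le> cmod z" for z
        using that norm_triangle_ineq2[of z x] by (intro mollifier_eq_0[OF d]) linarith
    qed (intro continuous_intros)
    moreover have "mollifier d (z - x) = mollifier d (x - z)" for z
      by (simp add: mollifier_def bump_def power2_commute)
    ultimately show ?thesis by simp
  qed
  have "moll d g x - c = (LBINT z. mollifier d (x - z) *\<^sub>R g z) - (LBINT z. mollifier d (x - z)) *\<^sub>R c"
    by (simp add: moll_def integral_mollifier[OF d])
  also have "\<dots> = (LBINT z. mollifier d (x - z) *\<^sub>R (g z - c))"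
    using int integrable_mollifier_mult[OF d g, of x] by (simp add: scaleR_diff_right)
  also have "norm \<dots> \<le> (LBINT z. mollifier d (x - z) * e)"
  proof (rule Bochner_Integration.integral_norm_bound_integral)
    show "integrable lborel (\<lambda>z. mollifier d (x - z) *\<^sub>R (g z - c))"
      using int integrable_mollifier_mult[OF d g, of x] by (simp add: scaleR_diff_right)
    show "integrable lborel (\<lambda>z. mollifier d (x - z) * e)" using int by simp
    show "norm (mollifier d (x - z) *\<^sub>R (g z - c)) \<le> mollifier d (x - z) * e" for z
      using mollifier_eq_0[OF d, of "x - z"] mollifier_nonneg[OF d, of "x - z"] e[of z]
      by (cases "dist z x < d") (auto simp: dist_norm norm_minus_commute intro!: mult_left_mono)
  qed
  also have "\<dots> = e" by (simp add: integral_mollifier[OF d])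
  finally show ?thesis .
qed

section \<open>Convergence of mollifications in L^1\<close>

lemma ennreal_tendsto_0I:
  fixes f :: "'a \<Rightarrow> ennreal"
  assumes "\<And>e::real. 0 < e \<Longrightarrow> eventually (\<lambda>x. f x \<le> ennreal e) F"
  shows "(f \<longlongrightarrow> 0) F"
proof (rule order_tendstoI)
  fix a :: ennreal assume "0 < a"
  then obtain b where b: "0 < b" "b < a" using dense by blast
  then obtain r where r: "b = ennreal r" "0 \<le> r" by (cases b) auto
  then have "0 < r" using b by auto
  from assms[OF this] show "eventually (\<lambda>x. f x < a) F"
    by eventually_elim (use b r in auto)
qed simp

lemma ennreal_tendsto_0D:
  fixes f :: "'a \<Rightarrow> ennreal"
  assumes "(f \<longlongrightarrow> 0) F" "0 < e"
  shows "eventually (\<lambda>x. f x \<le> ennreal e) F"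
  using order_tendstoD(2)[OF assms(1), of "ennreal e"] assms(2) by (auto elim: eventually_mono)

definition moll_L1 :: "(nat \<Rightarrow> real) \<Rightarrow> (complex \<Rightarrow> 'b::{banach, second_countable_topology}) \<Rightarrow> bool" where
  "moll_L1 d g \<longleftrightarrow> (\<lambda>n. \<integral>\<^sup>+x. norm (moll (d n) g x - g x) \<partial>lborel) \<longlonglongrightarrow> 0"

text \<open>Three-epsilon argument: by contraction the mollification error of \<open>g\<close>
  exceeds that of \<open>g'\<close> by at most twice the L^1 distance of the two.\<close>

lemma moll_L1_approx:
  fixes g :: "complex \<Rightarrow> 'b::{banach, second_countable_topology}"
  assumes d: "\<And>n. 0 < d n" and g: "integrable lborel g"
    and app: "\<And>e::real. 0 < e \<Longrightarrow> \<exists>g'. integrable lborel g' \<and> moll_L1 d g' \<and>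
                  (\<integral>\<^sup>+x. norm (g x - g' x) \<partial>lborel) \<le> ennreal e"
  shows "moll_L1 d g"
  unfolding moll_L1_def
proof (rule ennreal_tendsto_0I)
  fix e :: real assume "0 < e"
  then obtain g' where g': "integrable lborel g'" "moll_L1 d g'"
      "(\<integral>\<^sup>+x. norm (g x - g' x) \<partial>lborel) \<le> ennreal (e/3)"
    using app[of "e/3"] by auto
  note [measurable] = borel_measurable_integrable[OF g] borel_measurable_integrable[OF g'(1)]
  have "eventually (\<lambda>n. (\<integral>\<^sup>+x. norm (moll (d n) g' x - g' x) \<partial>lborel) \<le> ennreal (e/3)) sequentially"
    using ennreal_tendsto_0D[OF g'(2)[unfolded moll_L1_def], of "e/3"] \<open>0 < e\<close> by simp
  then show "eventually (\<lambda>n. (\<integral>\<^sup>+x. norm (moll (d n) g x - g x) \<partial>lborel) \<le> ennreal e) sequentially"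
  proof eventually_elim
    case (elim n)
    have [measurable]: "moll (d n) g' \<in> borel_measurable borel" "moll (d n) g \<in> borel_measurable borel"
      "moll (d n) (\<lambda>z. g z - g' z) \<in> borel_measurable borel"
      by (intro borel_measurable_moll d g g' Bochner_Integration.integrable_diff)+
    have "ennreal (norm (moll (d n) g x - g x)) \<le> norm (moll (d n) (\<lambda>z. g z - g' z) x) +
        (norm (moll (d n) g' x - g' x) + norm (g x - g' x))" for x
    proof -
      have eq: "moll (d n) g x - g x = moll (d n) (\<lambda>z. g z - g' z) x + ((moll (d n) g' x - g' x) - (g x - g' x))"
        by (simp add: moll_diff[OF d g g'(1)])
      have "norm (moll (d n) g x - g x) \<le> norm (moll (d n) (\<lambda>z. g z - g' z) x) +
        (norm (moll (d n) g' x - g' x) + norm (g x - g' x))"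
        unfolding eq by (intro order_trans[OF norm_triangle_ineq] add_left_mono norm_triangle_ineq4)
      then show ?thesis by (simp add: ennreal_plus[symmetric] del: ennreal_plus)
    qed
    then have "(\<integral>\<^sup>+x. norm (moll (d n) g x - g x) \<partial>lborel) \<le>
       (\<integral>\<^sup>+x. ennreal (norm (moll (d n) (\<lambda>z. g z - g' z) x)) +
        (ennreal (norm (moll (d n) g' x - g' x)) + ennreal (norm (g x - g' x))) \<partial>lborel)"
      by (intro nn_integral_mono) simp
    also have "\<dots> = (\<integral>\<^sup>+x. norm (moll (d n) (\<lambda>z. g z - g' z) x) \<partial>lborel) +
        ((\<integral>\<^sup>+x. norm (moll (d n) g' x - g' x) \<partial>lborel) + (\<integral>\<^sup>+x. norm (g x - g' x) \<partial>lborel))"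
      by (subst nn_integral_add, simp, simp)+ simp
    also have "\<dots> \<le> ennreal (e/3) + (ennreal (e/3) + ennreal (e/3))"
      by (intro add_mono elim g'(3) order_trans[OF nn_integral_moll_le[OF d]]
          Bochner_Integration.integrable_diff g g'(1))
    also have "\<dots> = ennreal e"
      using \<open>0 < e\<close> by (simp add: ennreal_plus[symmetric] del: ennreal_plus)
    finally show ?case .
  qed
qed

lemma moll_scaleR_const:
  fixes g :: "complex \<Rightarrow> real" and c :: "'b::{banach, second_countable_topology}"
  assumes "0 < d" "integrable lborel g"
  shows "moll d (\<lambda>z. g z *\<^sub>R c) x = moll d g x *\<^sub>R c"
proof -
  have "moll d (\<lambda>z. g z *\<^sub>R c) x = (LBINT z. (mollifier d (x - z) *\<^sub>R g z) *\<^sub>R c)"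
    by (simp add: moll_def)
  also have "\<dots> = moll d g x *\<^sub>R c"
    unfolding moll_def using integrable_mollifier_mult[OF assms, of x] by (intro integral_scaleR_left) simp
  finally show ?thesis .
qed

text \<open>Pointwise convergence may fail on the boundary of \<open>U\<close>, which can have
  positive measure. So only the positive part \<open>w n\<close> of the indicator minus its
  mollification is shown to converge, below the indicator itself. The rest follows from |a - b| = 2
  max(0, b - a) + (a - b), because mollification does not increase the total mass.\<close>

lemma moll_L1_indicator_open:
  assumes d: "\<And>n. 0 < d n" "d \<longlonglongrightarrow> 0" and U: "open U" "emeasure lborel U < \<infinity>"
  shows "moll_L1 d (indicator U :: complex \<Rightarrow> real)"
proof -
  let ?g = "indicator U :: complex \<Rightarrow> real"
  have g: "integrable lborel ?g" using U by (intro integrable_real_indicator) auto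
  have [measurable]: "U \<in> sets borel" "moll (d n) ?g \<in> borel_measurable borel" for n
    using U borel_measurable_moll[OF d(1) g] by auto
  have nonneg: "0 \<le> moll (d n) ?g x" for n x
    unfolding moll_def by (intro integral_nonneg_AE) (auto simp: mollifier_nonneg[OF d(1)])
  define w where "w n x = max 0 (?g x - moll (d n) ?g x)" for n x
  have [measurable]: "w n \<in> borel_measurable borel" for n unfolding w_def by measurable
  have wle: "0 \<le> w n x" "w n x \<le> ?g x" for n x
    using nonneg[of n x] by (auto simp: w_def)
  have wint: "integrable lborel (w n)" for n
    by (rule Bochner_Integration.integrable_bound[OF g]) (use wle in \<open>auto intro!: AE_I2\<close>)
  have lim: "(\<lambda>n. LBINT x. w n x) \<longlonglongrightarrow> (LBINT x::complex. 0)"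
  proof (rule integral_dominated_convergence[OF _ _ g])
    show "AE x in lborel. (\<lambda>n. w n x) \<longlonglongrightarrow> 0"
    proof (rule AE_I2)
      fix x
      show "(\<lambda>n. w n x) \<longlonglongrightarrow> 0"
      proof (cases "x \<in> U")
        case True
        then obtain r where r: "0 < r" "ball x r \<subseteq> U" using U(1) openE by blast
        have "eventually (\<lambda>n. d n < r) sequentially" using order_tendstoD(2)[OF d(2) r(1)] .
        then have "eventually (\<lambda>n. w n x = 0) sequentially"
        proof eventually_elim
          case (elim n)
          have "norm (moll (d n) ?g x - 1) \<le> 0"
          proof (rule norm_moll_minus_le[OF d(1) g])
            fix z assume "dist z x < d n"
            then have "z \<in> U" using elim r(2) by (auto simp: dist_commute)
            then show "norm (?g z - 1) \<le> 0" by simp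
          qed
          then show ?case using True by (simp add: w_def)
        qed
        then show ?thesis by (rule tendsto_eventually)
      next
        case False
        then show ?thesis using nonneg by (simp add: w_def max_absorb1)
      qed
    qed
    show "AE x in lborel. norm (w n x) \<le> ?g x" for n using wle by auto
  qed auto
  have bound: "(\<integral>\<^sup>+x. norm (moll (d n) ?g x - ?g x) \<partial>lborel) \<le> ennreal (2 * (LBINT x. w n x))" for n
  proof -
    have mint: "integrable lborel (moll (d n) ?g)"
      using nn_integral_moll_le[OF d(1) g, of n] g
      by (auto simp: integrable_iff_bounded intro: order.strict_trans1)
    have "(LBINT x. moll (d n) ?g x) \<le> (LBINT x. ?g x)"
    proof -
      have "ennreal (LBINT x. moll (d n) ?g x) \<le> ennreal (LBINT x. ?g x)"
        using nn_integral_moll_le[OF d(1) g, of n] mint g nonneg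
        by (simp add: nn_integral_eq_integral)
      then show ?thesis by (simp add: integral_nonneg_AE)
    qed
    have "(\<integral>\<^sup>+x. norm (moll (d n) ?g x - ?g x) \<partial>lborel) =
        (\<integral>\<^sup>+x. ennreal (2 * w n x + moll (d n) ?g x - ?g x) \<partial>lborel)"
      by (intro nn_integral_cong) (auto simp: w_def max_def)
    also have "\<dots> = ennreal (LBINT x. 2 * w n x + moll (d n) ?g x - ?g x)"
    proof (rule nn_integral_eq_integral)
      show "integrable lborel (\<lambda>x. 2 * w n x + moll (d n) ?g x - ?g x)" using wint mint g by simp
    qed (auto simp: w_def max_def)
    also have "(LBINT x. 2 * w n x + moll (d n) ?g x - ?g x) = 2 * (LBINT x. w n x) + (LBINT x. moll (d n) ?g x) - (LBINT x. ?g x)"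
      using wint mint g by simp
    also have "ennreal \<dots> \<le> ennreal (2 * (LBINT x. w n x))"
      using \<open>(LBINT x. moll (d n) ?g x) \<le> _\<close> by (intro ennreal_leI) simp
    finally show ?thesis .
  qed
  have "(\<lambda>n. ennreal (2 * (LBINT x. w n x))) \<longlonglongrightarrow> ennreal (2 * 0)"
    by (intro tendsto_ennrealI tendsto_mult tendsto_const) (use lim in simp)
  then have lim0: "(\<lambda>n. ennreal (2 * (LBINT x. w n x))) \<longlonglongrightarrow> 0" by simp
  show ?thesis
    unfolding moll_L1_def
    by (rule tendsto_sandwich[OF always_eventually always_eventually tendsto_const lim0])
       (use bound in simp_all)
qed

theorem moll_L1_integrable:
  fixes g :: "complex \<Rightarrow> 'b::{banach, second_countable_topology}"
  assumes d: "\<And>n. 0 < d n" "d \<longlonglongrightarrow> 0" and g: "integrable lborel g"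
  shows "moll_L1 d g"
  using g
proof (induction rule: integrable_induct)
  case (base A c)
  have A: "A \<in> sets borel" "emeasure lborel A < \<infinity>" using base by auto
  have intA: "integrable lborel (indicator A :: complex \<Rightarrow> real)"
    using A by (intro integrable_real_indicator) auto
  have "moll_L1 d (indicator A :: complex \<Rightarrow> real)"
  proof (rule moll_L1_approx[OF d(1) intA])
    fix e :: real assume "0 < e"
    obtain T where T: "open T" "A \<subseteq> T" "emeasure lebesgue (T - A) < ennreal e"
      using sets_lebesgue_outer_open[of A e] A \<open>0 < e\<close> by auto
    have TA: "emeasure lborel (T - A) < ennreal e" using T A by (simp add: emeasure_completion borel_open)
    have "emeasure lborel T \<le> emeasure lborel A + emeasure lborel (T - A)"
      using A T by (subst plus_emeasure) (auto simp: Un_absorb1 intro!: emeasure_mono)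
    then have Tfin: "emeasure lborel T < \<infinity>"
      using A TA by (auto simp: less_top[symmetric] top_unique)
    show "\<exists>g'. integrable lborel g' \<and> moll_L1 d g' \<and> (\<integral>\<^sup>+x. norm ((indicator A x :: real) - g' x) \<partial>lborel) \<le> ennreal e"
    proof (intro exI[of _ "indicator T"] conjI)
      show "integrable lborel (indicator T :: complex \<Rightarrow> real)"
        using T Tfin by (intro integrable_real_indicator) auto
      show "moll_L1 d (indicator T :: complex \<Rightarrow> real)" by (rule moll_L1_indicator_open[OF d T(1) Tfin])
      have "(\<integral>\<^sup>+x. norm ((indicator A x :: real) - indicator T x) \<partial>lborel) = (\<integral>\<^sup>+x. indicator (T - A) x \<partial>lborel)"
        using T by (intro nn_integral_cong) (auto simp: indicator_def)
      also have "\<dots> = emeasure lborel (T - A)" using A T by (intro nn_integral_indicator) auto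
      finally show "(\<integral>\<^sup>+x. norm ((indicator A x :: real) - indicator T x) \<partial>lborel) \<le> ennreal e" using TA by simp
    qed
  qed
  then have "(\<lambda>n. (\<integral>\<^sup>+x. ennreal (norm (moll (d n) (indicator A :: complex \<Rightarrow> real) x - indicator A x)) \<partial>lborel) * ennreal (norm c)) \<longlonglongrightarrow> 0 * ennreal (norm c)"
    unfolding moll_L1_def by (intro tendsto_mult_ennreal tendsto_const) auto
  moreover have [measurable]: "A \<in> sets borel" "moll (d n) (indicator A :: complex \<Rightarrow> real) \<in> borel_measurable borel" for n
    using A borel_measurable_moll[OF d(1) intA] by auto
  have "(\<integral>\<^sup>+x. norm (moll (d n) (\<lambda>x. indicator A x *\<^sub>R c) x - indicator A x *\<^sub>R c) \<partial>lborel) =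
      (\<integral>\<^sup>+x. ennreal (norm (moll (d n) (indicator A :: complex \<Rightarrow> real) x - indicator A x)) * ennreal (norm c) \<partial>lborel)" for n
    by (simp add: moll_scaleR_const[OF d(1) intA] scaleR_diff_left[symmetric] ennreal_mult)
  then have "(\<integral>\<^sup>+x. norm (moll (d n) (\<lambda>x. indicator A x *\<^sub>R c) x - indicator A x *\<^sub>R c) \<partial>lborel) =
      (\<integral>\<^sup>+x. ennreal (norm (moll (d n) (indicator A :: complex \<Rightarrow> real) x - indicator A x)) \<partial>lborel) * ennreal (norm c)" for n
    by (simp add: nn_integral_multc)
  ultimately show ?case unfolding moll_L1_def by simp
next
  case (add f g)
  show ?case
    unfolding moll_L1_def
  proof (rule tendsto_sandwich[OF _ _ tendsto_const])
    note [measurable] = borel_measurable_integrable[OF add.hyps(1)] borel_measurable_integrable[OF add.hyps(2)]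
    have [measurable]: "moll (d n) f \<in> borel_measurable borel" "moll (d n) g \<in> borel_measurable borel" for n
      by (intro borel_measurable_moll d add.hyps)+
    show "\<forall>\<^sub>F n in sequentially. (\<integral>\<^sup>+x. norm (moll (d n) (\<lambda>x. f x + g x) x - (f x + g x)) \<partial>lborel) \<le>
       (\<integral>\<^sup>+x. norm (moll (d n) f x - f x) \<partial>lborel) + (\<integral>\<^sup>+x. norm (moll (d n) g x - g x) \<partial>lborel)"
    proof (intro always_eventually allI)
      fix n
      have "(\<integral>\<^sup>+x. norm (moll (d n) (\<lambda>x. f x + g x) x - (f x + g x)) \<partial>lborel) \<le>
         (\<integral>\<^sup>+x. ennreal (norm (moll (d n) f x - f x)) + ennreal (norm (moll (d n) g x - g x)) \<partial>lborel)"
        by (intro nn_integral_mono)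
           (simp add: ennreal_plus[symmetric] moll_add[OF d(1) add.hyps] norm_diff_triangle_ineq del: ennreal_plus)
      also have "\<dots> = (\<integral>\<^sup>+x. norm (moll (d n) f x - f x) \<partial>lborel) + (\<integral>\<^sup>+x. norm (moll (d n) g x - g x) \<partial>lborel)"
        by (rule nn_integral_add) auto
      finally show "(\<integral>\<^sup>+x. norm (moll (d n) (\<lambda>x. f x + g x) x - (f x + g x)) \<partial>lborel) \<le> \<dots>" .
    qed
    show "(\<lambda>n. (\<integral>\<^sup>+x. norm (moll (d n) f x - f x) \<partial>lborel) + (\<integral>\<^sup>+x. norm (moll (d n) g x - g x) \<partial>lborel)) \<longlonglongrightarrow> 0"
      using tendsto_add[OF add.IH(1)[unfolded moll_L1_def] add.IH(2)[unfolded moll_L1_def]] by simp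
  qed simp
next
  case (lim f s)
  show ?case
  proof (rule moll_L1_approx[OF d(1)])
    show "integrable lborel f" by fact
    fix e :: real assume e: "0 < e"
    note [measurable] = borel_measurable_integrable[OF lim.hyps(1)] borel_measurable_integrable[OF lim.hyps(4)]
    have "(\<lambda>i. \<integral>\<^sup>+x. norm (f x - s i x) \<partial>lborel) \<longlonglongrightarrow> (nn_integral lborel (\<lambda>x::complex. 0))"
    proof (rule nn_integral_dominated_convergence[where w = "\<lambda>x. ennreal (3 * norm (f x))"])
      show "(\<integral>\<^sup>+x. ennreal (3 * norm (f x)) \<partial>lborel) < \<infinity>"
        using integrable_mult_right[OF integrable_norm[OF lim.hyps(4)], of 3]
        by (simp add: nn_integral_eq_integral)
      show "AE x in lborel. ennreal (norm (f x - s i x)) \<le> ennreal (3 * norm (f x))" for i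
        using lim.hyps(3)[of _ i] norm_triangle_ineq4[of "f _" "s i _"]
        by (intro AE_I2 ennreal_leI) (smt (verit) space_lborel UNIV_I)
      show "AE x in lborel. (\<lambda>i. ennreal (norm (f x - s i x))) \<longlonglongrightarrow> 0"
      proof (rule AE_I2)
        fix x :: complex
        have "(\<lambda>i. norm (f x - s i x)) \<longlonglongrightarrow> norm (f x - f x)"
          using lim.hyps(2)[of x] by (intro tendsto_intros) auto
        then show "(\<lambda>i. ennreal (norm (f x - s i x))) \<longlonglongrightarrow> 0"
          using tendsto_ennrealI by fastforce
      qed
    qed auto
    then have "(\<lambda>i. \<integral>\<^sup>+x. norm (f x - s i x) \<partial>lborel) \<longlonglongrightarrow> 0" by simp
    from ennreal_tendsto_0D[OF this e] obtain i where "(\<integral>\<^sup>+x. norm (f x - s i x) \<partial>lborel) \<le> ennreal e"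
      using eventually_sequentially by auto
    then show "\<exists>g'. integrable lborel g' \<and> moll_L1 d g' \<and> (\<integral>\<^sup>+x. norm (f x - g' x) \<partial>lborel) \<le> ennreal e"
      using lim.hyps(1) lim.IH by blast
  qed
qed

section \<open>Dominated subsequences that converge almost everywhere\<close>

lemma exists_fast_subseq:
  assumes "\<And>n::nat. eventually (P n) sequentially"
  shows "\<exists>r::nat \<Rightarrow> nat. strict_mono r \<and> (\<forall>n. P n (r n))"
proof -
  obtain N where N: "\<And>n m. N n \<le> m \<Longrightarrow> P n m"
    using assms unfolding eventually_sequentially by metis
  define r where "r = rec_nat (N 0) (\<lambda>n k. max (Suc k) (N (Suc n)))"
  have "r n < r (Suc n)" for n by (simp add: r_def)
  moreover have "N n \<le> r n" for n by (cases n) (auto simp: r_def)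
  ultimately show ?thesis
    using N by (intro exI[of _ r] conjI allI) (auto simp: strict_mono_Suc_iff)
qed

text \<open>Choosing integrals below 2^-n makes the sum of the chosen errors integrable. That sum is
  the majorant, and its finiteness almost everywhere forces its terms to 0. Both conclusions feed
  later uses of dominated convergence.\<close>

lemma L1_subseq_dominated:
  fixes e :: "nat \<Rightarrow> 'a \<Rightarrow> real"
  assumes [measurable]: "\<And>n. e n \<in> borel_measurable M" and nonneg: "\<And>n x. 0 \<le> e n x"
    and lim: "(\<lambda>n. \<integral>\<^sup>+x. e n x \<partial>M) \<longlonglongrightarrow> 0"
  obtains r G where "strict_mono r" "integrable M G"
    "AE x in M. \<forall>n. e (r n) x \<le> G x" "AE x in M. (\<lambda>n. e (r n) x) \<longlonglongrightarrow> 0"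
proof -
  have "\<exists>r::nat \<Rightarrow> nat. strict_mono r \<and> (\<forall>n. (\<integral>\<^sup>+x. e (r n) x \<partial>M) \<le> ennreal ((1/2) ^ n))"
    by (rule exists_fast_subseq) (rule ennreal_tendsto_0D[OF lim], simp)
  then obtain r :: "nat \<Rightarrow> nat" where r: "strict_mono r" "\<And>n. (\<integral>\<^sup>+x. e (r n) x \<partial>M) \<le> ennreal ((1/2) ^ n)"
    by blast
  define S where "S x = (\<Sum>n. ennreal (e (r n) x))" for x
  have [measurable]: "S \<in> borel_measurable M" unfolding S_def by measurable
  have "(\<integral>\<^sup>+x. S x \<partial>M) = (\<Sum>n. \<integral>\<^sup>+x. e (r n) x \<partial>M)"
    unfolding S_def by (rule nn_integral_suminf) measurable
  also have "\<dots> \<le> (\<Sum>n. ennreal ((1/2) ^ n))" using r(2) by (intro suminf_le) auto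
  also have "\<dots> = ennreal (\<Sum>n. (1/2) ^ n)" by (intro suminf_ennreal2) (auto intro: summable_geometric)
  finally have fin: "(\<integral>\<^sup>+x. S x \<partial>M) < \<infinity>" by (auto simp: top_unique less_top[symmetric])
  then have ae: "AE x in M. S x \<noteq> \<infinity>" by (intro nn_integral_PInf_AE) auto
  define G where "G x = enn2real (S x)" for x
  have [measurable]: "G \<in> borel_measurable M" unfolding G_def by measurable
  have SG: "AE x in M. S x = ennreal (G x)" using ae by eventually_elim (simp add: G_def less_top)
  have "(\<integral>\<^sup>+x. ennreal (norm (G x)) \<partial>M) = (\<integral>\<^sup>+x. S x \<partial>M)"
    using SG by (intro nn_integral_cong_AE) (auto simp: G_def)
  then have "integrable M G" using fin by (simp add: integrable_iff_bounded)
  moreover have "AE x in M. \<forall>n. e (r n) x \<le> G x"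
    using SG
  proof eventually_elim
    case (elim x)
    show ?case
    proof
      fix n
      have "ennreal (e (r n) x) \<le> S x"
        unfolding S_def by (rule order_trans[OF _ sum_le_suminf[where I = "{n}"]]) auto
      moreover have "0 \<le> G x" by (simp add: G_def)
      ultimately show "e (r n) x \<le> G x" unfolding elim by (simp only: ennreal_le_iff)
    qed
  qed
  moreover have "AE x in M. (\<lambda>n. e (r n) x) \<longlonglongrightarrow> 0"
    using ae
  proof eventually_elim
    case (elim x)
    then show ?case
      by (intro summable_LIMSEQ_zero summable_suminf_not_top) (auto simp: S_def nonneg)
  qed
  ultimately show ?thesis using r(1) that by blast
qed

section \<open>Derivatives of convolutions with the mollifier\<close>

definition conv :: "(complex \<Rightarrow> real) \<Rightarrow> (complex \<Rightarrow> 'b::{banach, second_countable_topology}) \<Rightarrow> complex \<Rightarrow> 'b" where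
  "conv k g x = (LBINT z. k (x - z) *\<^sub>R g z)"

lemma moll_eq_conv: "moll d = conv (mollifier d)"
  by (simp add: moll_def conv_def fun_eq_iff)

lemma conv_has_derivative:
  fixes g :: "complex \<Rightarrow> 'b::{banach, second_countable_topology}"
  assumes k: "\<And>z. (k has_derivative (\<lambda>v. Re v * kx z + Im v * ky z)) (at z)"
    and cont: "continuous_on UNIV kx" "continuous_on UNIV ky"
    and supp: "\<And>z. d \<le> cmod z \<Longrightarrow> k z = 0 \<and> kx z = 0 \<and> ky z = 0"
    and g: "integrable lborel g"
  shows "(conv k g has_derivative (\<lambda>v. Re v *\<^sub>R conv kx g x + Im v *\<^sub>R conv ky g x)) (at x)"
proof -
  have contk: "continuous_on UNIV k"
    using k by (meson continuous_at_imp_continuous_on has_derivative_continuous)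
  obtain L1 where L1: "\<And>z. \<bar>k z\<bar> \<le> L1" using continuous_compact_support_bounded[OF contk] supp by metis
  obtain L2 where L2: "\<And>z. \<bar>kx z\<bar> \<le> L2" using continuous_compact_support_bounded[OF cont(1)] supp by metis
  obtain L3 where L3: "\<And>z. \<bar>ky z\<bar> \<le> L3" using continuous_compact_support_bounded[OF cont(2)] supp by metis
  define L where "L = max L1 (max L2 L3)"
  have "\<bar>k z\<bar> \<le> L" "\<bar>kx z\<bar> \<le> L" "\<bar>ky z\<bar> \<le> L" for z
    using L1[of z] L2[of z] L3[of z] by (auto simp: L_def)
  from has_derivative_integral_kernel[OF k cont this, where M = lborel and m = "\<lambda>z. z", OF _ g, of x]
  show ?thesis unfolding conv_def[abs_def] by simp
qed

lemma continuous_on_conv: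
  fixes g :: "complex \<Rightarrow> 'b::{banach, second_countable_topology}"
  assumes cont: "continuous_on UNIV k" and supp: "\<And>z. d \<le> cmod z \<Longrightarrow> k z = 0"
    and g: "integrable lborel g"
  shows "continuous_on S (conv k g)"
proof -
  obtain L where L: "\<And>z. \<bar>k z\<bar> \<le> L" using continuous_compact_support_bounded[OF cont] supp by metis
  from continuous_integral_kernel[OF cont L, where M = lborel and m = "\<lambda>z. z", OF _ g]
  show ?thesis unfolding conv_def[abs_def] by simp
qed

text \<open>Second derivatives enter because the Jacobian of a mollified map is written as a
  divergence. The single \<open>mollifier_xy\<close> serves both mixed derivatives, which lets the
  mixed terms cancel there.\<close>

definition mollifier_x :: "real \<Rightarrow> complex \<Rightarrow> real" where
  "mollifier_x d z = - 2 * Re z * bump (flat_deriv_poly (mollifier_poly d)) d z"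
definition mollifier_y :: "real \<Rightarrow> complex \<Rightarrow> real" where
  "mollifier_y d z = - 2 * Im z * bump (flat_deriv_poly (mollifier_poly d)) d z"
definition mollifier_xx :: "real \<Rightarrow> complex \<Rightarrow> real" where
  "mollifier_xx d z = - 2 * bump (flat_deriv_poly (mollifier_poly d)) d z + 4 * (Re z)\<^sup>2 * bump (flat_deriv_poly (flat_deriv_poly (mollifier_poly d))) d z"
definition mollifier_xy :: "real \<Rightarrow> complex \<Rightarrow> real" where
  "mollifier_xy d z = 4 * Re z * Im z * bump (flat_deriv_poly (flat_deriv_poly (mollifier_poly d))) d z"
definition mollifier_yy :: "real \<Rightarrow> complex \<Rightarrow> real" where
  "mollifier_yy d z = - 2 * bump (flat_deriv_poly (mollifier_poly d)) d z + 4 * (Im z)\<^sup>2 * bump (flat_deriv_poly (flat_deriv_poly (mollifier_poly d))) d z"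

lemmas mollifier_deriv_defs = mollifier_x_def mollifier_y_def mollifier_xx_def mollifier_xy_def mollifier_yy_def

lemma continuous_on_mollifier_derivs:
  "continuous_on S (mollifier_x d)" "continuous_on S (mollifier_y d)" "continuous_on S (mollifier_xx d)"
  "continuous_on S (mollifier_xy d)" "continuous_on S (mollifier_yy d)"
  unfolding mollifier_deriv_defs[abs_def] by (intro continuous_intros)+

lemma mollifier_derivs_eq_0:
  assumes "0 < d" "d \<le> cmod z"
  shows "mollifier_x d z = 0" "mollifier_y d z = 0" "mollifier_xx d z = 0" "mollifier_xy d z = 0" "mollifier_yy d z = 0"
  using bump_eq_0[OF assms] by (auto simp: mollifier_deriv_defs)

lemma has_derivative_mollifier:
  "(mollifier d has_derivative (\<lambda>v. Re v * mollifier_x d z + Im v * mollifier_y d z)) (at z)"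
  unfolding mollifier_def mollifier_x_def mollifier_y_def by (rule has_derivative_bump)

lemma has_derivative_mollifier_derivs:
  "(mollifier_x d has_derivative (\<lambda>v. Re v * mollifier_xx d z + Im v * mollifier_xy d z)) (at z)"
  "(mollifier_y d has_derivative (\<lambda>v. Re v * mollifier_xy d z + Im v * mollifier_yy d z)) (at z)"
proof -
  note * = has_derivative_bump[of "flat_deriv_poly (mollifier_poly d)" d z]
  have r: "(Re has_derivative Re) (at z)" "(Im has_derivative Im) (at z)"
    by (auto intro!: derivative_eq_intros)
  have "((\<lambda>z. (- 2 * Re z) * bump (flat_deriv_poly (mollifier_poly d)) d z) has_derivative
     (\<lambda>v. Re v * mollifier_xx d z + Im v * mollifier_xy d z)) (at z)"
    by (rule has_derivative_eq_rhs[OF has_derivative_mult[OF has_derivative_mult_right[OF r(1)] *]])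
       (simp add: mollifier_deriv_defs fun_eq_iff algebra_simps power2_eq_square)
  then show "(mollifier_x d has_derivative (\<lambda>v. Re v * mollifier_xx d z + Im v * mollifier_xy d z)) (at z)"
    by (simp add: mollifier_x_def[abs_def])
  have "((\<lambda>z. (- 2 * Im z) * bump (flat_deriv_poly (mollifier_poly d)) d z) has_derivative
     (\<lambda>v. Re v * mollifier_xy d z + Im v * mollifier_yy d z)) (at z)"
    by (rule has_derivative_eq_rhs[OF has_derivative_mult[OF has_derivative_mult_right[OF r(2)] *]])
       (simp add: mollifier_deriv_defs fun_eq_iff algebra_simps power2_eq_square)
  then show "(mollifier_y d has_derivative (\<lambda>v. Re v * mollifier_xy d z + Im v * mollifier_yy d z)) (at z)"
    by (simp add: mollifier_y_def[abs_def])
qed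

lemma has_derivative_moll:
  fixes g :: "complex \<Rightarrow> 'b::{banach, second_countable_topology}"
  assumes d: "0 < d" and g: "integrable lborel g"
  shows "(moll d g has_derivative (\<lambda>v. Re v *\<^sub>R conv (mollifier_x d) g x + Im v *\<^sub>R conv (mollifier_y d) g x)) (at x)"
    and "(conv (mollifier_x d) g has_derivative (\<lambda>v. Re v *\<^sub>R conv (mollifier_xx d) g x + Im v *\<^sub>R conv (mollifier_xy d) g x)) (at x)"
    and "(conv (mollifier_y d) g has_derivative (\<lambda>v. Re v *\<^sub>R conv (mollifier_xy d) g x + Im v *\<^sub>R conv (mollifier_yy d) g x)) (at x)"
  unfolding moll_eq_conv
  by (rule conv_has_derivative[where d = d], use continuous_on_mollifier_derivs mollifier_derivs_eq_0[OF d] mollifier_eq_0[OF d] g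
      has_derivative_mollifier has_derivative_mollifier_derivs in auto)+

lemma continuous_on_conv_mollifier_derivs:
  fixes g :: "complex \<Rightarrow> 'b::{banach, second_countable_topology}"
  assumes d: "0 < d" and g: "integrable lborel g"
  shows "continuous_on S (conv (mollifier_x d) g)" "continuous_on S (conv (mollifier_y d) g)"
    "continuous_on S (conv (mollifier_xx d) g)" "continuous_on S (conv (mollifier_xy d) g)" "continuous_on S (conv (mollifier_yy d) g)"
  by (rule continuous_on_conv[where d = d, OF continuous_on_mollifier_derivs(1) _ g] continuous_on_conv[where d = d, OF continuous_on_mollifier_derivs(2) _ g]
      continuous_on_conv[where d = d, OF continuous_on_mollifier_derivs(3) _ g] continuous_on_conv[where d = d, OF continuous_on_mollifier_derivs(4) _ g]
      continuous_on_conv[where d = d, OF continuous_on_mollifier_derivs(5) _ g]; use mollifier_derivs_eq_0[OF d] in auto)+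

section \<open>Integrals of compactly supported derivatives\<close>

lemma partial_derivs_outside_support:
  fixes F Fx Fy :: "complex \<Rightarrow> real"
  assumes F: "\<And>z. (F has_derivative (\<lambda>v. Re v * Fx z + Im v * Fy z)) (at z)"
    and supp: "\<And>z. s \<le> cmod z \<Longrightarrow> F z = 0" and z: "s < cmod z"
  shows "Fx z = 0" "Fy z = 0"
proof -
  have "open {z::complex. s < cmod z}" by (intro open_Collect_less continuous_intros)
  then have "(F has_derivative (\<lambda>v. 0)) (at z)"
    by (rule has_derivative_transform_within_open[OF has_derivative_const, of _ _ 0]) (use z supp in auto)
  from has_derivative_unique[OF F this] have 0: "Re v * Fx z + Im v * Fy z = 0" for v by meson
  show "Fx z = 0" "Fy z = 0" using 0[of 1] 0[of \<i>] by auto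
qed

text \<open>By translation invariance the integral of \<open>F (x + z)\<close> over \<open>z\<close>
  does not depend on \<open>x\<close>. Differentiating it at \<open>x = 0\<close> under the integral
  sign produces the two integrals.\<close>

lemma integral_partial_derivs_eq_0_real:
  fixes F Fx Fy :: "complex \<Rightarrow> real"
  assumes F: "\<And>z. (F has_derivative (\<lambda>v. Re v * Fx z + Im v * Fy z)) (at z)"
    and cont: "continuous_on UNIV Fx" "continuous_on UNIV Fy"
    and supp: "\<And>z. s \<le> cmod z \<Longrightarrow> F z = 0"
  shows "(LBINT z. Fx z) = 0" "(LBINT z. Fy z) = 0"
proof -
  note Fxy = partial_derivs_outside_support[OF F supp]
  have contF: "continuous_on UNIV F"
    using F by (meson continuous_at_imp_continuous_on has_derivative_continuous)
  have [measurable]: "F \<in> borel_measurable borel" using contF by (rule borel_measurable_continuous_onI)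
  obtain L1 where L1: "\<And>z. \<bar>F z\<bar> \<le> L1" using continuous_compact_support_bounded[OF contF] supp by metis
  have "Fx z = 0" "Fy z = 0" if "s + 1 \<le> cmod z" for z using Fxy that by auto
  then obtain L2 L3 where L2: "\<And>z. \<bar>Fx z\<bar> \<le> L2" and L3: "\<And>z. \<bar>Fy z\<bar> \<le> L3"
    using continuous_compact_support_bounded[OF cont(1)] continuous_compact_support_bounded[OF cont(2)] by metis
  define L where "L = max L1 (max L2 L3)"
  have L: "\<bar>F z\<bar> \<le> L" "\<bar>Fx z\<bar> \<le> L" "\<bar>Fy z\<bar> \<le> L" for z
    using L1[of z] L2[of z] L3[of z] by (auto simp: L_def)
  \<comment> \<open>The indicator is the integrable density demanded by the kernel lemma; the radius
    \<open>s + 1\<close> leaves room for translations of length below 1. The double negation in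
    \<open>I\<close> fits the pattern \<open>x - m z\<close>.\<close>
  let ?c = "indicator (cball 0 (s + 1)) :: complex \<Rightarrow> real"
  have c: "integrable lborel ?c"
    by (intro integrable_real_indicator emeasure_lborel_cball_finite) auto
  define I where "I x = (LBINT z. F (x - (- z)) *\<^sub>R ?c z)" for x
  have dI: "(I has_derivative (\<lambda>v. Re v *\<^sub>R (LBINT z. Fx (0 - (- z)) *\<^sub>R ?c z) + Im v *\<^sub>R (LBINT z. Fy (0 - (- z)) *\<^sub>R ?c z))) (at 0)"
    unfolding I_def[abs_def]
    by (rule has_derivative_integral_kernel[OF F cont L _ c]) auto
  have "I x = (LBINT z. F z)" if "x \<in> ball 0 1" for x
  proof -
    have eq: "F (x - (- z)) *\<^sub>R ?c z = F (x + z)" for z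
    proof (cases "z \<in> cball 0 (s + 1)")
      case False
      have "cmod z \<le> cmod (x + z) + cmod x" using norm_triangle_ineq4[of "x + z" x] by simp
      then have "s \<le> cmod (x + z)" using that False by auto
      then show ?thesis using False supp by simp
    qed auto
    have "I x = (LBINT z. F (x + z))" unfolding I_def by (simp only: eq)
    also have "\<dots> = (LBINT z. F z)"
      by (subst (2) lborel_distr_plus[of x, symmetric], subst integral_distr) auto
    finally show ?thesis .
  qed
  then have "(I has_derivative (\<lambda>v. 0)) (at 0)"
    by (intro has_derivative_transform_within_open[OF has_derivative_const open_ball, of _ 0 1 "LBINT z. F z"]) auto
  from has_derivative_unique[OF dI this]
  have 0: "Re v *\<^sub>R (LBINT z. Fx (0 - (- z)) *\<^sub>R ?c z) + Im v *\<^sub>R (LBINT z. Fy (0 - (- z)) *\<^sub>R ?c z) = 0" for v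
    by meson
  have "Fx (0 - (- z)) *\<^sub>R ?c z = Fx z" "Fy (0 - (- z)) *\<^sub>R ?c z = Fy z" for z
    using Fxy[where z = z] by (auto simp: indicator_def)
  then show "(LBINT z. Fx z) = 0" "(LBINT z. Fy z) = 0"
    using 0[of 1] 0[of \<i>] by (simp_all only: one_complex.sel imaginary_unit.sel scaleR_one scaleR_zero_left add_0_left add_0_right)
qed

lemma integral_partial_derivs_eq_0:
  fixes F Fx Fy :: "complex \<Rightarrow> complex"
  assumes F: "\<And>z. (F has_derivative (\<lambda>v. Re v *\<^sub>R Fx z + Im v *\<^sub>R Fy z)) (at z)"
    and cont: "continuous_on UNIV Fx" "continuous_on UNIV Fy"
    and supp: "\<And>z. s \<le> cmod z \<Longrightarrow> F z = 0" "\<And>z. s \<le> cmod z \<Longrightarrow> Fx z = 0" "\<And>z. s \<le> cmod z \<Longrightarrow> Fy z = 0"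
  shows "(LBINT z. Fx z) = 0" "(LBINT z. Fy z) = 0"
proof -
  have ix: "integrable lborel Fx" "integrable lborel Fy"
    using integrable_compact_support cont supp by blast+
  have "((\<lambda>z. Re (F z)) has_derivative (\<lambda>v. Re v * Re (Fx z) + Im v * Re (Fy z))) (at z)"
    "((\<lambda>z. Im (F z)) has_derivative (\<lambda>v. Re v * Im (Fx z) + Im v * Im (Fy z))) (at z)" for z
    using has_derivative_Re[OF F[of z]] has_derivative_Im[OF F[of z]] by auto
  note r = integral_partial_derivs_eq_0_real[OF this(1), of s] integral_partial_derivs_eq_0_real[OF this(2), of s]
  have "(LBINT z. Re (Fx z)) = 0" "(LBINT z. Im (Fx z)) = 0" "(LBINT z. Re (Fy z)) = 0" "(LBINT z. Im (Fy z)) = 0"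
    using r cont supp by (auto intro!: continuous_intros)
  then show "(LBINT z. Fx z) = 0" "(LBINT z. Fy z) = 0"
    using integral_Re[OF ix(1)] integral_Im[OF ix(1)] integral_Re[OF ix(2)] integral_Im[OF ix(2)]
    by (auto simp: complex_eq_iff)
qed

text \<open>Jensen's inequality, by expanding the nonnegative variance of \<open>g\<close> around
  its own average \<open>m\<close>. It bounds squared derivatives of a mollified map by something
  that converges in L^1.\<close>

lemma norm_moll_sq_le:
  fixes g :: "complex \<Rightarrow> complex"
  assumes d: "0 < d" and g: "integrable lborel g" and g2: "integrable lborel (\<lambda>z. (cmod (g z))\<^sup>2)"
  shows "(cmod (moll d g x))\<^sup>2 \<le> moll d (\<lambda>z. (cmod (g z))\<^sup>2) x"
proof -
  define m where "m = moll d g x"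
  have ig: "integrable lborel (\<lambda>z. mollifier d (x - z) *\<^sub>R g z)"
    "integrable lborel (\<lambda>z. mollifier d (x - z) *\<^sub>R (cmod (g z))\<^sup>2)"
    using integrable_mollifier_mult[OF d g] integrable_mollifier_mult[OF d g2] by auto
  \<comment> \<open>The integral of a non-integrable function is 0 by convention, so the value 1
    forces integrability.\<close>
  have i1: "integrable lborel (\<lambda>z. mollifier d (x - z))"
    using integral_mollifier[OF d, of x] not_integrable_integral_eq by fastforce
  have i3: "integrable lborel (\<lambda>z. m \<bullet> (mollifier d (x - z) *\<^sub>R g z))"
    using ig(1) by (intro integrable_inner_right) 
  have eq: "mollifier d (x - z) * (cmod (g z - m))\<^sup>2 = mollifier d (x - z) *\<^sub>R (cmod (g z))\<^sup>2
      - 2 * (m \<bullet> (mollifier d (x - z) *\<^sub>R g z)) + (cmod m)\<^sup>2 * mollifier d (x - z)" for z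
    by (simp add: power2_norm_eq_inner inner_diff_left inner_diff_right inner_commute algebra_simps)
  have "0 \<le> (LBINT z. mollifier d (x - z) * (cmod (g z - m))\<^sup>2)"
    using mollifier_nonneg[OF d] by (intro integral_nonneg_AE) auto
  also have "\<dots> = (LBINT z. mollifier d (x - z) *\<^sub>R (cmod (g z))\<^sup>2) - 2 * (LBINT z. m \<bullet> (mollifier d (x - z) *\<^sub>R g z))
     + (cmod m)\<^sup>2 * (LBINT z. mollifier d (x - z))"
    unfolding eq using ig(2) i1 i3
    by (subst Bochner_Integration.integral_add Bochner_Integration.integral_diff, (simp; fail), (simp; fail))+ simp
  also have "(LBINT z. m \<bullet> (mollifier d (x - z) *\<^sub>R g z)) = m \<bullet> m"
    using ig(1) by (subst integral_inner_right) (auto simp: m_def moll_def)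
  also have "(LBINT z. mollifier d (x - z) *\<^sub>R (cmod (g z))\<^sup>2) = moll d (\<lambda>z. (cmod (g z))\<^sup>2) x" by (simp add: moll_def)
  finally show ?thesis
    by (simp add: m_def[symmetric] integral_mollifier[OF d] power2_norm_eq_inner)
qed

subsection \<open>Lines, null gradients and Borel representatives\<close>

text \<open>The flag selects vertical (True) or horizontal (False) lines; the first real argument names the
  line, the second the position on it.\<close>

definition line_pt :: "bool \<Rightarrow> real \<Rightarrow> real \<Rightarrow> complex" where
  "line_pt b c s = (if b then Complex c s else Complex s c)"

definition dir :: "bool \<Rightarrow> complex" where "dir b = (if b then \<i> else 1)"

definition coord :: "bool \<Rightarrow> complex \<Rightarrow> real" where
  "coord b z = (if b then Re z else Im z)"

lemma line_pt_eq: "line_pt b c s = of_real c * dir (\<not> b) + of_real s * dir b"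
  by (auto simp: line_pt_def dir_def complex_eq_iff)

lemma coord_line_pt [simp]: "coord b (line_pt b c s) = c" "coord (\<not> b) (line_pt b c s) = s"
  by (auto simp: coord_def line_pt_def)

lemma line_pt_coord [simp]: "line_pt b (coord b z) (coord (\<not> b) z) = z"
  by (auto simp: coord_def line_pt_def complex_eq_iff)

lemma distr_Complex_lborel: "distr (lborel \<Otimes>\<^sub>M lborel) borel (\<lambda>(x, y). Complex x y) = lborel"
proof (rule lborel_eqI[symmetric])
  fix l u :: complex assume le: "\<And>b. b \<in> Basis \<Longrightarrow> l \<bullet> b \<le> u \<bullet> b"
  have le': "Re l \<le> Re u" "Im l \<le> Im u"
    using le[of 1] le[of \<i>] by (auto simp: Basis_complex_def)
  have m: "(\<lambda>(x, y). Complex x y) \<in> borel_measurable (lborel \<Otimes>\<^sub>M lborel)"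
    unfolding Complex_eq by measurable
  have "(\<lambda>(x, y). Complex x y) -` box l u \<inter> space (lborel \<Otimes>\<^sub>M lborel) = {Re l<..<Re u} \<times> {Im l<..<Im u}"
    by (auto simp: box_def Basis_complex_def space_pair_measure)
  then have "emeasure (distr (lborel \<Otimes>\<^sub>M lborel) borel (\<lambda>(x, y). Complex x y)) (box l u) =
      emeasure (lborel \<Otimes>\<^sub>M lborel) ({Re l<..<Re u} \<times> {Im l<..<Im u})"
    using m by (subst emeasure_distr) auto
  also have "\<dots> = ennreal (Re u - Re l) * ennreal (Im u - Im l)"
    using le' by (subst lborel.emeasure_pair_measure_Times) auto
  also have "\<dots> = (\<Prod>b\<in>Basis. (u - l) \<bullet> b)"
    using le' by (auto simp: Basis_complex_def ennreal_mult)
  finally show "emeasure (distr (lborel \<Otimes>\<^sub>M lborel) borel (\<lambda>(x, y). Complex x y)) (box l u) = (\<Prod>b\<in>Basis. (u - l) \<bullet> b)" .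
qed simp

lemma borel_measurable_line_pt [measurable]: "line_pt b c \<in> borel_measurable borel" "(\<lambda>(c, s). line_pt b c s) \<in> borel_measurable (borel \<Otimes>\<^sub>M borel)"
  unfolding line_pt_eq[abs_def] by measurable

lemma nn_integral_line_pt:
  fixes f :: "complex \<Rightarrow> ennreal"
  assumes [measurable]: "f \<in> borel_measurable borel"
  shows "(\<integral>\<^sup>+z. f z \<partial>lborel) = (\<integral>\<^sup>+c. \<integral>\<^sup>+s. f (line_pt b c s) \<partial>lborel \<partial>lborel)"
proof -
  have m: "(\<lambda>(x, y). Complex x y) \<in> borel_measurable (lborel \<Otimes>\<^sub>M lborel)"
    unfolding Complex_eq by measurable
  have m2: "(\<lambda>(x, y). f (Complex x y)) \<in> borel_measurable (lborel \<Otimes>\<^sub>M lborel)"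
    using measurable_compose[OF m assms] by (simp add: split_beta')
  have "(\<integral>\<^sup>+z. f z \<partial>lborel) = (\<integral>\<^sup>+p. f ((\<lambda>(x, y). Complex x y) p) \<partial>(lborel \<Otimes>\<^sub>M lborel))"
    by (subst distr_Complex_lborel[symmetric], rule nn_integral_distr) (use m in auto)
  also have "\<dots> = (\<integral>\<^sup>+p. (\<lambda>(x, y). f (Complex x y)) p \<partial>(lborel \<Otimes>\<^sub>M lborel))"
    by (simp add: split_beta')
  also have "\<dots> = (\<integral>\<^sup>+c. \<integral>\<^sup>+s. f (Complex c s) \<partial>lborel \<partial>lborel)"
    by (subst lborel.nn_integral_fst[OF m2, symmetric]) simp
  finally have 1: "(\<integral>\<^sup>+z. f z \<partial>lborel) = (\<integral>\<^sup>+c. \<integral>\<^sup>+s. f (Complex c s) \<partial>lborel \<partial>lborel)" .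
  have 2: "\<dots> = (\<integral>\<^sup>+s. \<integral>\<^sup>+c. f (Complex c s) \<partial>lborel \<partial>lborel)"
    using lborel_pair.Fubini'[OF m2] by simp
  show ?thesis using 1 1[unfolded 2] by (cases b) (simp_all only: line_pt_def if_True if_False)
qed

lemma AE_line_pt:
  assumes "AE z in lborel. P z"
  shows "AE c in lborel. AE s in lborel. P (line_pt b c s)"
proof -
  obtain N where N: "{z. \<not> P z} \<subseteq> N" "emeasure lborel N = 0" "N \<in> sets borel"
    using AE_E[OF assms] by auto
  have [measurable]: "N \<in> sets borel" by fact
  have "(\<integral>\<^sup>+c. \<integral>\<^sup>+s. indicator N (line_pt b c s) \<partial>lborel \<partial>lborel) = (\<integral>\<^sup>+z. indicator N z \<partial>lborel)"
    by (rule nn_integral_line_pt[symmetric]) simp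
  also have "\<dots> = 0" using N by simp
  finally have "AE c in lborel. (\<integral>\<^sup>+s. indicator N (line_pt b c s) \<partial>lborel) = (0::ennreal)"
    by (subst (asm) nn_integral_0_iff_AE) auto
  then show ?thesis
  proof eventually_elim
    case (elim c)
    then have "AE s in lborel. indicator N (line_pt b c s) = (0::ennreal)"
      by (subst (asm) nn_integral_0_iff_AE) auto
    then show ?case by eventually_elim (use N(1) in \<open>auto simp: indicator_def split: if_splits\<close>)
  qed
qed

section \<open>Vanishing mollified gradients\<close>

lemma moll_AE_subseq:
  fixes g :: "complex \<Rightarrow> 'b::{banach, second_countable_topology}"
  assumes d: "\<And>n. 0 < d n" "d \<longlonglongrightarrow> 0" and g: "integrable lborel g"
  obtains r where "strict_mono r" "AE z in lborel. (\<lambda>n. moll (d (r n)) g z) \<longlonglongrightarrow> g z"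
proof -
  note [measurable] = borel_measurable_integrable[OF g] borel_measurable_moll[OF d(1) g]
  have "(\<lambda>n. \<integral>\<^sup>+x. norm (moll (d n) g x - g x) \<partial>lborel) \<longlonglongrightarrow> 0"
    using moll_L1_integrable[OF d g] by (simp add: moll_L1_def)
  then obtain r G where r: "strict_mono r" "integrable lborel (G::complex \<Rightarrow> real)"
    "AE x in lborel. \<forall>n. norm (moll (d (r n)) g x - g x) \<le> G x"
    "AE x in lborel. (\<lambda>n. norm (moll (d (r n)) g x - g x)) \<longlonglongrightarrow> 0"
    by (rule L1_subseq_dominated[where e = "\<lambda>n x. norm (moll (d n) g x - g x)", rotated 2]) auto
  from r(4) have "AE z in lborel. (\<lambda>n. moll (d (r n)) g z) \<longlonglongrightarrow> g z"
    by eventually_elim (simp add: tendsto_norm_zero_iff LIM_zero_iff)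
  then show ?thesis using that r(1) by blast
qed

text \<open>Du Bois-Reymond: mollifications with vanishing gradient are constant, and they converge a.e.\<close>

lemma AE_const_of_conv_deriv_eq_0:
  fixes V :: "complex \<Rightarrow> 'b::{banach, second_countable_topology}"
  assumes V: "integrable lborel V" and S: "open S" "convex S"
    and 0: "\<And>x d. 0 < d \<Longrightarrow> cball x d \<subseteq> S \<Longrightarrow> conv (mollifier_x d) V x = 0 \<and> conv (mollifier_y d) V x = 0"
  shows "\<exists>c. AE z in lborel. z \<in> S \<longrightarrow> V z = c"
proof (cases "S = {}")
  case False
  define d where "d n = inverse (real (Suc n))" for n
  have d: "0 < d n" "d \<longlonglongrightarrow> 0" for n
    unfolding d_def using LIMSEQ_inverse_real_of_nat by auto
  obtain r where r: "strict_mono r" and ae: "AE z in lborel. (\<lambda>n. moll (d (r n)) V z) \<longlonglongrightarrow> V z"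
    using moll_AE_subseq[OF d V] by blast
  define D where "D = {z. (\<lambda>n. moll (d (r n)) V z) \<longlonglongrightarrow> V z}"
  have eq: "V z = V z'" if z: "z \<in> S" "z \<in> D" and z': "z' \<in> S" "z' \<in> D" for z z'
  proof -
    obtain e where e: "0 < e" "cball z e \<subseteq> S" "cball z' e \<subseteq> S"
    proof -
      obtain e1 e2 where "0 < e1" "cball z e1 \<subseteq> S" "0 < e2" "cball z' e2 \<subseteq> S"
        using S(1) z(1) z'(1) open_contains_cball by meson
      then show ?thesis by (intro that[of "min e1 e2"]) auto
    qed
    \<comment> \<open>Convexity keeps the whole \<open>e\<close>-neighbourhood of the segment inside
      \<open>S\<close>, so every mollification of radius below \<open>e\<close> has zero gradient
      along the segment.\<close>
    have seg: "cball x e \<subseteq> S" if "x \<in> closed_segment z z'" for x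
    proof
      fix y assume y: "y \<in> cball x e"
      from that[unfolded in_segment(1)]
      obtain u where "0 \<le> u \<and> u \<le> 1 \<and> x = (1 - u) *\<^sub>R z + u *\<^sub>R z'" ..
      then have u: "0 \<le> u" "u \<le> 1" "x = (1 - u) *\<^sub>R z + u *\<^sub>R z'" by - (elim conjE, assumption)+
      have "z + (y - x) \<in> S" "z' + (y - x) \<in> S"
        using y e(2,3) by (auto simp: dist_norm norm_minus_commute)
      then have "(1 - u) *\<^sub>R (z + (y - x)) + u *\<^sub>R (z' + (y - x)) \<in> S"
        using S(2) u by (intro convexD) auto
      also have "(1 - u) *\<^sub>R (z + (y - x)) + u *\<^sub>R (z' + (y - x)) = y"
        by (simp add: u(3) algebra_simps scaleR_conv_of_real)
      finally show "y \<in> S" .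
    qed
    have "eventually (\<lambda>n. d (r n) < e) sequentially"
      using order_tendstoD(2)[OF LIMSEQ_subseq_LIMSEQ[OF d(2) r] e(1)] by (simp add: o_def)
    then have ev: "eventually (\<lambda>n. moll (d (r n)) V z = moll (d (r n)) V z') sequentially"
    proof eventually_elim
      case (elim n)
      have "\<exists>c. \<forall>x\<in>closed_segment z z'. moll (d (r n)) V x = c"
      proof (rule has_derivative_zero_constant)
        fix x assume "x \<in> closed_segment z z'"
        then have "cball x (d (r n)) \<subseteq> S" using seg[of x] elim by auto
        then show "(moll (d (r n)) V has_derivative (\<lambda>h. 0)) (at x within closed_segment z z')"
          using has_derivative_moll(1)[OF d(1) V, of "r n" x] 0[OF d(1)]
          by (auto intro: has_derivative_at_withinI)
      qed simp
      then show ?case by auto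
    qed
    have lims: "(\<lambda>n. moll (d (r n)) V z) \<longlonglongrightarrow> V z" "(\<lambda>n. moll (d (r n)) V z') \<longlonglongrightarrow> V z'"
      using z(2) z'(2) by (auto simp: D_def)
    from Lim_transform_eventually[OF lims(1) ev] lims(2) show ?thesis by (rule LIMSEQ_unique)
  qed
  have "\<not> (AE z in lborel. z \<notin> S)"
  proof
    assume "AE z in lborel. z \<notin> S"
    then have "S \<in> null_sets lborel"
      using S(1) by (simp add: AE_iff_null_sets)
    moreover have "S \<notin> null_sets lborel"
      using S(1) False open_not_negligible negligible_iff_null_sets null_sets_completionI by blast
    ultimately show False by blast
  qed
  then obtain z0 where z0: "z0 \<in> S" "z0 \<in> D"
    using ae unfolding D_def by (metis (mono_tags, lifting) AE_mp AE_I2 mem_Collect_eq)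
  have "AE z in lborel. z \<in> S \<longrightarrow> V z = V z0"
    using ae by eventually_elim (use eq[OF _ _ z0] in \<open>auto simp: D_def\<close>)
  then show ?thesis by blast
qed auto

section \<open>Borel representatives of locally integrable functions\<close>

lemma measurable_lebesgue_AE:
  fixes a b :: "complex \<Rightarrow> complex"
  assumes b: "b \<in> borel_measurable lborel" and ae: "AE z in lborel. a z = b z"
  shows "a \<in> borel_measurable lebesgue"
proof (rule measurableI)
  fix A :: "complex set" assume A: "A \<in> sets borel"
  show "a -` A \<inter> space lebesgue \<in> sets lebesgue"
  proof (rule complete_measure.in_sets_AE[OF completion.complete_measure_axioms, where A = "b -` A \<inter> space lebesgue"])
    show "AE x in lebesgue. (x \<in> b -` A \<inter> space lebesgue) = (x \<in> a -` A \<inter> space lebesgue)"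
      using AE_completion[OF ae] by eventually_elim simp
    show "b -` A \<inter> space lebesgue \<in> sets lebesgue"
      using measurable_completion[OF b] A by (rule measurable_sets)
  qed auto
qed simp

text \<open>Weak derivatives are only Lebesgue measurable, while restriction to lines and
  composition call for Borel functions. Measurability is known on compact subsets; an exhaustion by
  closed disks carries it to the open disk before a Borel version is chosen.\<close>

lemma Lq_loc_borel_representative:
  fixes g :: "complex \<Rightarrow> complex"
  assumes "Lq_loc q disk g"
  obtains G where "G \<in> borel_measurable borel" "\<And>z. z \<notin> disk \<Longrightarrow> G z = 0"
    "AE z in lborel. z \<in> disk \<longrightarrow> g z = G z"
proof -
  define R where "R n = 1 - inverse (real (Suc n))" for n
  have R: "R n < 1" for n by (simp add: R_def)
  have "(\<lambda>z. indicator (cball 0 (R n)) z *\<^sub>R g z) \<in> borel_measurable lebesgue" for n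
  proof -
    have "compact (cball (0::complex) (R n))" "cball (0::complex) (R n) \<subseteq> disk" using R[of n] by auto
    then have "g \<in> borel_measurable (lebesgue_on (cball 0 (R n)))"
      using assms unfolding Lq_loc_def Lq_on_def by blast
    then show ?thesis
      by (subst (asm) borel_measurable_restrict_space_iff) auto
  qed
  then have m: "(\<lambda>z. indicator disk z *\<^sub>R g z) \<in> borel_measurable lebesgue"
  proof (rule borel_measurable_LIMSEQ_metric)
    fix z :: complex
    show "(\<lambda>n. indicator (cball 0 (R n)) z *\<^sub>R g z) \<longlonglongrightarrow> indicator disk z *\<^sub>R g z"
    proof (cases "z \<in> disk")
      case True
      have "R \<longlonglongrightarrow> 1 - 0" unfolding R_def by (intro tendsto_intros LIMSEQ_inverse_real_of_nat)
      then have "eventually (\<lambda>n. cmod z < R n) sequentially" using True by (intro order_tendstoD(1)) auto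
      then have "eventually (\<lambda>n. indicator (cball 0 (R n)) z *\<^sub>R g z = indicator disk z *\<^sub>R g z) sequentially"
        by eventually_elim (use True in auto)
      then show ?thesis by (rule tendsto_eventually)
    next
      case False
      then have z0: "indicator (cball 0 (R n)) z *\<^sub>R g z = 0" for n using R[of n] by (auto simp: indicator_def)
      have "indicator disk z *\<^sub>R g z = 0" using False by simp
      then show ?thesis by (simp only: z0 tendsto_const)
    qed
  qed
  have "(\<lambda>z. Re (indicator disk z *\<^sub>R g z)) \<in> borel_measurable lebesgue" using m by measurable
  then obtain A where A: "A \<in> borel_measurable lborel" "AE z in lborel. Re (indicator disk z *\<^sub>R g z) = A z"
    using completion_ex_borel_measurable_real by blast
  have "(\<lambda>z. Im (indicator disk z *\<^sub>R g z)) \<in> borel_measurable lebesgue" using m by measurable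
  then obtain B where B: "B \<in> borel_measurable lborel" "AE z in lborel. Im (indicator disk z *\<^sub>R g z) = B z"
    using completion_ex_borel_measurable_real by blast
  have [measurable]: "A \<in> borel_measurable borel" "B \<in> borel_measurable borel" using A B by auto
  have [measurable]: "disk \<in> sets borel" by simp
  show ?thesis
  proof (rule that)
    show "(\<lambda>z. indicator disk z *\<^sub>R (of_real (A z) + \<i> * of_real (B z))) \<in> borel_measurable borel" by measurable
    show "AE z in lborel. z \<in> disk \<longrightarrow> g z = indicator disk z *\<^sub>R (of_real (A z) + \<i> * of_real (B z))"
      using A(2) B(2) by eventually_elim (auto simp: complex_eq_iff)
  qed auto
qed

lemma Lq_loc_integrable:
  fixes g G :: "complex \<Rightarrow> complex"
  assumes "Lq_loc q disk g" and [measurable]: "G \<in> borel_measurable borel"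
    and ae: "AE z in lborel. z \<in> disk \<longrightarrow> g z = G z" and R: "R < 1"
  shows "integrable lborel (\<lambda>z. indicator (cball 0 R) z *\<^sub>R (cmod (G z) powr q))"
proof -
  have C: "compact (cball (0::complex) R)" "cball (0::complex) R \<subseteq> disk" using R by auto
  then have "Lq_on q (cball 0 R) g" using assms(1) by (simp add: Lq_loc_def)
  then have i: "integrable lebesgue (\<lambda>z. indicator (cball 0 R) z *\<^sub>R (cmod (g z) powr q))"
    unfolding Lq_on_def by (subst (asm) integrable_restrict_space) auto
  have ae': "AE z in lebesgue. indicator (cball 0 R) z *\<^sub>R (cmod (g z) powr q) = indicator (cball 0 R) z *\<^sub>R (cmod (G z) powr q)"
    using AE_completion[OF ae] by eventually_elim (use C(2) in \<open>auto simp: indicator_def\<close>)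
  have [measurable]: "cball (0::complex) R \<in> sets borel" by simp
  have m: "(\<lambda>z. indicator (cball 0 R) z *\<^sub>R (cmod (G z) powr q)) \<in> borel_measurable borel" by measurable
  then have m: "(\<lambda>z. indicator (cball 0 R) z *\<^sub>R (cmod (G z) powr q)) \<in> borel_measurable lborel" by simp
  have "integrable lebesgue (\<lambda>z. indicator (cball 0 R) z *\<^sub>R (cmod (G z) powr q))"
    by (rule integrable_cong_AE_imp[OF i measurable_completion[OF m] ae'])
  then show ?thesis by (simp only: integrable_completion[OF m])
qed

text \<open>The translate of the mollifier centred at \<open>x\<close> is an admissible test
  function as soon as its supporting disk lies in the domain; the minus sign from reflecting its
  argument cancels the one from integration by parts. All later arguments use weak derivatives only
  through this identity.\<close>

lemma weak_deriv_conv: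
  fixes f g F G :: "complex \<Rightarrow> complex"
  assumes w: "has_weak_deriv disk e f g"
    and [measurable]: "F \<in> borel_measurable borel" "G \<in> borel_measurable borel"
    and F: "AE z in lborel. z \<in> disk \<longrightarrow> f z = F z"
    and G: "AE z in lborel. z \<in> disk \<longrightarrow> g z = G z"
    and x: "0 < d" "cball x d \<subseteq> disk"
  shows "e = 1 \<Longrightarrow> conv (mollifier_x d) F x = conv (mollifier d) G x"
    and "e = \<i> \<Longrightarrow> conv (mollifier_y d) F x = conv (mollifier d) G x"
proof -
  let ?phi = "\<lambda>z. mollifier d (x - z)"
  have tf: "test_function disk ?phi" unfolding mollifier_def by (rule test_function_bump[OF x])
  have eq: "(LINT z:disk|lebesgue. frechet_derivative ?phi (at z) e *\<^sub>R f z) =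
        - (LINT z:disk|lebesgue. ?phi z *\<^sub>R g z)"
    using w tf by (simp add: has_weak_deriv_def)
  have sub: "z \<in> disk" if "cmod (x - z) < d" for z using subsetD[OF x(2), of z] that by (simp add: dist_norm)
  \<comment> \<open>The kernel vanishes outside the disk, so a Lebesgue integral over the disk may
    be replaced by a Borel integral over the plane.\<close>
  have key: "(LINT z:disk|lebesgue. k (x - z) *\<^sub>R a z) = (LBINT z. k (x - z) *\<^sub>R b z)"
    if k [measurable]: "k \<in> borel_measurable borel" and supp: "\<And>z. d \<le> cmod z \<Longrightarrow> k z = (0::real)"
      and [measurable]: "b \<in> borel_measurable borel" and ae: "AE z in lborel. z \<in> disk \<longrightarrow> a z = b z"
    for k and a b :: "complex \<Rightarrow> complex"
  proof -
    have AE: "AE z in lborel. indicator disk z *\<^sub>R (k (x - z) *\<^sub>R a z) = k (x - z) *\<^sub>R b z"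
      using ae
    proof eventually_elim
      case (elim z)
      show ?case
      proof (cases "z \<in> disk")
        case False
        then have "d \<le> cmod (x - z)" using sub[of z] by fastforce
        then show ?thesis using supp by simp
      qed (use elim in auto)
    qed
    have m: "(\<lambda>z. k (x - z) *\<^sub>R b z) \<in> borel_measurable lborel" by measurable
    have "(LINT z|lebesgue. indicator disk z *\<^sub>R (k (x - z) *\<^sub>R a z)) = (LINT z|lebesgue. k (x - z) *\<^sub>R b z)"
    proof (rule integral_cong_AE)
      show mb: "(\<lambda>z. k (x - z) *\<^sub>R b z) \<in> borel_measurable lebesgue"
        using m by (rule measurable_completion)
      show "(\<lambda>z. indicator disk z *\<^sub>R (k (x - z) *\<^sub>R a z)) \<in> borel_measurable lebesgue"
        using m AE by (rule measurable_lebesgue_AE)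
      show "AE z in lebesgue. indicator disk z *\<^sub>R (k (x - z) *\<^sub>R a z) = k (x - z) *\<^sub>R b z"
        using AE by (rule AE_completion)
    qed
    also have "\<dots> = (LBINT z. k (x - z) *\<^sub>R b z)" by (rule integral_completion[OF m])
    finally show ?thesis by (simp add: set_lebesgue_integral_def)
  qed
  have fr: "frechet_derivative ?phi (at z) 1 = - mollifier_x d (x - z)" "frechet_derivative ?phi (at z) \<i> = - mollifier_y d (x - z)" for z
    unfolding mollifier_def frechet_derivative_bump_shift by (simp_all add: mollifier_x_def mollifier_y_def algebra_simps)
  have [measurable]: "mollifier_x d \<in> borel_measurable borel" "mollifier_y d \<in> borel_measurable borel"
    by (intro borel_measurable_continuous_onI continuous_on_mollifier_derivs)+
  have R: "(LINT z:disk|lebesgue. ?phi z *\<^sub>R g z) = conv (mollifier d) G x"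
    unfolding conv_def by (rule key) (use mollifier_eq_0[OF x(1)] G in auto)
  {
    assume e: "e = 1"
    have "(LINT z:disk|lebesgue. (- mollifier_x d (x - z)) *\<^sub>R f z) = - (LBINT z. mollifier_x d (x - z) *\<^sub>R F z)"
      using key[of "\<lambda>z. - mollifier_x d z" F f] mollifier_derivs_eq_0(1)[OF x(1)] F by (simp add: conv_def)
    then show "conv (mollifier_x d) F x = conv (mollifier d) G x"
      using eq unfolding e fr R by (simp add: conv_def)
  }
  {
    assume e: "e = \<i>"
    have "(LINT z:disk|lebesgue. (- mollifier_y d (x - z)) *\<^sub>R f z) = - (LBINT z. mollifier_y d (x - z) *\<^sub>R F z)"
      using key[of "\<lambda>z. - mollifier_y d z" F f] mollifier_derivs_eq_0(2)[OF x(1)] F by (simp add: conv_def)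
    then show "conv (mollifier_y d) F x = conv (mollifier d) G x"
      using eq unfolding e fr R by (simp add: conv_def)
  }
qed

lemma conv_cong_near:
  assumes "\<And>z. d \<le> cmod z \<Longrightarrow> k z = 0" "\<And>z. cmod (x - z) < d \<Longrightarrow> f z = g z"
  shows "conv k f x = conv k g x"
  unfolding conv_def
proof (rule Bochner_Integration.integral_cong[OF refl])
  show "k (x - z) *\<^sub>R f z = k (x - z) *\<^sub>R g z" for z
    using assms(1)[of "x - z"] assms(2)[of z] by (cases "cmod (x - z) < d") auto
qed

lemma moll_uniform:
  fixes F :: "complex \<Rightarrow> complex"
  assumes d: "\<And>n. 0 < d n" "d \<longlonglongrightarrow> 0" and F: "integrable lborel F"
    and cont: "continuous_on (cball 0 R') F" and R: "R < R'" and e: "0 < e"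
  shows "eventually (\<lambda>n. \<forall>x\<in>cball 0 R. cmod (moll (d n) F x - F x) \<le> e) sequentially"
proof -
  have "uniformly_continuous_on (cball 0 R') F"
    using cont by (intro compact_uniformly_continuous) auto
  then obtain t where t: "0 < t" "\<And>x y. x \<in> cball 0 R' \<Longrightarrow> y \<in> cball 0 R' \<Longrightarrow> dist x y < t \<Longrightarrow> dist (F x) (F y) < e"
    using e unfolding uniformly_continuous_on_def by metis
  have "eventually (\<lambda>n. d n < min t (R' - R)) sequentially"
    using order_tendstoD(2)[OF d(2), of "min t (R' - R)"] t R by simp
  then show ?thesis
  proof eventually_elim
    case (elim n)
    show ?case
    proof
      fix x :: complex assume x: "x \<in> cball 0 R"
      show "cmod (moll (d n) F x - F x) \<le> e"
      proof (rule norm_moll_minus_le[OF d(1) F])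
        fix z assume z: "dist z x < d n"
        have "z \<in> cball 0 R'" using z x elim norm_triangle_ineq2[of z x] by (auto simp: dist_norm)
        then show "cmod (F z - F x) \<le> e"
          using t(2)[of z x] z x elim R by (auto simp: dist_norm)
      qed
    qed
  qed
qed

subsection \<open>The Jacobian identity\<close>

lemma tendsto_add_zero_ennreal:
  fixes f g :: "nat \<Rightarrow> ennreal"
  shows "f \<longlonglongrightarrow> 0 \<Longrightarrow> g \<longlonglongrightarrow> 0 \<Longrightarrow> (\<lambda>n. f n + g n) \<longlonglongrightarrow> 0"
  using tendsto_add[of f 0 sequentially g 0] by simp

definition jac :: "complex \<Rightarrow> complex \<Rightarrow> real" where
  "jac a b = Re a * Im b - Im a * Re b"

lemma abs_jac_le: "\<bar>jac a b\<bar> \<le> ((cmod a)\<^sup>2 + (cmod b)\<^sup>2) / 2"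
proof -
  have "(Re a - Im b)\<^sup>2 + (Im a + Re b)\<^sup>2 = (cmod a)\<^sup>2 + (cmod b)\<^sup>2 - 2 * jac a b"
    "(Re a + Im b)\<^sup>2 + (Im a - Re b)\<^sup>2 = (cmod a)\<^sup>2 + (cmod b)\<^sup>2 + 2 * jac a b"
    unfolding cmod_power2 jac_def by (simp_all add: power2_eq_square algebra_simps)
  moreover have "0 \<le> (Re a - Im b)\<^sup>2 + (Im a + Re b)\<^sup>2" "0 \<le> (Re a + Im b)\<^sup>2 + (Im a - Re b)\<^sup>2" by auto
  ultimately have "2 * jac a b \<le> (cmod a)\<^sup>2 + (cmod b)\<^sup>2" "- (2 * jac a b) \<le> (cmod a)\<^sup>2 + (cmod b)\<^sup>2" by simp_all
  then show ?thesis by (simp add: abs_le_iff)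
qed

text \<open>For \<open>a = h_x\<close>, \<open>b = h_y\<close> and \<open>p\<close>,
  \<open>q\<close> the partial derivatives of \<Phi> at \<open>h\<close>, the left side is (\<Phi> o
  h)_x h_y - (\<Phi> o h)_y h_x, the part of the divergence without second derivatives.\<close>

lemma jac_scaleR_eq:
  "(p * Re a + q * Im a) *\<^sub>R b - (p * Re b + q * Im b) *\<^sub>R a = jac a b *\<^sub>R (\<i> * of_real p - of_real q)"
  by (simp add: complex_eq_iff jac_def algebra_simps)

lemma borel_measurable_jac [measurable]:
  assumes [measurable]: "a \<in> borel_measurable M" "b \<in> borel_measurable M"
  shows "(\<lambda>x. jac (a x) (b x)) \<in> borel_measurable M"
  unfolding jac_def by measurable

text \<open>The setting shared by \<open>h0\<close>, whose energy has to be bounded, and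
  \<open>h\<close>. The Borel functions \<open>A\<close> and \<open>B\<close> stand for the weak
  derivatives in the directions 1 and i and are tied to \<open>h\<close> only by the mollified
  identities. Square integrability is local, as a quasiconformal \<open>h0\<close> provides
  it.\<close>

locale planar_map =
  fixes h A B :: "complex \<Rightarrow> complex"
  assumes h_cont: "continuous_on closed_disk h"
    and h_closed: "z \<in> closed_disk \<Longrightarrow> h z \<in> closed_disk"
    and h_sphere: "z \<in> sphere 0 1 \<Longrightarrow> h z \<in> sphere 0 1"
    and A_meas [measurable]: "A \<in> borel_measurable borel"
    and B_meas [measurable]: "B \<in> borel_measurable borel"
    and A_int2: "R < 1 \<Longrightarrow> integrable lborel (\<lambda>z. indicator (cball 0 R) z *\<^sub>R (cmod (A z))\<^sup>2)"
    and B_int2: "R < 1 \<Longrightarrow> integrable lborel (\<lambda>z. indicator (cball 0 R) z *\<^sub>R (cmod (B z))\<^sup>2)"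
    and conv_x: "0 < d \<Longrightarrow> cball x d \<subseteq> disk \<Longrightarrow>
      conv (mollifier_x d) (\<lambda>z. indicator disk z *\<^sub>R h z) x = conv (mollifier d) A x"
    and conv_y: "0 < d \<Longrightarrow> cball x d \<subseteq> disk \<Longrightarrow>
      conv (mollifier_y d) (\<lambda>z. indicator disk z *\<^sub>R h z) x = conv (mollifier d) B x"
    and jac_nonneg: "AE z in lborel. z \<in> disk \<longrightarrow> 0 \<le> jac (A z) (B z)"
begin

text \<open>Outside the closed disk \<open>h\<close> is arbitrary. The cut-off is a bounded Borel
  function on the plane, to which mollification applies.\<close>

definition H :: "complex \<Rightarrow> complex" where "H z = indicator disk z *\<^sub>R h z"

lemma H_disk [simp]: "z \<in> disk \<Longrightarrow> H z = h z" by (simp add: H_def)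

lemma disk_meas [measurable]: "disk \<in> sets borel" "cball (0::complex) R \<in> sets borel" "ball (0::complex) R \<in> sets borel" by auto

lemma H_meas [measurable]: "H \<in> borel_measurable borel"
  unfolding H_def[abs_def]
  by (intro borel_measurable_continuous_on_indicator continuous_on_subset[OF h_cont]) auto

lemma norm_H_le: "cmod (H z) \<le> indicator disk z"
  using h_closed[of z] by (auto simp: H_def indicator_def)

lemma integrable_indicator_ball: "integrable lborel (indicator (ball (0::complex) R) :: complex \<Rightarrow> real)"
  "integrable lborel (indicator (cball (0::complex) R) :: complex \<Rightarrow> real)"
  by (intro integrable_real_indicator; simp add: emeasure_lborel_ball_finite[unfolded infinity_ennreal_def] emeasure_lborel_cball_finite[unfolded infinity_ennreal_def])+

lemma H_int: "integrable lborel H"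
  by (rule Bochner_Integration.integrable_bound[OF integrable_indicator_ball(1)[of 1]])
     (use norm_H_le in auto)

lemma L1_of_L2:
  fixes g :: "complex \<Rightarrow> complex"
  assumes [measurable]: "g \<in> borel_measurable borel"
    and i2: "integrable lborel (\<lambda>z. indicator (cball 0 R) z *\<^sub>R (cmod (g z))\<^sup>2)"
  shows "integrable lborel (\<lambda>z. indicator (cball 0 R) z *\<^sub>R g z)"
proof (rule Bochner_Integration.integrable_bound)
  show "integrable lborel (\<lambda>z. indicator (cball 0 R) z *\<^sub>R (cmod (g z))\<^sup>2 + indicator (cball (0::complex) R) z :: real)"
    by (intro Bochner_Integration.integrable_add i2 integrable_indicator_ball)
  show "AE z in lborel. norm (indicator (cball 0 R) z *\<^sub>R g z) \<le> norm (indicator (cball 0 R) z *\<^sub>R (cmod (g z))\<^sup>2 + indicator (cball 0 R) z)"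
  proof (rule AE_I2)
    fix z :: complex
    have "cmod (g z) \<le> (cmod (g z))\<^sup>2 + 1"
      using sum_power2_ge_zero[of "cmod (g z) - 1" 0] norm_ge_zero[of "g z"] unfolding power2_diff
      by (auto simp: power2_eq_square) (smt (verit) mult_le_cancel_left2)
    then show "norm (indicator (cball 0 R) z *\<^sub>R g z) \<le> norm (indicator (cball 0 R) z *\<^sub>R (cmod (g z))\<^sup>2 + indicator (cball 0 R) z)"
      by (auto simp: indicator_def)
  qed
qed measurable

text \<open>The Jacobian is quadratic, so passing to the limit needs a majorant of the squared
  derivatives. By Jensen they lie below the mollified squares, which converge in L^1; one
  subsequence is taken for both derivatives and both squares at once.\<close>

lemma smooth_approx:
  assumes R: "R < 1"
  obtains hn an bn axx axy byy :: "nat \<Rightarrow> complex \<Rightarrow> complex" and G :: "complex \<Rightarrow> real" where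
    "\<And>n z. (hn n has_derivative (\<lambda>v. Re v *\<^sub>R an n z + Im v *\<^sub>R bn n z)) (at z)"
    "\<And>n z. (an n has_derivative (\<lambda>v. Re v *\<^sub>R axx n z + Im v *\<^sub>R axy n z)) (at z)"
    "\<And>n z. (bn n has_derivative (\<lambda>v. Re v *\<^sub>R axy n z + Im v *\<^sub>R byy n z)) (at z)"
    "\<And>n. continuous_on UNIV (axx n)" "\<And>n. continuous_on UNIV (axy n)" "\<And>n. continuous_on UNIV (byy n)"
    "\<And>e. 0 < e \<Longrightarrow> eventually (\<lambda>n. \<forall>x\<in>cball 0 R. cmod (hn n x - h x) \<le> e) sequentially"
    "integrable lborel G"
    "AE z in lborel. \<forall>n. z \<in> cball 0 R \<longrightarrow> (cmod (an n z))\<^sup>2 \<le> G z \<and> (cmod (bn n z))\<^sup>2 \<le> G z"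
    "AE z in lborel. z \<in> cball 0 R \<longrightarrow> (\<lambda>n. an n z) \<longlonglongrightarrow> A z \<and> (\<lambda>n. bn n z) \<longlonglongrightarrow> B z"
proof -
  \<comment> \<open>The mollification radii are at most \<open>R' - R\<close>, so on the smaller
    disk it makes no difference that \<open>A\<close> and \<open>B\<close> are cut off at radius
    \<open>R'\<close>.\<close>
  define R' where "R' = (max R 0 + 1) / 2"
  have R': "R < R'" "R' < 1" "0 < R'" using R by (auto simp: R'_def)
  define d where "d n = (R' - R) * inverse (real (Suc n))" for n
  have d0: "0 < d n" for n using R' by (simp add: d_def)
  have dlim: "d \<longlonglongrightarrow> 0"
    unfolding d_def using tendsto_mult[OF tendsto_const[of "R' - R"] LIMSEQ_inverse_real_of_nat] by simp
  have dle: "d n \<le> R' - R" for n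
    using R' unfolding d_def by (intro mult_left_le) (auto simp: inverse_le_1_iff)
  define A' where "A' z = indicator (cball 0 R') z *\<^sub>R A z" for z
  define B' where "B' z = indicator (cball 0 R') z *\<^sub>R B z" for z
  have A'eq: "(cmod (A' z))\<^sup>2 = indicator (cball 0 R') z *\<^sub>R (cmod (A z))\<^sup>2"
    and B'eq: "(cmod (B' z))\<^sup>2 = indicator (cball 0 R') z *\<^sub>R (cmod (B z))\<^sup>2" for z
    by (auto simp: A'_def B'_def indicator_def)
  have iA: "integrable lborel A'" unfolding A'_def[abs_def] by (rule L1_of_L2[OF A_meas A_int2[OF R'(2)]])
  have iB: "integrable lborel B'" unfolding B'_def[abs_def] by (rule L1_of_L2[OF B_meas B_int2[OF R'(2)]])
  have iA2: "integrable lborel (\<lambda>z. (cmod (A' z))\<^sup>2)" unfolding A'eq by (rule A_int2[OF R'(2)])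
  have iB2: "integrable lborel (\<lambda>z. (cmod (B' z))\<^sup>2)" unfolding B'eq by (rule B_int2[OF R'(2)])
  note [measurable] = borel_measurable_integrable[OF iA] borel_measurable_integrable[OF iB]
    borel_measurable_moll[OF d0 iA] borel_measurable_moll[OF d0 iB]
    borel_measurable_moll[OF d0 iA2] borel_measurable_moll[OF d0 iB2]
  define e where "e n z = norm (moll (d n) A' z - A' z) + (norm (moll (d n) B' z - B' z) +
    (norm (moll (d n) (\<lambda>z. (cmod (A' z))\<^sup>2) z - (cmod (A' z))\<^sup>2) + norm (moll (d n) (\<lambda>z. (cmod (B' z))\<^sup>2) z - (cmod (B' z))\<^sup>2)))" for n z
  have [measurable]: "e n \<in> borel_measurable lborel" for n unfolding e_def[abs_def] by measurable
  have e_nonneg: "0 \<le> e n z" for n z by (simp add: e_def)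
  have e_lim: "(\<lambda>n. \<integral>\<^sup>+z. e n z \<partial>lborel) \<longlonglongrightarrow> 0"
  proof -
    have "(\<integral>\<^sup>+z. e n z \<partial>lborel) = (\<integral>\<^sup>+z. norm (moll (d n) A' z - A' z) \<partial>lborel) + ((\<integral>\<^sup>+z. norm (moll (d n) B' z - B' z) \<partial>lborel) +
      ((\<integral>\<^sup>+z. norm (moll (d n) (\<lambda>z. (cmod (A' z))\<^sup>2) z - (cmod (A' z))\<^sup>2) \<partial>lborel) +
       (\<integral>\<^sup>+z. norm (moll (d n) (\<lambda>z. (cmod (B' z))\<^sup>2) z - (cmod (B' z))\<^sup>2) \<partial>lborel)))" for n
      unfolding e_def by (simp add: nn_integral_add)
    then show ?thesis
      using moll_L1_integrable[OF d0 dlim iA] moll_L1_integrable[OF d0 dlim iB]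
        moll_L1_integrable[OF d0 dlim iA2] moll_L1_integrable[OF d0 dlim iB2]
      unfolding moll_L1_def by (simp only:) (intro tendsto_add_zero_ennreal)
  qed
  obtain r G0 where r: "strict_mono r" and G0: "integrable lborel G0"
    and G0b: "AE z in lborel. \<forall>n. e (r n) z \<le> G0 z" and elim0: "AE z in lborel. (\<lambda>n. e (r n) z) \<longlonglongrightarrow> 0"
    by (rule L1_subseq_dominated[where e = e, OF _ e_nonneg e_lim]) auto
  have near: "conv (mollifier_x (d n)) H z = moll (d n) A' z" "conv (mollifier_y (d n)) H z = moll (d n) B' z" if "z \<in> cball 0 R" for n z
  proof -
    have sub: "w \<in> cball 0 R'" if "w \<in> cball z (d n)" for w
    proof -
      have "cmod w \<le> cmod z + dist z w" using norm_triangle_ineq2[of w z] by (simp add: dist_norm norm_minus_commute)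
      then show ?thesis using that \<open>z \<in> cball 0 R\<close> dle[of n] by simp
    qed
    then have cb: "cball z (d n) \<subseteq> disk" using R' by fastforce
    have "conv (mollifier (d n)) A z = conv (mollifier (d n)) A' z" "conv (mollifier (d n)) B z = conv (mollifier (d n)) B' z"
      by (rule conv_cong_near[where d = "d n"]; use sub mollifier_eq_0[OF d0] in \<open>simp add: A'_def B'_def dist_norm\<close>)+
    then show "conv (mollifier_x (d n)) H z = moll (d n) A' z" "conv (mollifier_y (d n)) H z = moll (d n) B' z"
      using conv_x[OF d0 cb] conv_y[OF d0 cb] by (simp_all add: moll_eq_conv H_def[abs_def])
  qed
  show ?thesis
  proof (rule that)
    show "(moll (d (r n)) H has_derivative (\<lambda>v. Re v *\<^sub>R conv (mollifier_x (d (r n))) H z + Im v *\<^sub>R conv (mollifier_y (d (r n))) H z)) (at z)" for n z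
      by (rule has_derivative_moll(1)[OF d0 H_int])
    show "(conv (mollifier_x (d (r n))) H has_derivative (\<lambda>v. Re v *\<^sub>R conv (mollifier_xx (d (r n))) H z + Im v *\<^sub>R conv (mollifier_xy (d (r n))) H z)) (at z)" for n z
      by (rule has_derivative_moll(2)[OF d0 H_int])
    show "(conv (mollifier_y (d (r n))) H has_derivative (\<lambda>v. Re v *\<^sub>R conv (mollifier_xy (d (r n))) H z + Im v *\<^sub>R conv (mollifier_yy (d (r n))) H z)) (at z)" for n z
      by (rule has_derivative_moll(3)[OF d0 H_int])
    show "continuous_on UNIV (conv (mollifier_xx (d (r n))) H)" "continuous_on UNIV (conv (mollifier_xy (d (r n))) H)"
      "continuous_on UNIV (conv (mollifier_yy (d (r n))) H)" for n
      by (rule continuous_on_conv_mollifier_derivs[OF d0 H_int])+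
    show "eventually (\<lambda>n. \<forall>x\<in>cball 0 R. cmod (moll (d (r n)) H x - h x) \<le> \<epsilon>) sequentially" if "0 < \<epsilon>" for \<epsilon>
    proof -
      have "continuous_on (cball 0 R') H"
      proof (rule continuous_on_eq)
        show "continuous_on (cball 0 R') h" using R' by (intro continuous_on_subset[OF h_cont]) auto
      qed (use R' in auto)
      then have "eventually (\<lambda>n. \<forall>x\<in>cball 0 R. cmod (moll (d n) H x - H x) \<le> \<epsilon>) sequentially"
        by (intro moll_uniform[OF d0 dlim H_int _ R'(1) that])
      then have "eventually (\<lambda>n. \<forall>x\<in>cball 0 R. cmod (moll (d (r n)) H x - H x) \<le> \<epsilon>) sequentially"
        by (rule eventually_subseq[OF r])
      then show ?thesis by eventually_elim (use R in auto)
    qed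
    show "integrable lborel (\<lambda>z. (cmod (A' z))\<^sup>2 + ((cmod (B' z))\<^sup>2 + G0 z))"
      by (intro Bochner_Integration.integrable_add iA2 iB2 G0)
    show "AE z in lborel. \<forall>n. z \<in> cball 0 R \<longrightarrow> (cmod (conv (mollifier_x (d (r n))) H z))\<^sup>2 \<le> (cmod (A' z))\<^sup>2 + ((cmod (B' z))\<^sup>2 + G0 z) \<and>
       (cmod (conv (mollifier_y (d (r n))) H z))\<^sup>2 \<le> (cmod (A' z))\<^sup>2 + ((cmod (B' z))\<^sup>2 + G0 z)"
      using G0b
    proof eventually_elim
      case (elim z)
      show ?case
      proof (intro allI impI)
        fix n assume z: "z \<in> cball 0 R"
        have "norm (moll (d (r n)) (\<lambda>z. (cmod (A' z))\<^sup>2) z - (cmod (A' z))\<^sup>2) \<le> e (r n) z"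
          "norm (moll (d (r n)) (\<lambda>z. (cmod (B' z))\<^sup>2) z - (cmod (B' z))\<^sup>2) \<le> e (r n) z"
          by (simp_all add: e_def)
        then have "moll (d (r n)) (\<lambda>z. (cmod (A' z))\<^sup>2) z \<le> (cmod (A' z))\<^sup>2 + G0 z"
          "moll (d (r n)) (\<lambda>z. (cmod (B' z))\<^sup>2) z \<le> (cmod (B' z))\<^sup>2 + G0 z"
          using elim[rule_format, of n] by (simp_all add: abs_le_iff)
        then show "(cmod (conv (mollifier_x (d (r n))) H z))\<^sup>2 \<le> (cmod (A' z))\<^sup>2 + ((cmod (B' z))\<^sup>2 + G0 z) \<and>
          (cmod (conv (mollifier_y (d (r n))) H z))\<^sup>2 \<le> (cmod (A' z))\<^sup>2 + ((cmod (B' z))\<^sup>2 + G0 z)"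
          unfolding near[OF z]
          using norm_moll_sq_le[OF d0[of "r n"] iA iA2, of z] norm_moll_sq_le[OF d0[of "r n"] iB iB2, of z]
            zero_le_power2[of "cmod (A' z)"] zero_le_power2[of "cmod (B' z)"] by linarith
      qed
    qed
    show "AE z in lborel. z \<in> cball 0 R \<longrightarrow> (\<lambda>n. conv (mollifier_x (d (r n))) H z) \<longlonglongrightarrow> A z \<and> (\<lambda>n. conv (mollifier_y (d (r n))) H z) \<longlonglongrightarrow> B z"
      using elim0
    proof eventually_elim
      case (elim z)
      show ?case
      proof
        assume z: "z \<in> cball 0 R"
        have zz: "A' z = A z" "B' z = B z" using z R' by (auto simp: A'_def B'_def)
        have "(\<lambda>n. norm (moll (d (r n)) A' z - A' z)) \<longlonglongrightarrow> 0" "(\<lambda>n. norm (moll (d (r n)) B' z - B' z)) \<longlonglongrightarrow> 0"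
          by (rule tendsto_sandwich[OF _ _ tendsto_const elim]; simp add: e_def)+
        then show "(\<lambda>n. conv (mollifier_x (d (r n))) H z) \<longlonglongrightarrow> A z \<and> (\<lambda>n. conv (mollifier_y (d (r n))) H z) \<longlonglongrightarrow> B z"
          unfolding near[OF z] zz by (simp add: tendsto_norm_zero_iff LIM_zero_iff)
      qed
    qed
  qed
qed

text \<open>The set where \<open>|h| <= s\<close> is compact and misses the circle, whose image has
  modulus 1 > s. Thus test functions with compact support in the target disk pull back to functions
  with compact support in the source disk.\<close>

lemma preimage_compactly_inside:
  assumes "s < 1"
  obtains R where "0 \<le> R" "R < 1" "\<And>z. z \<in> closed_disk \<Longrightarrow> cmod (h z) \<le> s \<Longrightarrow> cmod z \<le> R"
proof -
  define K where "K = {z \<in> closed_disk. cmod (h z) \<le> s}"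
  have "closed K" unfolding K_def
    by (intro continuous_on_closed_Collect_le continuous_intros h_cont) auto
  moreover have "bounded K" by (rule bounded_subset[OF bounded_cball[of 0 1]]) (auto simp: K_def)
  ultimately have K: "compact K" by (simp add: compact_eq_bounded_closed)
  show ?thesis
  proof (cases "K = {}")
    case True
    then show ?thesis by (intro that[of 0]) (auto simp: K_def)
  next
    case False
    have "continuous_on K cmod" by (intro continuous_intros)
    then obtain z0 where z0: "z0 \<in> K" "\<And>z. z \<in> K \<Longrightarrow> cmod z \<le> cmod z0"
      using continuous_attains_sup[OF K False] by blast
    have "cmod z0 \<noteq> 1" using h_sphere[of z0] z0(1) assms by (auto simp: K_def)
    then have "cmod z0 < 1" using z0(1) by (auto simp: K_def)
    then show ?thesis by (intro that[of "cmod z0"]) (use z0(2) in \<open>auto simp: K_def\<close>)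
  qed
qed

text \<open>For smooth maps \<open>\<partial>\<^sub>x(\<Phi>(h) h\<^sub>y) - \<partial>\<^sub>y(\<Phi>(h) h\<^sub>x) = J (\<i> \<Phi>\<^sub>x(h) - \<Phi>\<^sub>y(h))\<close>, so both integrals are
  divergences; the general case follows by mollification.\<close>

theorem jacobian_identity:
  fixes \<Phi> \<Phi>x \<Phi>y :: "complex \<Rightarrow> real"
  assumes \<Phi>: "\<And>z. (\<Phi> has_derivative (\<lambda>v. Re v * \<Phi>x z + Im v * \<Phi>y z)) (at z)"
    and cont: "continuous_on UNIV \<Phi>x" "continuous_on UNIV \<Phi>y"
    and supp: "\<And>z. s \<le> cmod z \<Longrightarrow> \<Phi> z = 0" and s: "s < 1"
  shows "(LBINT z. indicator disk z * (\<Phi>x (h z) * jac (A z) (B z))) = 0"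
    and "(LBINT z. indicator disk z * (\<Phi>y (h z) * jac (A z) (B z))) = 0"
proof -
  note out = partial_derivs_outside_support[OF \<Phi> supp]
  have [measurable]: "\<Phi>x \<in> borel_measurable borel" "\<Phi>y \<in> borel_measurable borel"
    using cont by (auto intro: borel_measurable_continuous_onI)
  have cont\<Phi>: "continuous_on UNIV \<Phi>"
    using \<Phi> by (meson continuous_at_imp_continuous_on has_derivative_continuous)
  have out': "\<Phi>x z = 0" "\<Phi>y z = 0" if "s + 1 \<le> cmod z" for z using out[where z = z] that by auto
  obtain L1 where L1: "\<And>z. \<bar>\<Phi>x z\<bar> \<le> L1" using continuous_compact_support_bounded[OF cont(1) out'(1)] by blast
  obtain L2 where L2: "\<And>z. \<bar>\<Phi>y z\<bar> \<le> L2" using continuous_compact_support_bounded[OF cont(2) out'(2)] by blast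
  \<comment> \<open>The gap between \<open>s\<close> and \<open>s'\<close> absorbs the uniform error
    of the approximation: once it is at most half the gap, the composition of \<Phi> with the
    approximant vanishes for \<open>R0 < |z| \<le> R1\<close>.\<close>
  define s' where "s' = (s + 1) / 2"
  have s': "s < s'" "s' < 1" using s by (auto simp: s'_def)
  obtain R0 where R0: "0 \<le> R0" "R0 < 1" "\<And>z. z \<in> closed_disk \<Longrightarrow> cmod (h z) \<le> s' \<Longrightarrow> cmod z \<le> R0"
    using preimage_compactly_inside[OF s'(2)] by blast
  define R1 where "R1 = (R0 + 1) / 2"
  have R1: "R0 < R1" "R1 < 1" using R0 by (auto simp: R1_def)
  obtain hn an bn axx axy byy G where ap:
    "\<And>n z. (hn n has_derivative (\<lambda>v. Re v *\<^sub>R an n z + Im v *\<^sub>R bn n z)) (at z)"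
    "\<And>n z. (an n has_derivative (\<lambda>v. Re v *\<^sub>R axx n z + Im v *\<^sub>R axy n z)) (at z)"
    "\<And>n z. (bn n has_derivative (\<lambda>v. Re v *\<^sub>R axy n z + Im v *\<^sub>R byy n z)) (at z)"
    "\<And>n. continuous_on UNIV (axx n)" "\<And>n. continuous_on UNIV (axy n)" "\<And>n. continuous_on UNIV (byy n)"
    and unif: "\<And>e. 0 < e \<Longrightarrow> eventually (\<lambda>n. \<forall>x\<in>cball 0 R1. cmod (hn n x - h x) \<le> e) sequentially"
    and G: "integrable lborel (G :: complex \<Rightarrow> real)"
    and Gb: "AE z in lborel. \<forall>n. z \<in> cball 0 R1 \<longrightarrow> (cmod (an n z))\<^sup>2 \<le> G z \<and> (cmod (bn n z))\<^sup>2 \<le> G z"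
    and lim: "AE z in lborel. z \<in> cball 0 R1 \<longrightarrow> (\<lambda>n. an n z) \<longlonglongrightarrow> A z \<and> (\<lambda>n. bn n z) \<longlonglongrightarrow> B z"
    using smooth_approx[OF R1(2)] by blast
  have conta: "continuous_on UNIV (an n)" "continuous_on UNIV (bn n)" "continuous_on UNIV (hn n)" for n
    by (auto intro!: continuous_at_imp_continuous_on ap(1-3)[THEN has_derivative_continuous])
  have [measurable]: "an n \<in> borel_measurable borel" "bn n \<in> borel_measurable borel" "hn n \<in> borel_measurable borel" for n
    using conta by (auto intro: borel_measurable_continuous_onI)
  \<comment> \<open>Both integrals are packed into one complex integral: the imaginary part carries
    \<open>\<Phi>x\<close>, the real part minus \<open>\<Phi>y\<close>.\<close>
  define q where "q n z = indicator (ball 0 R1) z *\<^sub>R (jac (an n z) (bn n z) *\<^sub>R (\<i> * of_real (\<Phi>x (hn n z)) - of_real (\<Phi>y (hn n z))))" for n z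
  define q' where "q' z = indicator (ball 0 R1) z *\<^sub>R (jac (A z) (B z) *\<^sub>R (\<i> * of_real (\<Phi>x (H z)) - of_real (\<Phi>y (H z))))" for z
  have [measurable]: "q n \<in> borel_measurable borel" "q' \<in> borel_measurable borel" for n
    unfolding q_def[abs_def] q'_def[abs_def] by measurable
  have "eventually (\<lambda>n. \<forall>x\<in>cball 0 R1. cmod (hn n x - h x) \<le> (s' - s) / 2) sequentially"
    by (rule unif) (use s'(1) in simp)
  then have q_int0: "eventually (\<lambda>n. (LBINT z. q n z) = 0) sequentially"
  proof (rule eventually_mono)
    fix n assume u: "\<forall>x\<in>cball 0 R1. cmod (hn n x - h x) \<le> (s' - s) / 2"
    have big: "s < cmod (hn n z)" if "R0 < cmod z" "cmod z \<le> R1" for z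
    proof -
      have "s' < cmod (h z)" using R0(3)[of z] that R1 by force
      moreover have "cmod (hn n z - h z) \<le> (s' - s) / 2" using u that by auto
      ultimately show ?thesis using norm_triangle_ineq2[of "h z" "hn n z"] s'(1) by (auto simp: norm_minus_commute)
    qed
    \<comment> \<open>The approximant is uncontrolled near and beyond the circle, so the composition
      is set to 0 outside radius \<open>R1\<close>. It stays differentiable because it already
      vanishes on the collar between \<open>R0\<close> and \<open>R1\<close>.\<close>
    define W where "W z = (if cmod z < R1 then \<Phi> (hn n z) else 0)" for z
    define Wx where "Wx z = (if cmod z < R1 then \<Phi>x (hn n z) * Re (an n z) + \<Phi>y (hn n z) * Im (an n z) else 0)" for z
    define Wy where "Wy z = (if cmod z < R1 then \<Phi>x (hn n z) * Re (bn n z) + \<Phi>y (hn n z) * Im (bn n z) else 0)" for z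
    have W0: "W z = 0" "Wx z = 0" "Wy z = 0" if "R0 < cmod z" for z
      using big[OF that] supp[of "hn n z"] out[where z = "hn n z"] by (auto simp: W_def Wx_def Wy_def)
    have op: "open {z::complex. R0 < cmod z}" by (intro open_Collect_less continuous_intros)
    have dW: "(W has_derivative (\<lambda>v. Re v * Wx z + Im v * Wy z)) (at z)" for z
    proof (cases "cmod z < R1")
      case True
      have "((\<lambda>z. \<Phi> (hn n z)) has_derivative (\<lambda>v. Re v * Wx z + Im v * Wy z)) (at z)"
        by (rule has_derivative_eq_rhs[OF has_derivative_compose[OF ap(1) \<Phi>]])
           (use True in \<open>simp add: Wx_def Wy_def fun_eq_iff algebra_simps\<close>)
      then show ?thesis
        by (rule has_derivative_transform_within_open[OF _ open_ball[of 0 R1]]) (use True in \<open>auto simp: W_def\<close>)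
    next
      case False
      then have z: "R0 < cmod z" using R1 by auto
      have "((\<lambda>_. 0) has_derivative (\<lambda>v. Re v * Wx z + Im v * Wy z)) (at z)" using W0[OF z] by simp
      then show ?thesis
        by (rule has_derivative_transform_within_open[OF _ op]) (use z W0 in auto)
    qed
    have cov: "UNIV = ball (0::complex) R1 \<union> {z. R0 < cmod z}" using R1 by auto
    have contW: "continuous_on UNIV W"
      using dW by (meson continuous_at_imp_continuous_on has_derivative_continuous)
    have "continuous_on (ball 0 R1) (\<lambda>z. \<Phi>x (hn n z) * Re (an n z) + \<Phi>y (hn n z) * Im (an n z))"
      "continuous_on (ball 0 R1) (\<lambda>z. \<Phi>x (hn n z) * Re (bn n z) + \<Phi>y (hn n z) * Im (bn n z))"
      by (intro continuous_intros continuous_on_compose2[OF cont(1) continuous_on_subset[OF conta(3)]]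
        continuous_on_compose2[OF cont(2) continuous_on_subset[OF conta(3)]] continuous_on_subset[OF conta(1)]
        continuous_on_subset[OF conta(2)]; simp)+
    then have "continuous_on (ball 0 R1) Wx" "continuous_on (ball 0 R1) Wy"
      by (auto simp: Wx_def Wy_def cong: continuous_on_cong_simp)
    moreover have "continuous_on {z. R0 < cmod z} Wx" "continuous_on {z. R0 < cmod z} Wy"
      using W0 by (auto cong: continuous_on_cong_simp)
    ultimately have contWx: "continuous_on UNIV Wx" "continuous_on UNIV Wy"
      unfolding cov using op by (auto intro!: continuous_on_open_Un)
    have dF: "((\<lambda>z. W z *\<^sub>R bn n z) has_derivative (\<lambda>v. Re v *\<^sub>R (Wx z *\<^sub>R bn n z + W z *\<^sub>R axy n z) + Im v *\<^sub>R (Wy z *\<^sub>R bn n z + W z *\<^sub>R byy n z))) (at z)" for z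
      by (rule has_derivative_eq_rhs[OF has_derivative_scaleR[OF dW ap(3)]])
         (simp add: fun_eq_iff algebra_simps)
    have dF': "((\<lambda>z. W z *\<^sub>R an n z) has_derivative (\<lambda>v. Re v *\<^sub>R (Wx z *\<^sub>R an n z + W z *\<^sub>R axx n z) + Im v *\<^sub>R (Wy z *\<^sub>R an n z + W z *\<^sub>R axy n z))) (at z)" for z
      by (rule has_derivative_eq_rhs[OF has_derivative_scaleR[OF dW ap(2)]])
         (simp add: fun_eq_iff algebra_simps)
    have W1: "W z = 0" "Wx z = 0" "Wy z = 0" if "R1 \<le> cmod z" for z using W0[of z] that R1 by auto
    note ci = contW contWx conta ap(4-6)
    have I1: "(LBINT z. Wx z *\<^sub>R bn n z + W z *\<^sub>R axy n z) = 0"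
      by (rule integral_partial_derivs_eq_0(1)[OF dF, where s = R1]) (use W1 ci in \<open>auto intro!: continuous_intros\<close>)
    have I2: "(LBINT z. Wy z *\<^sub>R an n z + W z *\<^sub>R axy n z) = 0"
      by (rule integral_partial_derivs_eq_0(2)[OF dF', where s = R1]) (use W1 ci in \<open>auto intro!: continuous_intros\<close>)
    have i1: "integrable lborel (\<lambda>z. Wx z *\<^sub>R bn n z + W z *\<^sub>R axy n z)" "integrable lborel (\<lambda>z. Wy z *\<^sub>R an n z + W z *\<^sub>R axy n z)"
      by (rule integrable_compact_support[where d = R1]; use W1 ci in \<open>auto intro!: continuous_intros\<close>)+
    have "q n z = (Wx z *\<^sub>R bn n z + W z *\<^sub>R axy n z) - (Wy z *\<^sub>R an n z + W z *\<^sub>R axy n z)" for z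
    proof (cases "cmod z < R1")
      case True
      then have "(Wx z *\<^sub>R bn n z + W z *\<^sub>R axy n z) - (Wy z *\<^sub>R an n z + W z *\<^sub>R axy n z) =
        (\<Phi>x (hn n z) * Re (an n z) + \<Phi>y (hn n z) * Im (an n z)) *\<^sub>R bn n z - (\<Phi>x (hn n z) * Re (bn n z) + \<Phi>y (hn n z) * Im (bn n z)) *\<^sub>R an n z"
        by (simp add: Wx_def Wy_def)
      also have "\<dots> = q n z" unfolding jac_scaleR_eq using True by (simp add: q_def)
      finally show ?thesis by simp
    qed (use W1 in \<open>auto simp: q_def\<close>)
    then show "(LBINT z. q n z) = 0"
      using Bochner_Integration.integral_diff[OF i1] I1 I2 by simp
  qed
  have q_lim: "(\<lambda>n. LBINT z. q n z) \<longlonglongrightarrow> (LBINT z. q' z)" and q_int: "integrable lborel q'"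
  proof -
    have w: "integrable lborel (\<lambda>z. (L1 + L2) * \<bar>G z\<bar>)" using G by simp
    have l: "AE z in lborel. (\<lambda>n. q n z) \<longlonglongrightarrow> q' z"
      using lim
    proof eventually_elim
      case (elim z)
      show ?case
      proof (cases "z \<in> ball 0 R1")
        case True
        then have l: "(\<lambda>n. an n z) \<longlonglongrightarrow> A z" "(\<lambda>n. bn n z) \<longlonglongrightarrow> B z" using elim by auto
        have "(\<lambda>n. hn n z) \<longlonglongrightarrow> h z"
        proof (rule metric_LIMSEQ_I)
          fix e :: real assume "0 < e"
          then have "eventually (\<lambda>n. cmod (hn n z - h z) \<le> e / 2) sequentially"
            using unif[of "e / 2"] True by (auto elim!: eventually_mono)
          then show "\<exists>no. \<forall>n\<ge>no. dist (hn n z) (h z) < e"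
            unfolding eventually_sequentially dist_norm using \<open>0 < e\<close> by (fastforce elim: order.strict_trans1)
        qed
        then have h: "(\<lambda>n. hn n z) \<longlonglongrightarrow> H z" using True R1 by simp
        have "(\<lambda>n. jac (an n z) (bn n z)) \<longlonglongrightarrow> jac (A z) (B z)"
          unfolding jac_def by (intro tendsto_intros l)
        moreover have "(\<lambda>n. \<Phi>x (hn n z)) \<longlonglongrightarrow> \<Phi>x (H z)" "(\<lambda>n. \<Phi>y (hn n z)) \<longlonglongrightarrow> \<Phi>y (H z)"
          by (rule continuous_on_tendsto_compose[OF cont(1) h] continuous_on_tendsto_compose[OF cont(2) h]; simp)+
        ultimately show ?thesis unfolding q_def q'_def by (intro tendsto_intros)
      qed (simp add: q_def q'_def)
    qed
    have b: "AE z in lborel. norm (q n z) \<le> (L1 + L2) * \<bar>G z\<bar>" for n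
      using Gb
    proof eventually_elim
      case (elim z)
      have L: "0 \<le> L1" "0 \<le> L2" using L1[of 0] L2[of 0] by linarith+
      show ?case
      proof (cases "z \<in> ball 0 R1")
        case True
        then have g: "(cmod (an n z))\<^sup>2 \<le> G z" "(cmod (bn n z))\<^sup>2 \<le> G z" using elim by auto
        have j: "\<bar>jac (an n z) (bn n z)\<bar> \<le> G z" using abs_jac_le[of "an n z" "bn n z"] g by simp
        have "cmod (\<i> * of_real (\<Phi>x (hn n z)) - of_real (\<Phi>y (hn n z))) \<le> L1 + L2"
          using norm_triangle_ineq4[of "\<i> * of_real (\<Phi>x (hn n z))" "of_real (\<Phi>y (hn n z))"] L1[of "hn n z"] L2[of "hn n z"]
          by (simp add: norm_mult)
        then have "\<bar>jac (an n z) (bn n z)\<bar> * cmod (\<i> * of_real (\<Phi>x (hn n z)) - of_real (\<Phi>y (hn n z))) \<le> \<bar>G z\<bar> * (L1 + L2)"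
          using j L by (intro mult_mono) auto
        then show ?thesis using True by (simp add: q_def mult.commute)
      next
        case False
        then show ?thesis using L by (simp add: q_def)
      qed
    qed
    show "(\<lambda>n. LBINT z. q n z) \<longlonglongrightarrow> (LBINT z. q' z)"
      by (rule integral_dominated_convergence[OF _ _ w l b]) auto
    show "integrable lborel q'"
      by (rule integrable_dominated_convergence[OF _ _ w l b]) auto
  qed
  have I0: "(LBINT z. q' z) = 0"
    by (rule LIMSEQ_unique[OF q_lim tendsto_eventually[OF q_int0]])
  have q'eq: "q' z = complex_of_real (- (indicator disk z * (\<Phi>y (h z) * jac (A z) (B z)))) + \<i> * of_real (indicator disk z * (\<Phi>x (h z) * jac (A z) (B z)))" for z
  proof (cases "z \<in> ball 0 R1")
    case True
    then have "z \<in> disk" using R1 by auto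
    then show ?thesis using True by (simp add: q'_def complex_eq_iff)
  next
    case False
    show ?thesis
    proof (cases "z \<in> disk")
      case True
      then have "s' < cmod (h z)" using R0(3)[of z] False R1 by force
      then show ?thesis using out[where z = "h z"] s' False by (simp add: q'_def)
    qed (use False in \<open>simp add: q'_def\<close>)
  qed
  have "(LBINT z. Re (q' z)) = 0" "(LBINT z. Im (q' z)) = 0"
    using integral_Re[OF q_int] integral_Im[OF q_int] I0 by simp_all
  then show "(LBINT z. indicator disk z * (\<Phi>x (h z) * jac (A z) (B z))) = 0"
    and "(LBINT z. indicator disk z * (\<Phi>y (h z) * jac (A z) (B z))) = 0"
    unfolding q'eq by simp_all
qed

end

section \<open>Bounds for the push-forward of the Jacobian\<close>

context planar_map
begin

lemma jac_integrable:
  assumes "R < 1"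
  shows "integrable lborel (\<lambda>z. indicator (cball 0 R) z * jac (A z) (B z))"
proof (rule Bochner_Integration.integrable_bound)
  show "integrable lborel (\<lambda>z. indicator (cball 0 R) z *\<^sub>R (cmod (A z))\<^sup>2 + indicator (cball 0 R) z *\<^sub>R (cmod (B z))\<^sup>2)"
    using assms by (intro Bochner_Integration.integrable_add A_int2 B_int2)
  show "AE z in lborel. norm (indicator (cball 0 R) z * jac (A z) (B z)) \<le>
      norm (indicator (cball 0 R) z *\<^sub>R (cmod (A z))\<^sup>2 + indicator (cball 0 R) z *\<^sub>R (cmod (B z))\<^sup>2)"
  proof (rule AE_I2)
    fix z :: complex
    have "\<bar>jac (A z) (B z)\<bar> \<le> (cmod (A z))\<^sup>2 + (cmod (B z))\<^sup>2"
      using abs_jac_le[of "A z" "B z"] by (rule order_trans) simp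
    then show "norm (indicator (cball 0 R) z * jac (A z) (B z)) \<le>
      norm (indicator (cball 0 R) z *\<^sub>R (cmod (A z))\<^sup>2 + indicator (cball 0 R) z *\<^sub>R (cmod (B z))\<^sup>2)"
      by (auto simp: indicator_def)
  qed
qed measurable

text \<open>So far \<open>J\<close> is integrable only on compact subdisks. The restriction to
  \<open>|h| <= s\<close> with \<open>s < 1\<close> confines it to one of them and yields an
  integrable density on the plane.\<close>

definition jac_sublevel :: "real \<Rightarrow> complex \<Rightarrow> real" where
  "jac_sublevel s z = indicator {z \<in> disk. cmod (H z) \<le> s} z * jac (A z) (B z)"

lemma sublevel_meas [measurable]: "{z \<in> disk. cmod (H z) \<le> s} \<in> sets borel"
  by measurable

lemma jac_sublevel_meas [measurable]: "jac_sublevel s \<in> borel_measurable borel"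
  unfolding jac_sublevel_def[abs_def] by measurable

lemma jac_sublevel_integrable:
  assumes "s < 1" shows "integrable lborel (jac_sublevel s)"
proof -
  obtain R where R: "0 \<le> R" "R < 1" "\<And>z. z \<in> closed_disk \<Longrightarrow> cmod (h z) \<le> s \<Longrightarrow> cmod z \<le> R"
    using preimage_compactly_inside[OF assms] by blast
  show ?thesis
  proof (rule Bochner_Integration.integrable_bound[OF jac_integrable[OF R(2)]])
    show "AE z in lborel. norm (jac_sublevel s z) \<le> norm (indicator (cball 0 R) z * jac (A z) (B z))"
    proof (rule AE_I2)
      fix z :: complex
      show "norm (jac_sublevel s z) \<le> norm (indicator (cball 0 R) z * jac (A z) (B z))"
        using R(3)[of z] by (auto simp: jac_sublevel_def indicator_def)
    qed
  qed simp
qed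

lemma jac_sublevel_nonneg: "AE z in lborel. 0 \<le> jac_sublevel s z"
  using jac_nonneg by eventually_elim (auto simp: jac_sublevel_def indicator_def)

text \<open>As a function of \<open>t\<close> this is the push-forward measure mollified at scale
  \<open>r\<close>. Its gradient pairs the Jacobian with derivatives of a bump supported in the disk
  of radius \<open>|t| + r\<close>, which is zero by the Jacobian identity. The margin
  \<open>2 * r\<close> keeps that radius below \<open>1 - r\<close>, where the truncation of the
  density has no effect.\<close>

lemma translation_invariant:
  assumes r: "0 < r"
  shows "\<exists>c. \<forall>t\<in>ball 0 (1 - 2 * r). (LBINT z. mollifier r (t - H z) * jac_sublevel (1 - r) z) = c"
proof (rule has_derivative_zero_constant)
  fix t :: complex assume t: "t \<in> ball 0 (1 - 2 * r)"
  define s where "s = cmod t + r"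
  have s: "s < 1 - r" using t by (simp add: s_def)
  have supp: "r \<le> cmod (t - z)" if "s \<le> cmod z" for z
    using that norm_triangle_ineq2[of z t] by (simp add: s_def norm_minus_commute)
  have d\<Phi>: "((\<lambda>z. mollifier r (t - z)) has_derivative (\<lambda>v. Re v * (- mollifier_x r (t - z)) + Im v * (- mollifier_y r (t - z)))) (at z)" for z
  proof -
    have "((\<lambda>z. t - z) has_derivative (\<lambda>v. - v)) (at z)" by (auto intro!: derivative_eq_intros)
    from has_derivative_compose[OF this has_derivative_mollifier]
    show ?thesis by (rule has_derivative_eq_rhs) (simp add: fun_eq_iff)
  qed
  have cont: "continuous_on UNIV (\<lambda>z. - mollifier_x r (t - z))" "continuous_on UNIV (\<lambda>z. - mollifier_y r (t - z))"
    unfolding mollifier_x_def mollifier_y_def by (intro continuous_intros)+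
  note J = jacobian_identity[OF d\<Phi> cont, where s = s]
  have eq: "k (t - H z) * jac_sublevel (1 - r) z = indicator disk z * (k (t - h z) * jac (A z) (B z))"
    if k: "\<And>z. r \<le> cmod z \<Longrightarrow> k z = (0::real)" for k z
  proof (cases "z \<in> disk \<and> cmod (h z) \<le> 1 - r")
    case False
    then show ?thesis using k[of "t - h z"] supp[of "h z"] s by (cases "z \<in> disk") (auto simp: jac_sublevel_def)
  qed (auto simp: jac_sublevel_def)
  have z: "(LBINT z. mollifier_x r (t - H z) * jac_sublevel (1 - r) z) = 0" "(LBINT z. mollifier_y r (t - H z) * jac_sublevel (1 - r) z) = 0"
    using J mollifier_eq_0[OF r] supp s r mollifier_derivs_eq_0[OF r] by (simp_all add: eq)
  obtain L1 where L1: "\<And>z. \<bar>mollifier r z\<bar> \<le> L1" using mollifier_bounded[OF r] by blast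
  obtain L2 where L2: "\<And>z. \<bar>mollifier_x r z\<bar> \<le> L2" using continuous_compact_support_bounded[OF continuous_on_mollifier_derivs(1) mollifier_derivs_eq_0(1)[OF r]] by blast
  obtain L3 where L3: "\<And>z. \<bar>mollifier_y r z\<bar> \<le> L3" using continuous_compact_support_bounded[OF continuous_on_mollifier_derivs(2) mollifier_derivs_eq_0(2)[OF r]] by blast
  define L where "L = max L1 (max L2 L3)"
  have L: "\<bar>mollifier r z\<bar> \<le> L" "\<bar>mollifier_x r z\<bar> \<le> L" "\<bar>mollifier_y r z\<bar> \<le> L" for z
    using L1[of z] L2[of z] L3[of z] by (auto simp: L_def)
  have gi: "integrable lborel (jac_sublevel (1 - r))" using r by (intro jac_sublevel_integrable) simp
  have Hm: "H \<in> borel_measurable lborel" by simp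
  have "((\<lambda>t. LBINT z. mollifier r (t - H z) *\<^sub>R jac_sublevel (1 - r) z) has_derivative
     (\<lambda>v. Re v *\<^sub>R (LBINT z. mollifier_x r (t - H z) *\<^sub>R jac_sublevel (1 - r) z) + Im v *\<^sub>R (LBINT z. mollifier_y r (t - H z) *\<^sub>R jac_sublevel (1 - r) z))) (at t)"
    by (rule has_derivative_integral_kernel[OF has_derivative_mollifier continuous_on_mollifier_derivs(1,2) L Hm gi])
  then have "((\<lambda>t. LBINT z. mollifier r (t - H z) * jac_sublevel (1 - r) z) has_derivative (\<lambda>v. 0)) (at t)"
    by (simp add: z)
  then show "((\<lambda>t. LBINT z. mollifier r (t - H z) * jac_sublevel (1 - r) z) has_derivative (\<lambda>v. 0)) (at t within ball 0 (1 - 2 * r))"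
    by (rule has_derivative_at_withinI)
qed simp

text \<open>The measure of \<open>S\<close> under the push-forward of \<open>J dw\<close> by
  \<open>h\<close>. The conversion to \<open>ennreal\<close> sends negative values to 0, which
  happens only on a null set.\<close>

definition mass :: "complex set \<Rightarrow> ennreal" where
  "mass S = (\<integral>\<^sup>+z. indicator disk z * (indicator S (h z) * ennreal (jac (A z) (B z))) \<partial>lborel)"

text \<open>Averaging the translation invariance over \<open>t \<in> ball 0 (1/4)\<close> bounds the constant by a quantity
  that does not depend on \<open>r\<close>.\<close>

lemma mollified_mass_bound:
  "\<exists>C::ennreal. C < \<infinity> \<and> (\<forall>r S. 0 < r \<longrightarrow> r \<le> 1/8 \<longrightarrow> S \<in> sets borel \<longrightarrow> S \<subseteq> ball 0 (1 - 2 * r) \<longrightarrow>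
      (\<integral>\<^sup>+z. ennreal (jac_sublevel (1 - r) z) * (\<integral>\<^sup>+t. indicator S t * ennreal (mollifier r (t - H z)) \<partial>lborel) \<partial>lborel) \<le> C * emeasure lborel S)"
proof -
  \<comment> \<open>For \<open>r \<le> 1/8\<close> this ball lies in \<open>|t| < 1 - 2 * r\<close>,
    and kernels centred in it see only points with \<open>|h| < 1/2\<close>. There the density is
    \<open>jac_sublevel (1/2)\<close>, whatever \<open>r\<close> is.\<close>
  let ?B = "ball (0::complex) (1/4)"
  define N0 where "N0 = (\<integral>\<^sup>+z. ennreal (jac_sublevel (1/2) z) \<partial>lborel)"
  have N0: "N0 < \<infinity>"
  proof -
    have "N0 = ennreal (LBINT z. jac_sublevel (1/2) z)"
      unfolding N0_def by (rule nn_integral_eq_integral[OF jac_sublevel_integrable jac_sublevel_nonneg]) simp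
    then show ?thesis by simp
  qed
  define \<beta> where "\<beta> = emeasure lborel ?B"
  have \<beta>: "0 < \<beta>" "\<beta> < \<infinity>"
    unfolding \<beta>_def by (simp_all add: emeasure_ball unit_ball_vol_2 ennreal_zero_less_mult_iff)
  show ?thesis
  proof (intro exI[of _ "N0 / \<beta>"] conjI allI impI)
    show "N0 / \<beta> < \<infinity>" using N0 \<beta> by (simp add: ennreal_divide_eq_top_iff less_top[symmetric] zero_less_iff_neq_zero)
    fix r :: real and S :: "complex set" assume r: "0 < r" "r \<le> 1/8" and S [measurable]: "S \<in> sets borel" and S': "S \<subseteq> ball 0 (1 - 2 * r)"
    obtain c where c: "\<And>t. t \<in> ball 0 (1 - 2 * r) \<Longrightarrow> (LBINT z. mollifier r (t - H z) * jac_sublevel (1 - r) z) = c"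
      using translation_invariant[OF r(1)] by blast
    have cn: "(\<integral>\<^sup>+z. ennreal (mollifier r (t - H z)) * ennreal (jac_sublevel (1 - r) z) \<partial>lborel) = ennreal c" if "t \<in> ball 0 (1 - 2 * r)" for t
    proof -
      obtain L where L: "\<And>z. \<bar>mollifier r z\<bar> \<le> L" using mollifier_bounded[OF r(1)] by blast
      have cm: "continuous_on UNIV (mollifier r)" using continuous_on_mollifier[OF continuous_on_id] by simp
      have i: "integrable lborel (\<lambda>z. mollifier r (t - H z) *\<^sub>R jac_sublevel (1 - r) z)"
        by (rule integrable_kernel[OF cm L]) (use r in \<open>auto intro: jac_sublevel_integrable\<close>)
      have "AE z in lborel. 0 \<le> mollifier r (t - H z) *\<^sub>R jac_sublevel (1 - r) z"
        using jac_sublevel_nonneg[of "1 - r"] by eventually_elim (simp add: mollifier_nonneg[OF r(1)])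
      from nn_integral_eq_integral[OF i this] show ?thesis
        using c[OF that] by (simp add: ennreal_mult' mollifier_nonneg[OF r(1)])
    qed
    have swap: "(\<integral>\<^sup>+z. ennreal (jac_sublevel (1 - r) z) * (\<integral>\<^sup>+t. indicator T t * ennreal (mollifier r (t - H z)) \<partial>lborel) \<partial>lborel) = ennreal c * emeasure lborel T"
      if [measurable]: "T \<in> sets borel" and T: "T \<subseteq> ball 0 (1 - 2 * r)" for T
    proof -
      have "(\<integral>\<^sup>+z. ennreal (jac_sublevel (1 - r) z) * (\<integral>\<^sup>+t. indicator T t * ennreal (mollifier r (t - H z)) \<partial>lborel) \<partial>lborel) =
        (\<integral>\<^sup>+z. (\<integral>\<^sup>+t. ennreal (jac_sublevel (1 - r) z) * (indicator T t * ennreal (mollifier r (t - H z))) \<partial>lborel) \<partial>lborel)"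
        by (intro nn_integral_cong nn_integral_cmult[symmetric]) measurable
      also have "\<dots> = (\<integral>\<^sup>+t. (\<integral>\<^sup>+z. ennreal (jac_sublevel (1 - r) z) * (indicator T t * ennreal (mollifier r (t - H z))) \<partial>lborel) \<partial>lborel)"
        by (rule lborel_pair.Fubini') measurable
      also have "\<dots> = (\<integral>\<^sup>+t. indicator T t * (\<integral>\<^sup>+z. ennreal (mollifier r (t - H z)) * ennreal (jac_sublevel (1 - r) z) \<partial>lborel) \<partial>lborel)"
        by (subst nn_integral_cmult[symmetric]) (auto simp: ac_simps)
      also have "\<dots> = (\<integral>\<^sup>+t. ennreal c * indicator T t \<partial>lborel)"
        using T cn by (intro nn_integral_cong) (auto simp: indicator_def)
      also have "\<dots> = ennreal c * emeasure lborel T" by (simp add: nn_integral_cmult)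
      finally show ?thesis .
    qed
    have "ennreal c * \<beta> = (\<integral>\<^sup>+z. ennreal (jac_sublevel (1 - r) z) * (\<integral>\<^sup>+t. indicator ?B t * ennreal (mollifier r (t - H z)) \<partial>lborel) \<partial>lborel)"
      unfolding \<beta>_def by (rule swap[symmetric]) (use r in auto)
    also have "\<dots> \<le> N0"
      unfolding N0_def
    proof (rule nn_integral_mono)
      fix z :: complex
      have le1: "(\<integral>\<^sup>+t. indicator ?B t * ennreal (mollifier r (t - H z)) \<partial>lborel) \<le> 1"
        unfolding nn_integral_mollifier'[OF r(1), of "H z", symmetric]
        by (intro nn_integral_mono) (auto simp: indicator_def)
      show "ennreal (jac_sublevel (1 - r) z) * (\<integral>\<^sup>+t. indicator ?B t * ennreal (mollifier r (t - H z)) \<partial>lborel) \<le> ennreal (jac_sublevel (1/2) z)"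
      proof (cases "cmod (H z) \<le> 1/2")
        case True
        then have "jac_sublevel (1 - r) z = jac_sublevel (1/2) z" using r by (auto simp: jac_sublevel_def indicator_def)
        then show ?thesis using mult_left_mono[OF le1, of "ennreal (jac_sublevel (1/2) z)"] by simp
      next
        case False
        have eq0: "indicator ?B t * ennreal (mollifier r (t - H z)) = 0" for t
        proof (cases "t \<in> ?B")
          case True
          then have "r \<le> cmod (t - H z)" using False r norm_triangle_ineq2[of "H z" t] by (simp add: norm_minus_commute)
          then show ?thesis using mollifier_eq_0[OF r(1)] by simp
        qed simp
        show ?thesis unfolding eq0 by simp
      qed
    qed
    finally have "ennreal c * \<beta> / \<beta> \<le> N0 / \<beta>" by (rule divide_right_mono_ennreal)
    then have "ennreal c \<le> N0 / \<beta>"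
      using \<beta> by (simp add: mult_divide_eq_ennreal)
    then show "(\<integral>\<^sup>+z. ennreal (jac_sublevel (1 - r) z) * (\<integral>\<^sup>+t. indicator S t * ennreal (mollifier r (t - H z)) \<partial>lborel) \<partial>lborel) \<le> N0 / \<beta> * emeasure lborel S"
      unfolding swap[OF S S'] by (rule mult_right_mono) simp
  qed
qed

text \<open>Fatou along radii tending to 0. Over a point of an open set the kernel eventually lies
  inside the set, so the mollified density is eventually equal to \<open>J\<close> there.\<close>

theorem mass_open_bound:
  "\<exists>C::ennreal. C < \<infinity> \<and> (\<forall>S. open S \<longrightarrow> S \<subseteq> disk \<longrightarrow> mass S \<le> C * emeasure lborel S)"
proof -
  obtain C :: ennreal where C: "C < \<infinity>" and bound: "\<And>r S. 0 < r \<Longrightarrow> r \<le> 1/8 \<Longrightarrow> S \<in> sets borel \<Longrightarrow> S \<subseteq> ball 0 (1 - 2 * r) \<Longrightarrow>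
      (\<integral>\<^sup>+z. ennreal (jac_sublevel (1 - r) z) * (\<integral>\<^sup>+t. indicator S t * ennreal (mollifier r (t - H z)) \<partial>lborel) \<partial>lborel) \<le> C * emeasure lborel S"
    using mollified_mass_bound by auto
  show ?thesis
  proof (intro exI[of _ C] conjI allI impI C)
    fix S :: "complex set" assume S: "open S" "S \<subseteq> disk"
    have [measurable]: "S \<in> sets borel" using S by simp
    define r where "r n = (1/8) * inverse (real (Suc n))" for n
    have r: "0 < r n" "r n \<le> 1/8" for n by (auto simp: r_def inverse_le_1_iff)
    have rlim: "r \<longlonglongrightarrow> 0" unfolding r_def
      using tendsto_mult[OF tendsto_const[of "1/8"] LIMSEQ_inverse_real_of_nat] by simp
    define T where "T n = S \<inter> ball 0 (1 - 2 * r n)" for n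
    have [measurable]: "T n \<in> sets borel" for n unfolding T_def by measurable
    define F where "F n z = ennreal (jac_sublevel (1 - r n) z) * (\<integral>\<^sup>+t. indicator (T n) t * ennreal (mollifier (r n) (t - H z)) \<partial>lborel)" for n z
    have [measurable]: "F n \<in> borel_measurable lborel" for n
      unfolding F_def[abs_def] by measurable
    have ptw: "indicator disk z * (indicator S (h z) * ennreal (jac (A z) (B z))) \<le> liminf (\<lambda>n. F n z)" for z
    proof (cases "z \<in> disk \<and> h z \<in> S")
      case True
      then have z: "z \<in> disk" "h z \<in> S" by auto
      obtain e where e: "0 < e" "ball (h z) e \<subseteq> S" using S(1) z(2) openE by blast
      have "cmod (h z) < 1" using z S by auto
      \<comment> \<open>A third of the margin gives \<open>|h z| + r < 1 - 2 * r\<close>: the kernel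
        around \<open>h z\<close> stays in \<open>T n\<close>, and \<open>h z\<close> stays below
        the truncation level \<open>1 - r\<close>.\<close>
      then have "eventually (\<lambda>n. r n < min e ((1 - cmod (h z)) / 3)) sequentially"
        using e by (intro order_tendstoD(2)[OF rlim]) auto
      then have "eventually (\<lambda>n. F n z = ennreal (jac (A z) (B z))) sequentially"
      proof eventually_elim
        case (elim n)
        have "indicator (T n) t * ennreal (mollifier (r n) (t - H z)) = ennreal (mollifier (r n) (t - H z))" for t
        proof (cases "cmod (t - h z) < r n")
          case True
          then have "t \<in> ball (h z) e" using elim by (simp add: dist_norm norm_minus_commute)
          moreover have "t \<in> ball 0 (1 - 2 * r n)" using True elim norm_triangle_ineq2[of t "h z"] by simp
          ultimately show ?thesis using e by (auto simp: T_def)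
        next
          case False
          then show ?thesis using mollifier_eq_0[OF r(1)[of n], of "t - h z"] z by simp
        qed
        moreover have "jac_sublevel (1 - r n) z = jac (A z) (B z)" using z elim r(1)[of n] by (auto simp: jac_sublevel_def indicator_def)
        ultimately show ?case by (simp add: F_def nn_integral_mollifier'[OF r(1)])
      qed
      then have "liminf (\<lambda>n. F n z) = ennreal (jac (A z) (B z))"
        by (subst Liminf_eq) (auto simp: Liminf_const)
      then show ?thesis using True by simp
    qed (auto simp: indicator_def)
    have "mass S \<le> (\<integral>\<^sup>+z. liminf (\<lambda>n. F n z) \<partial>lborel)"
      unfolding mass_def by (intro nn_integral_mono ptw)
    also have "\<dots> \<le> liminf (\<lambda>n. \<integral>\<^sup>+z. F n z \<partial>lborel)"
      by (rule nn_integral_liminf) measurable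
    also have "\<dots> \<le> liminf (\<lambda>n. C * emeasure lborel S)"
    proof (rule Liminf_mono, intro always_eventually allI)
      fix n
      have "(\<integral>\<^sup>+z. F n z \<partial>lborel) \<le> C * emeasure lborel (T n)"
        unfolding F_def by (rule bound[OF r]) (auto simp: T_def)
      also have "\<dots> \<le> C * emeasure lborel S"
        by (intro mult_left_mono emeasure_mono) (auto simp: T_def)
      finally show "(\<integral>\<^sup>+z. F n z \<partial>lborel) \<le> C * emeasure lborel S" .
    qed
    also have "\<dots> = C * emeasure lborel S" by (simp add: Liminf_const)
    finally show "mass S \<le> C * emeasure lborel S" .
  qed
qed

end

subsection \<open>Absolute continuity on lines\<close>

text \<open>Take \<beta> as the first point where \<rho> reaches \<open>b\<close>, then \<alpha> as
  the last point before it where \<rho> is at most \<open>a\<close>. Strictly between them \<rho>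
  stays inside the open interval.\<close>

lemma crossing_interval_aux:
  fixes \<rho> :: "real \<Rightarrow> real"
  assumes c: "continuous_on {s0..s1} \<rho>" and le: "s0 \<le> s1" and ab: "a < b" "\<rho> s0 \<le> a" "b \<le> \<rho> s1"
  shows "\<exists>\<alpha> \<beta>. \<alpha> < \<beta> \<and> {\<alpha>..\<beta>} \<subseteq> {s0..s1} \<and> (\<forall>s\<in>{\<alpha><..<\<beta>}. a < \<rho> s \<and> \<rho> s < b) \<and> b - a \<le> \<bar>\<rho> \<beta> - \<rho> \<alpha>\<bar>"
proof -
  define T where "T = {s \<in> {s0..s1}. b \<le> \<rho> s}"
  have "closed T" unfolding T_def by (intro continuous_on_closed_Collect_le continuous_intros c closed_atLeastAtMost)
  moreover have "bounded T" by (rule bounded_subset[OF bounded_closed_interval[of s0 s1]]) (auto simp: T_def)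
  moreover have "T \<noteq> {}" using le ab by (auto simp: T_def)
  ultimately obtain \<beta> where \<beta>: "\<beta> \<in> T" "\<And>s. s \<in> T \<Longrightarrow> \<beta> \<le> s"
    using compact_attains_inf[of T] by (auto simp: compact_eq_bounded_closed)
  define U where "U = {s \<in> {s0..\<beta>}. \<rho> s \<le> a}"
  have \<beta>': "s0 \<le> \<beta>" "\<beta> \<le> s1" "b \<le> \<rho> \<beta>" using \<beta>(1) by (auto simp: T_def)
  have "continuous_on {s0..\<beta>} \<rho>" using \<beta>' by (intro continuous_on_subset[OF c]) auto
  then have "closed U" unfolding U_def by (intro continuous_on_closed_Collect_le continuous_on_const closed_atLeastAtMost)
  moreover have "bounded U" by (rule bounded_subset[OF bounded_closed_interval[of s0 \<beta>]]) (auto simp: U_def)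
  moreover have "U \<noteq> {}" using \<beta>' ab by (auto simp: U_def)
  ultimately obtain \<alpha> where \<alpha>: "\<alpha> \<in> U" "\<And>s. s \<in> U \<Longrightarrow> s \<le> \<alpha>"
    using compact_attains_sup[of U] by (auto simp: compact_eq_bounded_closed)
  have \<alpha>': "s0 \<le> \<alpha>" "\<alpha> \<le> \<beta>" "\<rho> \<alpha> \<le> a" using \<alpha>(1) by (auto simp: U_def)
  have "\<alpha> \<noteq> \<beta>" using \<alpha>' \<beta>' ab by auto
  show ?thesis
  proof (rule exI[of _ \<alpha>], rule exI[of _ \<beta>], intro conjI ballI)
    show "\<alpha> < \<beta>" using \<alpha>' \<open>\<alpha> \<noteq> \<beta>\<close> by simp
    show "{\<alpha>..\<beta>} \<subseteq> {s0..s1}" using \<alpha>' \<beta>' by auto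
    fix s assume s: "s \<in> {\<alpha><..<\<beta>}"
    show "a < \<rho> s" using \<alpha>(2)[of s] s \<alpha>' by (force simp: U_def)
    show "\<rho> s < b" using \<beta>(2)[of s] s \<alpha>' \<beta>' by (force simp: T_def)
  next
    show "b - a \<le> \<bar>\<rho> \<beta> - \<rho> \<alpha>\<bar>" using \<alpha>' \<beta>' by simp
  qed
qed

lemma crossing_interval:
  fixes \<rho> :: "real \<Rightarrow> real"
  assumes c: "continuous_on (closed_segment s0 s1) \<rho>" and ab: "a < b" "\<rho> s0 \<le> a" "b \<le> \<rho> s1"
  obtains \<alpha> \<beta> where "\<alpha> < \<beta>" "{\<alpha>..\<beta>} \<subseteq> closed_segment s0 s1"
    "\<And>s. s \<in> {\<alpha><..<\<beta>} \<Longrightarrow> a < \<rho> s \<and> \<rho> s < b" "b - a \<le> \<bar>\<rho> \<beta> - \<rho> \<alpha>\<bar>"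
proof (cases "s0 \<le> s1")
  case True
  then show ?thesis
    using crossing_interval_aux[of s0 s1 \<rho> a b] assms that by (auto simp: closed_segment_eq_real_ivl)
next
  case False
  then have seg: "closed_segment s0 s1 = {s1..s0}" by (simp add: closed_segment_eq_real_ivl)
  have "continuous_on {- s0..- s1} (\<lambda>s. \<rho> (- s))"
    by (rule continuous_on_compose2[OF c]) (auto intro!: continuous_intros simp: seg)
  from crossing_interval_aux[OF this _ ab(1)] ab False
  obtain \<alpha> \<beta> where *: "\<alpha> < \<beta>" "{\<alpha>..\<beta>} \<subseteq> {- s0..- s1}" "\<forall>s\<in>{\<alpha><..<\<beta>}. a < \<rho> (- s) \<and> \<rho> (- s) < b"
    "b - a \<le> \<bar>\<rho> (- \<beta>) - \<rho> (- \<alpha>)\<bar>"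
    by auto
  show ?thesis
  proof (rule that)
    show "- \<beta> < - \<alpha>" using *(1) by simp
    show "{- \<beta>..- \<alpha>} \<subseteq> closed_segment s0 s1" using *(1,2) by (auto simp: seg)
    show "a < \<rho> s \<and> \<rho> s < b" if "s \<in> {- \<beta><..<- \<alpha>}" for s
      using *(3)[rule_format, of "- s"] that by auto
    show "b - a \<le> \<bar>\<rho> (- \<alpha>) - \<rho> (- \<beta>)\<bar>" using *(4) by linarith
  qed
qed

lemma norm_line_pt_sq: "(cmod (line_pt b c s))\<^sup>2 = c\<^sup>2 + s\<^sup>2"
  by (cases b) (auto simp: line_pt_def cmod_power2)

lemma line_pt_mem_cball:
  assumes "line_pt b c s1 \<in> cball 0 R" "line_pt b c s2 \<in> cball 0 R" "s1 \<le> s" "s \<le> s2"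
  shows "line_pt b c s \<in> cball 0 R"
proof -
  have R: "0 \<le> R" using assms(1) norm_ge_zero[of "line_pt b c s1"] by (simp del: norm_ge_zero)
  have "\<bar>s\<bar> \<le> \<bar>s1\<bar> \<or> \<bar>s\<bar> \<le> \<bar>s2\<bar>" using assms(3,4) by auto
  then have "s\<^sup>2 \<le> s1\<^sup>2 \<or> s\<^sup>2 \<le> s2\<^sup>2" by (simp add: abs_le_square_iff)
  moreover have "(cmod (line_pt b c s1))\<^sup>2 \<le> R\<^sup>2" "(cmod (line_pt b c s2))\<^sup>2 \<le> R\<^sup>2"
    using assms(1,2) by (auto intro!: power_mono)
  ultimately have "(cmod (line_pt b c s))\<^sup>2 \<le> R\<^sup>2" unfolding norm_line_pt_sq by auto
  then show ?thesis using R power2_le_imp_le by auto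
qed

lemma has_derivative_line_pt: "(line_pt b c has_derivative (\<lambda>t. of_real t * dir b)) (at s within S)"
  unfolding line_pt_eq[abs_def] by (auto intro!: derivative_eq_intros)

lemma continuous_on_line_pt [continuous_intros]:
  "continuous_on S f \<Longrightarrow> continuous_on S (\<lambda>s. line_pt b c (f s))"
  unfolding line_pt_eq by (intro continuous_intros)

lemma norm_diff_le_nn_integral_line:
  fixes g gx gy :: "complex \<Rightarrow> complex"
  assumes g: "\<And>z. (g has_derivative (\<lambda>v. Re v *\<^sub>R gx z + Im v *\<^sub>R gy z)) (at z)"
    and cont: "continuous_on UNIV gx" "continuous_on UNIV gy" and le: "s1 \<le> s2"
  shows "ennreal (cmod (g (line_pt b c s2) - g (line_pt b c s1))) \<le>
    (\<integral>\<^sup>+s. indicator {s1..s2} s * ennreal (cmod (if b then gy (line_pt b c s) else gx (line_pt b c s))) \<partial>lborel)"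
proof -
  let ?D = "\<lambda>s. if b then gy (line_pt b c s) else gx (line_pt b c s)"
  have cD: "continuous_on S ?D" for S
    by (cases b) (auto intro!: continuous_on_compose2[OF cont(1)] continuous_on_compose2[OF cont(2)] continuous_intros)
  have dv: "((\<lambda>s. g (line_pt b c s)) has_vector_derivative ?D s) (at s within {s1..s2})" for s
    unfolding has_vector_derivative_def
    by (rule has_derivative_eq_rhs[OF has_derivative_compose[OF has_derivative_line_pt g]])
       (auto simp: dir_def fun_eq_iff)
  have eq: "(LBINT s. indicator {s1..s2} s *\<^sub>R ?D s) = g (line_pt b c s2) - g (line_pt b c s1)"
    by (rule integral_FTC_Icc[OF le dv cD])
  have "integrable lborel (\<lambda>s. indicator {s1..s2} s *\<^sub>R ?D s)"
    by (intro borel_integrable_compact cD) auto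
  from integral_norm_bound_ennreal[OF this]
  have "ennreal (cmod (LBINT s. indicator {s1..s2} s *\<^sub>R ?D s)) \<le> (\<integral>\<^sup>+s. cmod (indicator {s1..s2} s *\<^sub>R ?D s) \<partial>lborel)" .
  also have "\<dots> = (\<integral>\<^sup>+s. indicator {s1..s2} s * ennreal (cmod (?D s)) \<partial>lborel)"
    by (intro nn_integral_cong) (auto simp: indicator_def)
  finally show ?thesis unfolding eq .
qed

context planar_map
begin

text \<open>Absolute continuity of the push-forward: a null set has open neighbourhoods of
  arbitrarily small measure, and the bound for open sets applies to these.\<close>

lemma jac_eq_0_over_null_set:
  assumes N: "N \<in> null_sets lborel"
  shows "AE z in lborel. z \<in> disk \<longrightarrow> h z \<in> N \<inter> disk \<longrightarrow> jac (A z) (B z) = 0"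
proof -
  have [measurable]: "N \<in> sets borel" using N by auto
  from mass_open_bound obtain C :: ennreal where
    CC: "C < \<infinity> \<and> (\<forall>S. open S \<longrightarrow> S \<subseteq> disk \<longrightarrow> mass S \<le> C * emeasure lborel S)" ..
  have C: "C < \<infinity>" using CC ..
  have bound: "mass S \<le> C * emeasure lborel S" if "open S" "S \<subseteq> disk" for S using CC that by blast
  obtain c where c: "C = ennreal c" "0 \<le> c" using C by (cases C) auto
  have "mass (N \<inter> disk) \<le> 0"
  proof (rule ennreal_le_epsilon)
    fix e :: real assume e: "0 < e"
    have NL: "N \<in> sets lebesgue" using \<open>N \<in> sets borel\<close> by auto
    have pos: "0 < e / (c + 1)" using e c(2) by simp
    obtain T where "open T" "N \<subseteq> T" "T - N \<in> lmeasurable" "emeasure lebesgue (T - N) < ennreal (e / (c + 1))"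
      by (rule sets_lebesgue_outer_open[OF NL pos])
    then have T: "open T" "N \<subseteq> T" by simp_all
    have "emeasure lborel T \<le> emeasure lborel N + emeasure lborel (T - N)"
      using T by (subst plus_emeasure) (auto intro!: emeasure_mono)
    also have "\<dots> = emeasure lborel (T - N)" by (simp add: null_setsD1[OF N])
    also have "\<dots> = emeasure lebesgue (T - N)" using T(1) by (simp add: borel_open)
    also have "\<dots> \<le> ennreal (e / (c + 1))"
      using \<open>emeasure lebesgue (T - N) < _\<close> by (rule less_imp_le)
    finally have ET: "emeasure lborel T \<le> ennreal (e / (c + 1))" .
    have "mass (N \<inter> disk) \<le> mass (T \<inter> disk)"
      unfolding mass_def using T(2) by (intro nn_integral_mono) (auto simp: indicator_def)
    also have "\<dots> \<le> C * emeasure lborel (T \<inter> disk)" using T by (intro bound) auto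
    also have "\<dots> \<le> C * emeasure lborel T" using T by (intro mult_left_mono emeasure_mono) auto
    also have "\<dots> \<le> C * ennreal (e / (c + 1))" by (intro mult_left_mono ET) auto
    also have "\<dots> \<le> ennreal e"
      using c e by (simp add: ennreal_mult[symmetric] divide_le_eq algebra_simps)
    finally show "mass (N \<inter> disk) \<le> 0 + ennreal e" by simp
  qed
  \<comment> \<open>On the disk \<open>h\<close> and \<open>H\<close> agree, and \<open>H\<close> is
    the one known to be Borel measurable.\<close>
  then have "(\<integral>\<^sup>+z. indicator disk z * (indicator (N \<inter> disk) (H z) * ennreal (jac (A z) (B z))) \<partial>lborel) = 0"
    unfolding mass_def by (subst nn_integral_cong[where v = "\<lambda>z. indicator disk z * (indicator (N \<inter> disk) (h z) * ennreal (jac (A z) (B z)))"])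
      (auto simp: indicator_def)
  then have "AE z in lborel. indicator disk z * (indicator (N \<inter> disk) (H z) * ennreal (jac (A z) (B z))) = 0"
    by (subst (asm) nn_integral_0_iff_AE) auto
  then show ?thesis
    using jac_nonneg by eventually_elim (auto simp: indicator_def ennreal_eq_0_iff)
qed

definition dir_deriv :: "bool \<Rightarrow> complex \<Rightarrow> complex" where
  "dir_deriv b z = (if b then B z else A z)"

lemma dir_deriv_meas [measurable]: "dir_deriv b \<in> borel_measurable borel"
  unfolding dir_deriv_def[abs_def] by (cases b) auto

text \<open>Fubini selects the lines: on almost every one the smooth derivatives converge almost
  everywhere below an integrable majorant, so the fundamental theorem of calculus for the
  approximants passes to the limit. The exceptional set of \<open>c\<close> does not depend on the
  endpoints, because these will be chosen after the line.\<close>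

lemma absolutely_continuous_on_lines_cball:
  assumes R: "R < 1"
  shows "AE c in lborel. \<forall>s1 s2. s1 \<le> s2 \<longrightarrow> line_pt b c s1 \<in> cball 0 R \<longrightarrow> line_pt b c s2 \<in> cball 0 R \<longrightarrow>
    ennreal (cmod (h (line_pt b c s2) - h (line_pt b c s1))) \<le> (\<integral>\<^sup>+s. indicator {s1..s2} s * ennreal (cmod (dir_deriv b (line_pt b c s))) \<partial>lborel)"
proof -
  obtain hn an bn axx axy byy G where ap:
    "\<And>n z. (hn n has_derivative (\<lambda>v. Re v *\<^sub>R an n z + Im v *\<^sub>R bn n z)) (at z)"
    "\<And>n z. (an n has_derivative (\<lambda>v. Re v *\<^sub>R axx n z + Im v *\<^sub>R axy n z)) (at z)"
    "\<And>n z. (bn n has_derivative (\<lambda>v. Re v *\<^sub>R axy n z + Im v *\<^sub>R byy n z)) (at z)"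
    "\<And>n. continuous_on UNIV (axx n)" "\<And>n. continuous_on UNIV (axy n)" "\<And>n. continuous_on UNIV (byy n)"
    and unif: "\<And>e. 0 < e \<Longrightarrow> eventually (\<lambda>n. \<forall>x\<in>cball 0 R. cmod (hn n x - h x) \<le> e) sequentially"
    and G: "integrable lborel (G :: complex \<Rightarrow> real)"
    and Gb: "AE z in lborel. \<forall>n. z \<in> cball 0 R \<longrightarrow> (cmod (an n z))\<^sup>2 \<le> G z \<and> (cmod (bn n z))\<^sup>2 \<le> G z"
    and lim: "AE z in lborel. z \<in> cball 0 R \<longrightarrow> (\<lambda>n. an n z) \<longlonglongrightarrow> A z \<and> (\<lambda>n. bn n z) \<longlonglongrightarrow> B z"
    using smooth_approx[OF R] by blast
  have conta: "continuous_on UNIV (an n)" "continuous_on UNIV (bn n)" for n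
    by (auto intro!: continuous_at_imp_continuous_on ap(2-3)[THEN has_derivative_continuous])
  have [measurable]: "an n \<in> borel_measurable borel" "bn n \<in> borel_measurable borel" for n
    using conta by (auto intro: borel_measurable_continuous_onI)
  have [measurable]: "G \<in> borel_measurable borel" using G by auto
  have "(\<integral>\<^sup>+c. \<integral>\<^sup>+s. ennreal \<bar>G (line_pt b c s)\<bar> \<partial>lborel \<partial>lborel) = (\<integral>\<^sup>+z. ennreal \<bar>G z\<bar> \<partial>lborel)"
    by (rule nn_integral_line_pt[symmetric]) simp
  also have "\<dots> < \<infinity>" using G by (simp add: integrable_iff_bounded)
  finally have "(\<integral>\<^sup>+c. \<integral>\<^sup>+s. ennreal \<bar>G (line_pt b c s)\<bar> \<partial>lborel \<partial>lborel) \<noteq> \<infinity>" by simp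
  moreover have "(\<lambda>c. \<integral>\<^sup>+s. ennreal \<bar>G (line_pt b c s)\<bar> \<partial>lborel) \<in> borel_measurable lborel"
    by measurable
  ultimately have fin: "AE c in lborel. (\<integral>\<^sup>+s. ennreal \<bar>G (line_pt b c s)\<bar> \<partial>lborel) \<noteq> \<infinity>"
    by (intro nn_integral_PInf_AE)
  show ?thesis
    using fin AE_line_pt[OF Gb, of b] AE_line_pt[OF lim, of b]
  proof eventually_elim
    case (elim c)
    show ?case
    proof (intro allI impI)
      fix s1 s2 :: real assume s: "s1 \<le> s2" "line_pt b c s1 \<in> cball 0 R" "line_pt b c s2 \<in> cball 0 R"
      have mem: "line_pt b c s \<in> cball 0 R" if "s \<in> {s1..s2}" for s using line_pt_mem_cball[OF s(2,3)] that by auto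
      let ?d = "\<lambda>n s. if b then bn n (line_pt b c s) else an n (line_pt b c s)"
      have hlim: "(\<lambda>n. hn n z) \<longlonglongrightarrow> h z" if "z \<in> cball 0 R" for z
      proof (rule metric_LIMSEQ_I)
        fix e :: real assume "0 < e"
        then have "eventually (\<lambda>n. cmod (hn n z - h z) \<le> e / 2) sequentially"
          using unif[of "e / 2"] that by (auto elim!: eventually_mono)
        then show "\<exists>no. \<forall>n\<ge>no. dist (hn n z) (h z) < e"
          unfolding eventually_sequentially dist_norm using \<open>0 < e\<close> by (fastforce elim: order.strict_trans1)
      qed
      have L: "(\<lambda>n. ennreal (cmod (hn n (line_pt b c s2) - hn n (line_pt b c s1)))) \<longlonglongrightarrow> ennreal (cmod (h (line_pt b c s2) - h (line_pt b c s1)))"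
        by (intro tendsto_ennrealI tendsto_norm tendsto_diff hlim s)
      have Rl: "(\<lambda>n. \<integral>\<^sup>+s. indicator {s1..s2} s * ennreal (cmod (?d n s)) \<partial>lborel) \<longlonglongrightarrow>
          (\<integral>\<^sup>+s. indicator {s1..s2} s * ennreal (cmod (dir_deriv b (line_pt b c s))) \<partial>lborel)"
      \<comment> \<open>\<open>G\<close> dominates the squares of the derivatives;
        \<open>x \<le> 1 + x^2\<close> turns this into a bound for the derivatives and explains the
        added indicator.\<close>
      proof (rule nn_integral_dominated_convergence[where w = "\<lambda>s. indicator {s1..s2} s + ennreal \<bar>G (line_pt b c s)\<bar>"])
        have "(\<integral>\<^sup>+s. indicator {s1..s2} s + ennreal \<bar>G (line_pt b c s)\<bar> \<partial>lborel) = emeasure lborel {s1..s2} + (\<integral>\<^sup>+s. ennreal \<bar>G (line_pt b c s)\<bar> \<partial>lborel)"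
          by (subst nn_integral_add) auto
        then show "(\<integral>\<^sup>+s. indicator {s1..s2} s + ennreal \<bar>G (line_pt b c s)\<bar> \<partial>lborel) < \<infinity>"
          using elim(1) s(1) by (simp add: less_top)
        show "AE s in lborel. indicator {s1..s2} s * ennreal (cmod (?d n s)) \<le> indicator {s1..s2} s + ennreal \<bar>G (line_pt b c s)\<bar>" for n
          using elim(2)
        proof eventually_elim
          case (elim s)
          show ?case
          proof (cases "s \<in> {s1..s2}")
            case True
            then have dG: "(cmod (?d n s))\<^sup>2 \<le> G (line_pt b c s)" using elim mem by auto
            have "x \<le> 1 + x\<^sup>2" if "0 \<le> x" for x :: real
              using zero_le_power2[of "x - 1"] that unfolding power2_diff by simp
            from this[OF norm_ge_zero[of "?d n s"]] have "cmod (?d n s) \<le> 1 + (cmod (?d n s))\<^sup>2" .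
            with dG have "cmod (?d n s) \<le> 1 + \<bar>G (line_pt b c s)\<bar>" by linarith
            then have "ennreal (cmod (?d n s)) \<le> ennreal (1 + \<bar>G (line_pt b c s)\<bar>)" by (rule ennreal_leI)
            then show ?thesis using True by (simp add: ennreal_plus)
          qed simp
        qed
        show "AE s in lborel. (\<lambda>n. indicator {s1..s2} s * ennreal (cmod (?d n s))) \<longlonglongrightarrow> indicator {s1..s2} s * ennreal (cmod (dir_deriv b (line_pt b c s)))"
          using elim(3)
        proof eventually_elim
          case (elim s)
          show ?case
          proof (cases "s \<in> {s1..s2}")
            case True
            then have "(\<lambda>n. ?d n s) \<longlonglongrightarrow> dir_deriv b (line_pt b c s)" using elim mem by (cases b) (auto simp: dir_deriv_def)
            then have "(\<lambda>n. ennreal (cmod (?d n s))) \<longlonglongrightarrow> ennreal (cmod (dir_deriv b (line_pt b c s)))"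
              by (intro tendsto_ennrealI tendsto_norm)
            then show ?thesis using True by simp
          qed simp
        qed
      qed (cases b; measurable)+
      show "ennreal (cmod (h (line_pt b c s2) - h (line_pt b c s1))) \<le> (\<integral>\<^sup>+s. indicator {s1..s2} s * ennreal (cmod (dir_deriv b (line_pt b c s))) \<partial>lborel)"
        by (rule LIMSEQ_le[OF L Rl]) (use norm_diff_le_nn_integral_line[OF ap(1) conta s(1)] in blast)
    qed
  qed
qed

lemma absolutely_continuous_on_lines:
  "AE c in lborel. \<forall>s1 s2. s1 \<le> s2 \<longrightarrow> line_pt b c s1 \<in> disk \<longrightarrow> line_pt b c s2 \<in> disk \<longrightarrow>
    ennreal (cmod (h (line_pt b c s2) - h (line_pt b c s1))) \<le> (\<integral>\<^sup>+s. indicator {s1..s2} s * ennreal (cmod (dir_deriv b (line_pt b c s))) \<partial>lborel)"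
proof -
  define R where "R n = 1 - inverse (real (Suc n))" for n
  have R: "R n < 1" for n by (simp add: R_def)
  have Rlim: "R \<longlonglongrightarrow> 1 - 0" unfolding R_def by (intro tendsto_intros LIMSEQ_inverse_real_of_nat)
  have "AE c in lborel. \<forall>n. \<forall>s1 s2. s1 \<le> s2 \<longrightarrow> line_pt b c s1 \<in> cball 0 (R n) \<longrightarrow> line_pt b c s2 \<in> cball 0 (R n) \<longrightarrow>
    ennreal (cmod (h (line_pt b c s2) - h (line_pt b c s1))) \<le> (\<integral>\<^sup>+s. indicator {s1..s2} s * ennreal (cmod (dir_deriv b (line_pt b c s))) \<partial>lborel)"
    unfolding AE_all_countable using absolutely_continuous_on_lines_cball[OF R] by blast
  then show ?thesis
  proof eventually_elim
    case (elim c)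
    show ?case
    proof (intro allI impI)
      fix s1 s2 :: real assume s: "s1 \<le> s2" "line_pt b c s1 \<in> disk" "line_pt b c s2 \<in> disk"
      have "eventually (\<lambda>n. max (cmod (line_pt b c s1)) (cmod (line_pt b c s2)) < R n) sequentially"
        using s by (intro order_tendstoD(1)[OF Rlim]) auto
      then obtain n where "max (cmod (line_pt b c s1)) (cmod (line_pt b c s2)) < R n" using eventually_sequentially by auto
      then show "ennreal (cmod (h (line_pt b c s2) - h (line_pt b c s1))) \<le> (\<integral>\<^sup>+s. indicator {s1..s2} s * ennreal (cmod (dir_deriv b (line_pt b c s))) \<partial>lborel)"
        using elim[rule_format, of s1 s2 n] s(1) by simp
    qed
  qed
qed

end

subsection \<open>Almost every line misses a fibre\<close>

text \<open>The factor 2 in \<open>distortion\<close> arises because |h_x|^2 + |h_y|^2 is twice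
  |h_z|^2 + |h_zbar|^2. The push-forward bound concerns open subsets of the open disk;
  \<open>jac_edge\<close> rules out that \<open>J\<close> carries mass to the circle.\<close>

locale light_map = planar_map +
  fixes K :: "complex \<Rightarrow> real"
  assumes K_meas [measurable]: "K \<in> borel_measurable borel"
    and K_nonneg: "0 \<le> K z"
    and K_int: "(\<integral>\<^sup>+z. indicator disk z * ennreal (K z) \<partial>lborel) < \<infinity>"
    and distortion: "AE z in lborel. z \<in> disk \<longrightarrow> (cmod (A z))\<^sup>2 + (cmod (B z))\<^sup>2 \<le> 2 * K z * jac (A z) (B z)"
    and sphere_inj: "inj_on h (sphere 0 1)"
    and jac_edge: "AE z in lborel. z \<in> disk \<longrightarrow> h z \<notin> disk \<longrightarrow> jac (A z) (B z) = 0"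
begin

text \<open>Dyadic shells around the fibre over \<open>y\<close>. Strict inequalities make them
  disjoint and fit the open intervals on which a line crosses a shell.\<close>

definition annulus :: "complex \<Rightarrow> nat \<Rightarrow> complex set" where
  "annulus y n = {z \<in> disk. (1/2) ^ Suc n < cmod (H z - y) \<and> cmod (H z - y) < (1/2) ^ n}"

lemma annulus_meas [measurable]: "annulus y n \<in> sets borel"
  unfolding annulus_def by measurable

lemma annulus_disjoint: "disjoint_family (annulus y)"
proof -
  have "annulus y m \<inter> annulus y n = {}" if "m < n" for m n
  proof -
    have le: "(1/2 :: real) ^ n \<le> (1/2) ^ Suc m" using that by (intro power_decreasing) auto
    have False if "z \<in> annulus y m" "z \<in> annulus y n" for z
    proof -
      have "(1/2) ^ Suc m < cmod (H z - y)" "cmod (H z - y) < (1/2) ^ n"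
        using that unfolding annulus_def by blast+
      then show False using le by linarith
    qed
    then show ?thesis by blast
  qed
  then show ?thesis unfolding disjoint_family_on_def by (metis Int_commute nat_neq_iff)
qed

text \<open>Up to constants, the value of 1 / (t log (1/t)) at t = 2^-n; \<open>Suc n\<close> keeps
  the denominator positive for n = 0.\<close>

definition weight :: "nat \<Rightarrow> real" where "weight n = 2 ^ n / real (Suc n)"

lemma weight_pos: "0 < weight n" by (simp add: weight_def)

text \<open>Cauchy-Schwarz in pointwise form: w^2 |Dh|^2 <= 2 K w^2 J <= (K + w^2 J)^2, hence w |Dh|
  <= K + w^2 J for each directional derivative. The \<open>K\<close> terms add up to at most the
  integral of \<open>K\<close> since the shells are disjoint; the \<open>J\<close> term of a shell
  is bounded by the mass of a ball of radius 2^-n.\<close>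

lemma annulus_sum_finite:
  "(\<Sum>n. \<integral>\<^sup>+z. indicator (annulus y n) z * ennreal (weight n * cmod (dir_deriv b z)) \<partial>lborel) < \<infinity>"
proof -
  from mass_open_bound obtain C :: ennreal where
    CC: "C < \<infinity> \<and> (\<forall>S. open S \<longrightarrow> S \<subseteq> disk \<longrightarrow> mass S \<le> C * emeasure lborel S)" ..
  have C: "C < \<infinity>" using CC ..
  have bound: "mass S \<le> C * emeasure lborel S" if "open S" "S \<subseteq> disk" for S using CC that by blast
  obtain c where c: "C = ennreal c" "0 \<le> c" using C by (cases C) auto
  let ?K = "\<lambda>n. \<integral>\<^sup>+z. indicator (annulus y n) z * ennreal (K z) \<partial>lborel"
  let ?J = "\<lambda>n. \<integral>\<^sup>+z. indicator (annulus y n) z * ennreal (jac (A z) (B z)) \<partial>lborel"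
  have bnd: "(\<integral>\<^sup>+z. indicator (annulus y n) z * ennreal (weight n * cmod (dir_deriv b z)) \<partial>lborel) \<le>
      ?K n + ennreal ((weight n)\<^sup>2) * ?J n" for n
  proof -
    have "AE z in lborel. indicator (annulus y n) z * ennreal (weight n * cmod (dir_deriv b z)) \<le>
        indicator (annulus y n) z * ennreal (K z) + ennreal ((weight n)\<^sup>2) * (indicator (annulus y n) z * ennreal (jac (A z) (B z)))"
      using distortion jac_nonneg
    proof eventually_elim
      case (elim z)
      show ?case
      proof (cases "z \<in> annulus y n")
        case True
        then have z: "z \<in> disk" by (auto simp: annulus_def)
        let ?w = "weight n" and ?j = "jac (A z) (B z)"
        have j: "0 \<le> ?j" using elim z by auto
        have "(cmod (dir_deriv b z))\<^sup>2 \<le> (cmod (A z))\<^sup>2 + (cmod (B z))\<^sup>2" by (auto simp: dir_deriv_def)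
        also have "\<dots> \<le> 2 * K z * ?j" using elim z by auto
        finally have "?w\<^sup>2 * (cmod (dir_deriv b z))\<^sup>2 \<le> ?w\<^sup>2 * (2 * K z * ?j)" by (intro mult_left_mono) auto
        also have "\<dots> \<le> (K z + ?w\<^sup>2 * ?j)\<^sup>2"
          unfolding power2_sum using zero_le_power2[of "K z"] zero_le_power2[of "?w\<^sup>2 * ?j"] by (simp add: algebra_simps)
        finally have "(?w * cmod (dir_deriv b z))\<^sup>2 \<le> (K z + ?w\<^sup>2 * ?j)\<^sup>2" unfolding power_mult_distrib .
        moreover have "0 \<le> K z + ?w\<^sup>2 * ?j" using K_nonneg[of z] j by simp
        ultimately have "?w * cmod (dir_deriv b z) \<le> K z + ?w\<^sup>2 * ?j" by (rule power2_le_imp_le)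
        then have "ennreal (?w * cmod (dir_deriv b z)) \<le> ennreal (K z + ?w\<^sup>2 * ?j)" by (rule ennreal_leI)
        also have "\<dots> = ennreal (K z) + ennreal (?w\<^sup>2) * ennreal ?j"
          using K_nonneg[of z] j by (simp add: ennreal_plus ennreal_mult)
        finally show ?thesis using True by simp
      qed simp
    qed
    then have "(\<integral>\<^sup>+z. indicator (annulus y n) z * ennreal (weight n * cmod (dir_deriv b z)) \<partial>lborel) \<le>
      (\<integral>\<^sup>+z. indicator (annulus y n) z * ennreal (K z) + ennreal ((weight n)\<^sup>2) * (indicator (annulus y n) z * ennreal (jac (A z) (B z))) \<partial>lborel)"
      by (rule nn_integral_mono_AE)
    also have "\<dots> = ?K n + ennreal ((weight n)\<^sup>2) * ?J n"
      by (simp add: nn_integral_add nn_integral_cmult)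
    finally show ?thesis .
  qed
  have J: "?J n \<le> ennreal (c * (pi * ((1/2) ^ n)\<^sup>2))" for n
  proof -
    \<comment> \<open>The point \<open>y\<close> may lie on the circle, so the ball is cut down to
      the disk before the mass bound applies; \<open>jac_edge\<close> shows that nothing is
      lost.\<close>
    let ?S = "ball y ((1/2) ^ n) \<inter> disk"
    have "?J n \<le> mass ?S"
      unfolding mass_def
    proof (rule nn_integral_mono_AE)
      show "AE z in lborel. indicator (annulus y n) z * ennreal (jac (A z) (B z)) \<le>
          indicator disk z * (indicator ?S (h z) * ennreal (jac (A z) (B z)))"
        using jac_edge
      proof eventually_elim
        case (elim z)
        show ?case
        proof (cases "z \<in> annulus y n")
          case True
          then have "z \<in> disk" "h z \<in> ball y ((1/2) ^ n)" by (auto simp: annulus_def dist_norm norm_minus_commute)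
          then show ?thesis using True elim by (cases "h z \<in> disk") auto
        qed simp
      qed
    qed
    also have "\<dots> \<le> C * emeasure lborel ?S" by (intro bound) auto
    also have "\<dots> \<le> C * emeasure lborel (ball y ((1/2) ^ n))" by (intro mult_left_mono emeasure_mono) auto
    also have "\<dots> = ennreal (c * (pi * ((1/2) ^ n)\<^sup>2))"
      unfolding c(1) using c(2) by (simp add: emeasure_ball unit_ball_vol_2 ennreal_mult)
    finally show ?thesis .
  qed
  have "(\<Sum>n. \<integral>\<^sup>+z. indicator (annulus y n) z * ennreal (weight n * cmod (dir_deriv b z)) \<partial>lborel) \<le>
      (\<Sum>n. ?K n + ennreal (c * pi * (1 / (real (Suc n))\<^sup>2)))"
  proof (rule suminf_le)
    fix n
    have "ennreal ((weight n)\<^sup>2) * ?J n \<le> ennreal ((weight n)\<^sup>2) * ennreal (c * (pi * ((1/2) ^ n)\<^sup>2))"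
      by (intro mult_left_mono J) auto
    also have "\<dots> = ennreal ((weight n)\<^sup>2 * (c * (pi * ((1/2) ^ n)\<^sup>2)))" by (rule ennreal_mult'[symmetric]) simp
    also have "(weight n)\<^sup>2 * (c * (pi * ((1/2) ^ n)\<^sup>2)) = c * pi * (1 / (real (Suc n))\<^sup>2)"
      by (simp add: weight_def power_divide power_one_over field_simps)
    finally show "(\<integral>\<^sup>+z. indicator (annulus y n) z * ennreal (weight n * cmod (dir_deriv b z)) \<partial>lborel) \<le> ?K n + ennreal (c * pi * (1 / (real (Suc n))\<^sup>2))"
      using bnd[of n] by (meson add_left_mono order_trans)
  qed auto
  also have "\<dots> = (\<Sum>n. ?K n) + (\<Sum>n. ennreal (c * pi * (1 / (real (Suc n))\<^sup>2)))"
    by (rule suminf_add[symmetric]) auto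
  also have "(\<Sum>n. ?K n) = (\<integral>\<^sup>+z. (\<Sum>n. indicator (annulus y n) z * ennreal (K z)) \<partial>lborel)"
    by (rule nn_integral_suminf[symmetric]) measurable
  also have "\<dots> = (\<integral>\<^sup>+z. indicator (\<Union>n. annulus y n) z * ennreal (K z) \<partial>lborel)"
    using annulus_disjoint by (simp add: suminf_indicator)
  also have "\<dots> \<le> (\<integral>\<^sup>+z. indicator disk z * ennreal (K z) \<partial>lborel)"
    by (intro nn_integral_mono mult_right_mono) (auto simp: indicator_def annulus_def)
  also have "(\<Sum>n. ennreal (c * pi * (1 / (real (Suc n))\<^sup>2))) < \<infinity>"
  proof -
    have "summable (\<lambda>n. inverse (real (Suc n) ^ 2))"
      using inverse_power_summable[of 2, where 'a = real] by (subst summable_Suc_iff) simp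
    then have "summable (\<lambda>n. c * pi * (1 / (real (Suc n))\<^sup>2))"
      by (intro summable_mult) (simp add: inverse_eq_divide)
    then show ?thesis using c(2) by (subst suminf_ennreal2) auto
  qed
  finally show ?thesis using K_int by (simp add: ennreal_add_less_top less_top)
qed

text \<open>Along a line meeting the fibre the dyadic annuli would contribute at least the harmonic series.\<close>

theorem AE_line_misses_fibre:
  assumes y: "y \<in> closed_disk"
  shows "AE c in lborel. \<forall>s. line_pt b c s \<in> disk \<longrightarrow> h (line_pt b c s) \<noteq> y"
proof -
  define g where "g n z = indicator (annulus y n) z * ennreal (weight n * cmod (dir_deriv b z))" for n z
  have [measurable]: "g n \<in> borel_measurable borel" for n unfolding g_def[abs_def] by measurable
  have "(\<integral>\<^sup>+c. (\<Sum>n. \<integral>\<^sup>+s. g n (line_pt b c s) \<partial>lborel) \<partial>lborel) = (\<Sum>n. \<integral>\<^sup>+c. \<integral>\<^sup>+s. g n (line_pt b c s) \<partial>lborel \<partial>lborel)"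
    by (rule nn_integral_suminf) measurable
  also have "\<dots> = (\<Sum>n. \<integral>\<^sup>+z. g n z \<partial>lborel)"
    by (subst nn_integral_line_pt[of "g _" b, symmetric]) auto
  also have "\<dots> < \<infinity>" unfolding g_def by (rule annulus_sum_finite)
  finally have "(\<integral>\<^sup>+c. (\<Sum>n. \<integral>\<^sup>+s. g n (line_pt b c s) \<partial>lborel) \<partial>lborel) \<noteq> \<infinity>" by simp
  moreover have "(\<lambda>c. \<Sum>n. \<integral>\<^sup>+s. g n (line_pt b c s) \<partial>lborel) \<in> borel_measurable lborel" by measurable
  ultimately have "AE c in lborel. (\<Sum>n. \<integral>\<^sup>+s. g n (line_pt b c s) \<partial>lborel) \<noteq> \<infinity>"
    by (intro nn_integral_PInf_AE)
  then show ?thesis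
    using absolutely_continuous_on_lines[of b]
  proof eventually_elim
    case (elim c)
    show ?case
    proof (intro allI impI notI)
      fix s0 assume s0: "line_pt b c s0 \<in> disk" "h (line_pt b c s0) = y"
      have c0: "c\<^sup>2 + s0\<^sup>2 < 1"
      proof -
        have "(cmod (line_pt b c s0))\<^sup>2 < 1\<^sup>2" using s0(1) by (intro power_strict_mono) auto
        then show ?thesis by (simp add: norm_line_pt_sq)
      qed
      have c1: "c\<^sup>2 < 1" using c0 zero_le_power2[of s0] by linarith
      define \<sigma> where "\<sigma> = sqrt (1 - c\<^sup>2)"
      have \<sigma>2: "\<sigma>\<^sup>2 = 1 - c\<^sup>2" using c1 by (simp add: \<sigma>_def)
      have \<sigma>: "0 < \<sigma>" using c1 by (simp add: \<sigma>_def)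
      have cl: "line_pt b c s \<in> closed_disk \<longleftrightarrow> \<bar>s\<bar> \<le> \<sigma>" "line_pt b c s \<in> disk \<longleftrightarrow> \<bar>s\<bar> < \<sigma>" for s
      proof -
        have "line_pt b c s \<in> closed_disk \<longleftrightarrow> (cmod (line_pt b c s))\<^sup>2 \<le> 1" by (simp add: abs_square_le_1)
        also have "\<dots> \<longleftrightarrow> s\<^sup>2 \<le> \<sigma>\<^sup>2" by (auto simp: norm_line_pt_sq \<sigma>2)
        also have "\<dots> \<longleftrightarrow> \<bar>s\<bar> \<le> \<sigma>" using \<sigma> by (simp add: abs_le_square_iff[symmetric])
        finally show "line_pt b c s \<in> closed_disk \<longleftrightarrow> \<bar>s\<bar> \<le> \<sigma>" .
        have "line_pt b c s \<in> disk \<longleftrightarrow> (cmod (line_pt b c s))\<^sup>2 < 1" by (simp add: abs_square_less_1)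
        also have "\<dots> \<longleftrightarrow> s\<^sup>2 < \<sigma>\<^sup>2" by (auto simp: norm_line_pt_sq \<sigma>2)
        also have "\<dots> \<longleftrightarrow> \<bar>s\<bar> < \<sigma>" using \<sigma> abs_le_square_iff[of \<sigma> s] by (simp add: not_le[symmetric])
        finally show "line_pt b c s \<in> disk \<longleftrightarrow> \<bar>s\<bar> < \<sigma>" .
      qed
      have sph: "line_pt b c \<sigma> \<in> sphere 0 1" "line_pt b c (- \<sigma>) \<in> sphere 0 1"
        using cl(1)[of \<sigma>] cl(2)[of \<sigma>] cl(1)[of "- \<sigma>"] cl(2)[of "- \<sigma>"] \<sigma> by auto
      have "line_pt b c \<sigma> \<noteq> line_pt b c (- \<sigma>)" using \<sigma> by (auto simp: line_pt_def split: if_splits)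
      then have "h (line_pt b c \<sigma>) \<noteq> h (line_pt b c (- \<sigma>))" using sphere_inj sph by (auto dest: inj_onD)
      \<comment> \<open>A chord could a priori lie entirely in the fibre. Injectivity on the circle
        gives one of its ends a different value.\<close>
      then obtain \<tau> where \<tau>: "\<bar>\<tau>\<bar> = \<sigma>" "h (line_pt b c \<tau>) \<noteq> y"
        using \<sigma> by (cases "h (line_pt b c \<sigma>) = y") (auto intro: that[of \<sigma>] that[of "- \<sigma>"])
      define \<rho> where "\<rho> s = cmod (h (line_pt b c s) - y)" for s
      have cont: "continuous_on {- \<sigma>..\<sigma>} \<rho>"
        unfolding \<rho>_def
        by (intro continuous_intros continuous_on_compose2[OF h_cont]) (use cl in auto)
      \<comment> \<open>Continuity moves this end into the open disk, where absolute continuity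
        along the line holds.\<close>
      obtain s1 where s1: "\<bar>s1\<bar> < \<sigma>" "0 < \<rho> s1"
      proof -
        have "\<tau> \<in> {- \<sigma>..\<sigma>}" using \<tau>(1) by auto
        then obtain e where e: "0 < e" "\<And>s. s \<in> {- \<sigma>..\<sigma>} \<Longrightarrow> dist s \<tau> < e \<Longrightarrow> dist (\<rho> s) (\<rho> \<tau>) < \<rho> \<tau>"
          using cont \<tau>(2) unfolding continuous_on_iff by (metis \<rho>_def right_minus_eq zero_less_norm_iff)
        define m where "m = min (e / 2) \<sigma>"
        have m: "0 < m" "m < e" "m \<le> \<sigma>" using e \<sigma> by (auto simp: m_def)
        define s where "s = (if 0 < \<tau> then \<tau> - m else \<tau> + m)"
        have s: "\<bar>s\<bar> < \<sigma>" "dist s \<tau> < e" using m \<tau>(1) \<sigma> by (auto simp: s_def dist_real_def)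
        then have "dist (\<rho> s) (\<rho> \<tau>) < \<rho> \<tau>" by (intro e(2)) auto
        then have "0 < \<rho> s" by (auto simp: dist_real_def)
        then show ?thesis using s(1) that by blast
      qed
      have s0': "\<bar>s0\<bar> < \<sigma>" "\<rho> s0 = 0" using s0 cl by (auto simp: \<rho>_def)
      have seg: "closed_segment s0 s1 \<subseteq> {- \<sigma><..<\<sigma>}"
        using s0'(1) s1(1) by (auto simp: closed_segment_eq_real_ivl split: if_splits)
      have contseg: "continuous_on (closed_segment s0 s1) \<rho>"
        using seg by (intro continuous_on_subset[OF cont]) auto
      obtain n0 where n0: "(1/2 :: real) ^ n0 < \<rho> s1"
        using real_arch_pow_inv[OF s1(2), of "1/2"] by auto
      \<comment> \<open>For such \<open>n\<close> the distance \<rho> passes from 0 to above 2^-n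
        between \<open>s0\<close> and \<open>s1\<close>. Crossing the shell changes it by at least
        2^-(n+1), which the weight turns into 1 / (2 (n + 1)).\<close>
      have low: "ennreal (1 / (2 * real (Suc n))) \<le> (\<integral>\<^sup>+s. g n (line_pt b c s) \<partial>lborel)" if n: "n0 \<le> n" for n
      proof -
        have "(1/2 :: real) ^ n \<le> (1/2) ^ n0" using n by (intro power_decreasing) auto
        then have "(1/2) ^ n \<le> \<rho> s1" by (rule order_trans[OF _ less_imp_le[OF n0]])
        then obtain \<alpha> \<beta> where ab: "\<alpha> < \<beta>" "{\<alpha>..\<beta>} \<subseteq> closed_segment s0 s1"
          "\<And>s. s \<in> {\<alpha><..<\<beta>} \<Longrightarrow> (1/2) ^ Suc n < \<rho> s \<and> \<rho> s < (1/2) ^ n" "(1/2) ^ n - (1/2) ^ Suc n \<le> \<bar>\<rho> \<beta> - \<rho> \<alpha>\<bar>"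
          using crossing_interval[OF contseg, of "(1/2) ^ Suc n" "(1/2) ^ n"] s0'(2) by auto
        have sub: "line_pt b c s \<in> disk" if "s \<in> {\<alpha>..\<beta>}" for s
        proof -
          have "s \<in> {- \<sigma><..<\<sigma>}" using that ab(2) seg by blast
          then have "\<bar>s\<bar> < \<sigma>" by auto
          then show ?thesis using cl(2) by blast
        qed
        have "(1/2) ^ Suc n \<le> \<bar>\<rho> \<beta> - \<rho> \<alpha>\<bar>" using ab(4) by simp
        also have "\<dots> \<le> cmod (h (line_pt b c \<beta>) - h (line_pt b c \<alpha>))"
          unfolding \<rho>_def using norm_triangle_ineq3[of "h (line_pt b c \<beta>) - y" "h (line_pt b c \<alpha>) - y"] by simp
        finally have "ennreal ((1/2) ^ Suc n) \<le> ennreal (cmod (h (line_pt b c \<beta>) - h (line_pt b c \<alpha>)))" by (rule ennreal_leI)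
        also have "\<dots> \<le> (\<integral>\<^sup>+s. indicator {\<alpha>..\<beta>} s * ennreal (cmod (dir_deriv b (line_pt b c s))) \<partial>lborel)"
          using elim(2)[rule_format, of \<alpha> \<beta>] ab(1) sub by simp
        finally have l1: "ennreal (weight n) * ennreal ((1/2) ^ Suc n) \<le> ennreal (weight n) * (\<integral>\<^sup>+s. indicator {\<alpha>..\<beta>} s * ennreal (cmod (dir_deriv b (line_pt b c s))) \<partial>lborel)"
          by (rule mult_left_mono) simp
        have "ennreal (weight n) * ennreal ((1/2) ^ Suc n) = ennreal (weight n * (1/2) ^ Suc n)"
          using weight_pos[of n] by (intro ennreal_mult'[symmetric]) simp
        also have "weight n * (1/2) ^ Suc n = 1 / (2 * real (Suc n))"
        proof -
          have "2 ^ n * (1/2) ^ n = (2 * (1/2) :: real) ^ n" by (rule power_mult_distrib[symmetric])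
          then have p: "2 ^ n * (1/2) ^ n = (1::real)" by simp
          have "a / m * (1/2 * x) = a * x * (1 / (2 * m))" for a m x :: real
            by (cases "m = 0") (auto simp: field_simps)
          from this[of "2 ^ n" "real (Suc n)" "(1/2) ^ n"] show ?thesis
            unfolding weight_def power_Suc p by (simp only: mult_1_left)
        qed
        finally have l2: "ennreal (1 / (2 * real (Suc n))) \<le> ennreal (weight n) * (\<integral>\<^sup>+s. indicator {\<alpha>..\<beta>} s * ennreal (cmod (dir_deriv b (line_pt b c s))) \<partial>lborel)"
          using l1 by simp
        have "ennreal (weight n) * (\<integral>\<^sup>+s. indicator {\<alpha>..\<beta>} s * ennreal (cmod (dir_deriv b (line_pt b c s))) \<partial>lborel) =
          (\<integral>\<^sup>+s. ennreal (weight n) * (indicator {\<alpha>..\<beta>} s * ennreal (cmod (dir_deriv b (line_pt b c s)))) \<partial>lborel)"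
          by (rule nn_integral_cmult[symmetric]) measurable
        also have "\<dots> \<le> (\<integral>\<^sup>+s. g n (line_pt b c s) \<partial>lborel)"
        proof (rule nn_integral_mono_AE)
          show "AE s in lborel. ennreal (weight n) * (indicator {\<alpha>..\<beta>} s * ennreal (cmod (dir_deriv b (line_pt b c s)))) \<le> g n (line_pt b c s)"
            using AE_lborel_singleton[of \<alpha>] AE_lborel_singleton[of \<beta>]
          proof eventually_elim
            case (elim s)
            show ?case
            proof (cases "s \<in> {\<alpha><..<\<beta>}")
              case True
              then have "line_pt b c s \<in> annulus y n" using ab(3)[OF True] sub[of s] by (auto simp: annulus_def \<rho>_def)
              then show ?thesis using True weight_pos[of n] by (simp add: g_def ennreal_mult)
            next
              case False
              then have "s \<notin> {\<alpha>..\<beta>}" using elim by auto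
              then show ?thesis by simp
            qed
          qed
        qed
        finally show ?thesis using l2 by simp
      qed
      define x where "x n = (if n0 \<le> n then 1 / (2 * real (Suc n)) else 0)" for n
      have "(\<Sum>n. ennreal (x n)) \<le> (\<Sum>n. \<integral>\<^sup>+s. g n (line_pt b c s) \<partial>lborel)"
        by (intro suminf_le) (use low in \<open>auto simp: x_def\<close>)
      then have "(\<Sum>n. ennreal (x n)) \<noteq> top" using elim(1) by (auto simp: top_unique)
      then have sx: "summable x" by (intro summable_suminf_not_top) (auto simp: x_def)
      have ev: "eventually (\<lambda>n. x n = 1 / (2 * real (Suc n))) sequentially"
        using eventually_ge_at_top[of n0] by eventually_elim (simp add: x_def)
      have "summable (\<lambda>n. 1 / (2 * real (Suc n)))" using summable_cong[OF ev] sx by blast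
      from summable_mult[OF this, of 2] have "summable (\<lambda>n. inverse (real (Suc n)))"
        by (simp add: field_simps inverse_eq_divide del: of_nat_Suc)
      then have "summable (\<lambda>n. inverse (of_nat n) :: real)" by (subst (asm) summable_Suc_iff)
      then show False using not_summable_harmonic[where 'a = real] by blast
    qed
  qed
qed

end

section \<open>Injectivity\<close>

context light_map
begin

text \<open>The function \<pi> will be a coordinate or its negative, so one lemma treats both sides
  of the line. Because \<open>w0\<close> may lie on the circle, the open set on which
  \<open>h\<close> turns out to be constant is a ball around \<open>w0\<close> intersected with the
  disk.\<close>

lemma side_contradiction:
  fixes \<pi> :: "complex \<Rightarrow> real"
  assumes X: "X \<subseteq> disk" "\<And>z. z \<in> X \<Longrightarrow> h (f z) = z"
    and jX: "AE w in lborel. w \<in> disk \<longrightarrow> w \<notin> f ` X \<longrightarrow> jac (A w) (B w) = 0"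
    and \<pi>: "continuous_on UNIV \<pi>" and w0: "w0 \<in> closed_disk" "c < \<pi> w0" and \<eta>: "0 < \<eta>"
    and ae: "AE z in lborel. z \<in> X \<longrightarrow> z \<in> ball (h w0) \<eta> \<longrightarrow> \<not> c < \<pi> (f z)"
  shows False
proof -
  obtain N where N: "{z. \<not> (z \<in> X \<longrightarrow> z \<in> ball (h w0) \<eta> \<longrightarrow> \<not> c < \<pi> (f z))} \<subseteq> N" "emeasure lborel N = 0" "N \<in> sets lborel"
    using AE_E[OF ae] by auto
  then have Nn: "N \<in> null_sets lborel" by auto
  \<comment> \<open>A point \<open>w = f x\<close> with \<open>x \<in> X\<close> satisfies
    \<open>h w = x\<close>. If \<pi> exceeds \<open>c\<close> at \<open>w\<close>, then
    \<open>x\<close> belongs to the exceptional null set of \<open>ae\<close>, and over a null set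
    the Jacobian vanishes. Points outside the image of \<open>X\<close> are covered by
    \<open>jX\<close>.\<close>
  have zero: "AE w in lborel. w \<in> disk \<longrightarrow> c < \<pi> w \<longrightarrow> h w \<in> ball (h w0) \<eta> \<longrightarrow> A w = 0 \<and> B w = 0"
    using jX jac_eq_0_over_null_set[OF Nn] distortion
  proof eventually_elim
    case (elim w)
    show ?case
    proof (intro impI)
      assume w: "w \<in> disk" "c < \<pi> w" "h w \<in> ball (h w0) \<eta>"
      have "jac (A w) (B w) = 0"
      proof (cases "w \<in> f ` X")
        case True
        then obtain x where x: "x \<in> X" "w = f x" by blast
        then have "h w = x" using X(2) by simp
        then have "h w \<in> N \<inter> disk" using N(1) x w X(1) by auto
        then show ?thesis using elim(2) w by blast
      next
        case False
        then show ?thesis using elim(1) w by blast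
      qed
      then have "(cmod (A w))\<^sup>2 + (cmod (B w))\<^sup>2 \<le> 0" using elim(3) w by simp
      then show "A w = 0 \<and> B w = 0"
        by (metis add_nonneg_eq_0_iff norm_eq_zero order_antisym power_eq_0_iff sum_power2_ge_zero zero_le_power2)
    qed
  qed
  have "continuous_on closed_disk \<pi>" using \<pi> continuous_on_subset by blast
  then obtain e1 where e1: "0 < e1" "\<And>w. w \<in> closed_disk \<Longrightarrow> dist w w0 < e1 \<Longrightarrow> dist (\<pi> w) (\<pi> w0) < \<pi> w0 - c"
    using w0 unfolding continuous_on_iff by (metis diff_gt_0_iff_gt)
  obtain e2 where e2: "0 < e2" "\<And>w. w \<in> closed_disk \<Longrightarrow> dist w w0 < e2 \<Longrightarrow> dist (h w) (h w0) < \<eta>"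
    using h_cont w0(1) \<eta> unfolding continuous_on_iff by metis
  define W where "W = ball w0 (min e1 e2) \<inter> disk"
  have W: "open W" "convex W" by (auto simp: W_def intro!: convex_Int)
  have Wne: "W \<noteq> {}"
  proof -
    have "w0 \<in> closure disk" using w0(1) by simp
    then show ?thesis
      using e1(1) e2(1) unfolding closure_approachable W_def by (metis Int_iff dist_commute empty_iff mem_ball min_less_iff_conj)
  qed
  have inW: "w \<in> disk \<and> c < \<pi> w \<and> h w \<in> ball (h w0) \<eta>" if "w \<in> W" for w
    using e1(2)[of w] e2(2)[of w] that by (auto simp: W_def dist_commute dist_real_def)
  have "\<exists>k. AE z in lborel. z \<in> W \<longrightarrow> H z = k"
  proof (rule AE_const_of_conv_deriv_eq_0[OF H_int W])
    fix x :: complex and d :: real assume d: "0 < d" "cball x d \<subseteq> W"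
    have sub: "cball x d \<subseteq> disk" using d(2) by (auto simp: W_def)
    have "conv (mollifier d) A x = 0" "conv (mollifier d) B x = 0"
    proof -
      have ae0: "AE z in lborel. mollifier d (x - z) *\<^sub>R A z = 0 \<and> mollifier d (x - z) *\<^sub>R B z = 0"
        using zero
      proof eventually_elim
        case (elim z)
        show ?case
        proof (cases "cmod (x - z) < d")
          case True
          then have "z \<in> W" using d(2) by (auto simp: dist_norm)
          then show ?thesis using elim inW by simp
        qed (use mollifier_eq_0[OF d(1)] in auto)
      qed
      show "conv (mollifier d) A x = 0" "conv (mollifier d) B x = 0"
        unfolding conv_def by (rule integral_eq_zero_AE; use ae0 in eventually_elim; simp)+
    qed
    then show "conv (mollifier_x d) H x = 0 \<and> conv (mollifier_y d) H x = 0"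
      using conv_x[OF d(1) sub] conv_y[OF d(1) sub] by (simp add: H_def[abs_def])
  qed
  then obtain k where k: "AE z in lborel. z \<in> W \<longrightarrow> H z = k" ..
  have hk: "h z = k" if "z \<in> W" for z
  proof (rule ccontr)
    assume ne: "h z \<noteq> k"
    have "continuous_on W h" by (rule continuous_on_subset[OF h_cont]) (auto simp: W_def)
    then have "open (W \<inter> h -` (- {k}))" using W(1) by (intro continuous_open_preimage) auto
    moreover have "W \<inter> h -` (- {k}) \<in> null_sets lborel"
    proof -
      have "AE z in lborel. z \<notin> W \<inter> h -` (- {k})"
        using k by eventually_elim (auto simp: W_def)
      then show ?thesis using calculation by (subst AE_iff_null_sets) auto
    qed
    ultimately have "W \<inter> h -` (- {k}) = {}"
      using open_not_negligible negligible_iff_null_sets null_sets_completionI by blast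
    then show False using ne that by auto
  qed
  obtain z1 where z1: "z1 \<in> W" using Wne by blast
  then obtain e where e: "0 < e" "ball z1 e \<subseteq> W" using W(1) openE by blast
  have kc: "k \<in> closed_disk" using hk[OF z1] h_closed[of z1] z1 by (auto simp: W_def)
  \<comment> \<open>The vertical lines through \<open>ball z1 e\<close> form an interval of positive
    length, and each of them meets the fibre over \<open>k\<close>.\<close>
  have "AE c in lborel. c \<notin> {coord True z1 - e<..<coord True z1 + e}"
    using AE_line_misses_fibre[OF kc, of True]
  proof eventually_elim
    case (elim c)
    show ?case
    proof
      assume c: "c \<in> {coord True z1 - e<..<coord True z1 + e}"
      let ?z = "line_pt True c (coord False z1)"
      have "z1 - ?z = of_real (coord True z1 - c)"
        by (simp add: line_pt_def coord_def complex_eq_iff)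
      then have "dist z1 ?z = \<bar>coord True z1 - c\<bar>" by (simp add: dist_norm del: of_real_diff)
      then have "?z \<in> W" using c e(2) by (intro subsetD[OF e(2)]) auto
      then show False using hk inW elim by blast
    qed
  qed
  then have "emeasure lborel {coord True z1 - e<..<coord True z1 + e} = 0"
    by (subst (asm) AE_iff_measurable[of "{coord True z1 - e<..<coord True z1 + e}"]) auto
  then show False using e(1) by simp
qed

text \<open>The Sobolev regularity of \<open>f\<close> enters through \<open>connected\<close>,
  which takes the place of connectedness of the image of a continuous map. Distinct points differ in
  some coordinate \<open>b\<close>, so excluding \<open>coord b u < coord b v\<close> for both
  coordinates is enough.\<close>

theorem injective:
  assumes X: "X \<subseteq> disk" "\<And>z. z \<in> X \<Longrightarrow> h (f z) = z" "AE z in lborel. z \<in> disk \<longrightarrow> z \<in> X"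
    and f: "\<And>z. z \<in> X \<Longrightarrow> f z \<in> disk"
    and jX: "AE w in lborel. w \<in> disk \<longrightarrow> w \<notin> f ` X \<longrightarrow> jac (A w) (B w) = 0"
    and connected: "\<And>b c \<delta> S. 0 < \<delta> \<Longrightarrow> open S \<Longrightarrow> convex S \<Longrightarrow> S \<subseteq> disk \<Longrightarrow>
        (AE z in lborel. z \<in> S \<longrightarrow> \<delta> < \<bar>coord b (f z) - c\<bar>) \<Longrightarrow>
        (AE z in lborel. z \<in> S \<longrightarrow> coord b (f z) < c) \<or> (AE z in lborel. z \<in> S \<longrightarrow> c < coord b (f z))"
  shows "inj_on h closed_disk"
proof -
  have False if uv: "u \<in> closed_disk" "v \<in> closed_disk" "h u = h v" "coord b u < coord b v" for u v b
  proof -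
    define y where "y = h u"
    have y: "y \<in> closed_disk" using h_closed uv by (simp add: y_def)
    have contc: "continuous_on S (coord b)" for S
      unfolding coord_def[abs_def] by (cases b) (auto intro!: continuous_intros)
    \<comment> \<open>The fibre contains at most one point of the circle. Avoiding its coordinate
      makes the chosen line miss the fibre in the closed disk, which the compactness argument below
      needs.\<close>
    obtain q where q: "\<And>w. w \<in> sphere 0 1 \<Longrightarrow> h w = y \<Longrightarrow> coord b w = q"
      using sphere_inj by (metis inj_onD)
    have ae: "AE c in lborel. c \<noteq> q \<and> (\<forall>s. line_pt b c s \<in> disk \<longrightarrow> h (line_pt b c s) \<noteq> y)"
      using AE_line_misses_fibre[OF y, of b] AE_lborel_singleton[of q] by eventually_elim auto
    have I: "\<not> (AE c in lborel. c \<notin> {coord b u<..<coord b v})"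
    proof
      assume "AE c in lborel. c \<notin> {coord b u<..<coord b v}"
      then have "emeasure lborel {coord b u<..<coord b v} = 0"
        by (subst (asm) AE_iff_measurable[of "{coord b u<..<coord b v}"]) auto
      then show False using uv(4) by simp
    qed
    have "\<exists>c. c \<in> {coord b u<..<coord b v} \<and> c \<noteq> q \<and> (\<forall>s. line_pt b c s \<in> disk \<longrightarrow> h (line_pt b c s) \<noteq> y)"
    proof (rule ccontr)
      assume no: "\<nexists>c. c \<in> {coord b u<..<coord b v} \<and> c \<noteq> q \<and> (\<forall>s. line_pt b c s \<in> disk \<longrightarrow> h (line_pt b c s) \<noteq> y)"
      have "AE c in lborel. c \<notin> {coord b u<..<coord b v}"
        using ae by eventually_elim (use no in blast)
      then show False using I by blast
    qed
    then obtain c where c: "c \<in> {coord b u<..<coord b v}" "c \<noteq> q" "\<And>s. line_pt b c s \<in> disk \<Longrightarrow> h (line_pt b c s) \<noteq> y"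
      by blast
    have miss: "h w \<noteq> y" if "w \<in> closed_disk" "coord b w = c" for w
    proof (cases "w \<in> disk")
      case True
      then show ?thesis using c(3)[of "coord (\<not> b) w"] that(2) by (metis line_pt_coord)
    next
      case False
      then show ?thesis using q[of w] that c(2) by auto
    qed
    \<comment> \<open>The continuous function \<open>m\<close> is positive on the closed disk. With
      minimum \<open>2 * \<eta>\<close>, the inequality \<open>|h w - y| < \<eta>\<close> forces
      \<open>w\<close> to be farther than \<eta> from the line.\<close>
    define m where "m w = cmod (h w - y) + \<bar>coord b w - c\<bar>" for w
    have "continuous_on closed_disk m" unfolding m_def by (intro continuous_intros h_cont contc)
    then obtain w1 where w1: "w1 \<in> closed_disk" "\<And>w. w \<in> closed_disk \<Longrightarrow> m w1 \<le> m w"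
      using continuous_attains_inf[of closed_disk m] by auto
    have m1: "0 < m w1" using miss[OF w1(1)] by (cases "coord b w1 = c") (auto simp: m_def add_nonneg_pos add_pos_nonneg)
    define \<eta> where "\<eta> = m w1 / 2"
    have \<eta>: "0 < \<eta>" using m1 by (simp add: \<eta>_def)
    have sep: "\<eta> < \<bar>coord b w - c\<bar>" if "w \<in> closed_disk" "cmod (h w - y) < \<eta>" for w
      using w1(2)[OF that(1)] that(2) by (simp add: m_def \<eta>_def)
    define S where "S = ball y \<eta> \<inter> disk"
    have S: "open S" "convex S" "S \<subseteq> disk" by (auto simp: S_def intro!: convex_Int)
    have "AE z in lborel. z \<in> S \<longrightarrow> \<eta> < \<bar>coord b (f z) - c\<bar>"
      using X(3)
    proof eventually_elim
      case (elim z)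
      show ?case
      proof
        assume z: "z \<in> S"
        then have "z \<in> X" using elim by (auto simp: S_def)
        then show "\<eta> < \<bar>coord b (f z) - c\<bar>"
          using sep[of "f z"] f[of z] X(2)[of z] z by (auto simp: S_def dist_norm norm_minus_commute)
      qed
    qed
    from connected[OF \<eta> S this] show False
    proof
      assume "AE z in lborel. z \<in> S \<longrightarrow> coord b (f z) < c"
      then have "AE z in lborel. z \<in> X \<longrightarrow> z \<in> ball (h v) \<eta> \<longrightarrow> \<not> c < coord b (f z)"
        by eventually_elim (use X(1) uv(3) in \<open>auto simp: S_def y_def\<close>)
      from side_contradiction[OF X(1,2) jX contc uv(2) _ \<eta> this] c(1) show False by auto
    next
      assume "AE z in lborel. z \<in> S \<longrightarrow> c < coord b (f z)"
      then have "AE z in lborel. z \<in> X \<longrightarrow> z \<in> ball (h u) \<eta> \<longrightarrow> \<not> - c < - coord b (f z)"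
        by eventually_elim (use X(1) in \<open>auto simp: S_def y_def\<close>)
      moreover have "continuous_on UNIV (\<lambda>z. - coord b z)" by (intro continuous_intros contc)
      ultimately show False using side_contradiction[OF X(1,2) jX _ uv(1) _ \<eta>, of "\<lambda>z. - coord b z" "- c"] c(1) by auto
    qed
  qed
  then have "coord b u = coord b v" if "u \<in> closed_disk" "v \<in> closed_disk" "h u = h v" for u v b
    using that by (metis linorder_neqE_linordered_idom)
  then show ?thesis
    unfolding inj_on_def by (metis line_pt_coord)
qed

end

subsection \<open>Sobolev functions avoiding a strip\<close>

text \<open>The step is an antiderivative of a parabola cut off at 0. Such a C^1 function is smooth
  enough for the first-order chain rule it is made for.\<close>

lemma smooth_step:
  fixes c \<delta> :: real
  assumes \<delta>: "0 < \<delta>"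
  obtains \<beta> \<beta>' :: "real \<Rightarrow> real" and b0 b1 M where
    "\<And>t. (\<beta> has_real_derivative \<beta>' t) (at t)" "continuous_on UNIV \<beta>'"
    "\<And>t. \<bar>\<beta>' t\<bar> \<le> M" "\<And>t. \<bar>\<beta> t\<bar> \<le> M" "b0 < b1"
    "\<And>t. t \<le> c - \<delta> \<Longrightarrow> \<beta> t = b0 \<and> \<beta>' t = 0" "\<And>t. c + \<delta> \<le> t \<Longrightarrow> \<beta> t = b1 \<and> \<beta>' t = 0"
proof -
  define \<beta>' where "\<beta>' t = max 0 (\<delta>\<^sup>2 - (t - c)\<^sup>2)" for t
  have cont: "continuous_on UNIV \<beta>'" unfolding \<beta>'_def by (intro continuous_intros)
  then have "isCont \<beta>' t" for t using continuous_on_eq_continuous_at open_UNIV by blast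
  then obtain \<beta> where "\<And>t. (\<beta> has_vector_derivative \<beta>' t) (at t)"
    using einterval_antiderivative[of "-\<infinity>" "\<infinity>" \<beta>'] by auto
  then have d: "(\<beta> has_real_derivative \<beta>' t) (at t)" for t
    by (simp add: has_real_derivative_iff_has_vector_derivative)
  have le: "\<delta>\<^sup>2 \<le> (t - c)\<^sup>2" if "\<delta> \<le> \<bar>t - c\<bar>" for t using that \<delta> by (simp add: abs_le_square_iff[symmetric])
  have zero: "\<beta>' t = 0" if "\<delta> \<le> \<bar>t - c\<bar>" for t using le[OF that] by (simp add: \<beta>'_def)
  have pos: "0 < \<beta>' t" if "\<bar>t - c\<bar> < \<delta>" for t
  proof -
    have "\<bar>t - c\<bar>\<^sup>2 < \<delta>\<^sup>2" using that by (intro power_strict_mono) auto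
    then show ?thesis by (simp add: \<beta>'_def)
  qed
  have nn: "0 \<le> \<beta>' t" "\<beta>' t \<le> \<delta>\<^sup>2" for t using zero_le_power2[of "t - c"] zero_le_power2[of \<delta>] unfolding \<beta>'_def by linarith+
  have mono: "\<beta> s \<le> \<beta> t" if "s \<le> t" for s t
    by (rule DERIV_nonneg_imp_nondecreasing[OF that]) (use d nn in blast)
  have lo: "\<beta> t = \<beta> (c - \<delta>)" if "t \<le> c - \<delta>" for t
  proof (cases "t = c - \<delta>")
    case False
    then have "t < c - \<delta>" using that by simp
    from MVT2[OF this d] obtain z where "t < z" "z < c - \<delta>" "\<beta> (c - \<delta>) - \<beta> t = (c - \<delta> - t) * \<beta>' z"
      by blast
    then show ?thesis using zero[of z] by simp
  qed simp
  have hi: "\<beta> t = \<beta> (c + \<delta>)" if "c + \<delta> \<le> t" for t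
  proof (cases "t = c + \<delta>")
    case False
    then have "c + \<delta> < t" using that by simp
    from MVT2[OF this d] obtain z where "c + \<delta> < z" "z < t" "\<beta> t - \<beta> (c + \<delta>) = (t - (c + \<delta>)) * \<beta>' z"
      by blast
    then show ?thesis using zero[of z] by simp
  qed simp
  obtain z where z: "c - \<delta> < z" "z < c + \<delta>" "\<beta> (c + \<delta>) - \<beta> (c - \<delta>) = (c + \<delta> - (c - \<delta>)) * \<beta>' z"
    using MVT2[of "c - \<delta>" "c + \<delta>" \<beta> \<beta>'] \<delta> d by auto
  have lt: "\<beta> (c - \<delta>) < \<beta> (c + \<delta>)"
  proof -
    have "0 < (c + \<delta> - (c - \<delta>)) * \<beta>' z" using \<delta> pos[of z] z by (intro mult_pos_pos) auto
    then show ?thesis using z(3) by linarith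
  qed
  have bd: "\<beta> (c - \<delta>) \<le> \<beta> t" "\<beta> t \<le> \<beta> (c + \<delta>)" for t
    using mono[of "c - \<delta>" t] mono[of t "c + \<delta>"] lo[of t] hi[of t] lt by linarith+
  show ?thesis
  proof (rule that[OF d cont _ _ lt])
    fix t
    show "\<bar>\<beta>' t\<bar> \<le> \<delta>\<^sup>2 + \<bar>\<beta> (c - \<delta>)\<bar> + \<bar>\<beta> (c + \<delta>)\<bar>" using nn[of t] by linarith
    show "\<bar>\<beta> t\<bar> \<le> \<delta>\<^sup>2 + \<bar>\<beta> (c - \<delta>)\<bar> + \<bar>\<beta> (c + \<delta>)\<bar>" using bd[of t] zero_le_power2[of \<delta>] by linarith
    show "\<beta> t = \<beta> (c - \<delta>) \<and> \<beta>' t = 0" if t: "t \<le> c - \<delta>"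
    proof -
      have "\<delta> \<le> \<bar>t - c\<bar>" using t \<delta> by linarith
      then show ?thesis using lo[OF t] zero[of t] by blast
    qed
    show "\<beta> t = \<beta> (c + \<delta>) \<and> \<beta>' t = 0" if t: "c + \<delta> \<le> t"
    proof -
      have "\<delta> \<le> \<bar>t - c\<bar>" using t \<delta> by linarith
      then show ?thesis using hi[OF t] zero[of t] by blast
    qed
  qed
qed

lemma abs_coord_le: "\<bar>coord b z\<bar> \<le> cmod z"
  by (cases b) (auto simp: coord_def abs_Re_le_cmod abs_Im_le_cmod)

lemma continuous_on_coord: "continuous_on S (coord b)"
  unfolding coord_def[abs_def] by (cases b) (auto intro!: continuous_intros)

lemma borel_measurable_coord [measurable]: "coord b \<in> borel_measurable borel"
  by (rule borel_measurable_continuous_onI[OF continuous_on_coord])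

lemma has_derivative_coord:
  "(f has_derivative (\<lambda>v. Re v *\<^sub>R fx + Im v *\<^sub>R fy)) F \<Longrightarrow>
   ((\<lambda>z. coord b (f z)) has_derivative (\<lambda>v. Re v * coord b fx + Im v * coord b fy)) F"
  by (cases b) (auto dest: has_derivative_Re has_derivative_Im simp: coord_def)

lemma cball_subset_disk_norm:
  assumes "cball x d \<subseteq> disk" "0 < d" shows "cmod x + d < 1"
proof -
  define u where "u = (if x = 0 then 1 else sgn x)"
  have u: "cmod u = 1" by (simp add: u_def norm_sgn)
  have "x = cmod x *\<^sub>R u" by (simp add: u_def sgn_div_norm)
  then have "x + d *\<^sub>R u = (cmod x + d) *\<^sub>R u" by (metis scaleR_add_left)
  then have "cmod (x + d *\<^sub>R u) = cmod x + d" using u assms(2) by simp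
  moreover have "x + d *\<^sub>R u \<in> cball x d" using u assms(2) by (simp add: dist_norm)
  ultimately show ?thesis using assms(1) by auto
qed

text \<open>Chain rule for \<open>\<beta> (coord b F)\<close>, in the only case needed: \<open>\<beta>'\<close> vanishes a.e. along \<open>F\<close>.\<close>

lemma conv_deriv_step_eq_0:
  fixes F G1 G2 :: "complex \<Rightarrow> complex" and \<beta> \<beta>' :: "real \<Rightarrow> real"
  assumes F: "integrable lborel F"
    and G [measurable]: "G1 \<in> borel_measurable borel" "G2 \<in> borel_measurable borel"
    and iG: "\<And>R. R < 1 \<Longrightarrow> integrable lborel (\<lambda>z. indicator (cball 0 R) z *\<^sub>R G1 z)"
      "\<And>R. R < 1 \<Longrightarrow> integrable lborel (\<lambda>z. indicator (cball 0 R) z *\<^sub>R G2 z)"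
    and cx: "\<And>x d. 0 < d \<Longrightarrow> cball x d \<subseteq> disk \<Longrightarrow> conv (mollifier_x d) F x = conv (mollifier d) G1 x"
    and cy: "\<And>x d. 0 < d \<Longrightarrow> cball x d \<subseteq> disk \<Longrightarrow> conv (mollifier_y d) F x = conv (mollifier d) G2 x"
    and \<beta>: "\<And>t. (\<beta> has_real_derivative \<beta>' t) (at t)" "continuous_on UNIV \<beta>'"
    and M: "\<And>t. \<bar>\<beta>' t\<bar> \<le> M" "\<And>t. \<bar>\<beta> t\<bar> \<le> M"
    and d: "0 < d" "cball x d \<subseteq> disk"
    and flat: "AE z in lborel. z \<in> cball x d \<longrightarrow> \<beta>' (coord b (F z)) = 0"
  shows "conv (mollifier_x d) (\<lambda>z. indicator disk z * \<beta> (coord b (F z))) x = 0 \<and>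
    conv (mollifier_y d) (\<lambda>z. indicator disk z * \<beta> (coord b (F z))) x = 0"
proof -
  define R where "R = cmod x + d"
  have R: "R < 1" "0 < R" using cball_subset_disk_norm[OF d(2,1)] d(1) by (auto simp: R_def add_nonneg_pos)
  have inR: "z \<in> cball 0 R" if "cmod (x - z) \<le> d" for z
    using that norm_triangle_ineq2[of z x] by (simp add: R_def norm_minus_commute)
  define R' where "R' = (R + 1) / 2"
  have R': "R < R'" "R' < 1" using R by (auto simp: R'_def)
  define t where "t n = (R' - R) * inverse (real (Suc n))" for n
  have t0: "0 < t n" for n using R' by (simp add: t_def)
  have tlim: "t \<longlonglongrightarrow> 0"
    unfolding t_def using tendsto_mult[OF tendsto_const[of "R' - R"] LIMSEQ_inverse_real_of_nat] by simp
  have tle: "t n \<le> R' - R" for n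
    using R' unfolding t_def by (intro mult_left_le) (auto simp: inverse_le_1_iff)
  define A' where "A' z = indicator (cball 0 R') z *\<^sub>R G1 z" for z
  define B' where "B' z = indicator (cball 0 R') z *\<^sub>R G2 z" for z
  have iA: "integrable lborel A'" unfolding A'_def[abs_def] by (rule iG(1)[OF R'(2)])
  have iB: "integrable lborel B'" unfolding B'_def[abs_def] by (rule iG(2)[OF R'(2)])
  note [measurable] = borel_measurable_integrable[OF iA] borel_measurable_integrable[OF iB] borel_measurable_integrable[OF F]
    borel_measurable_moll[OF t0 iA] borel_measurable_moll[OF t0 iB] borel_measurable_moll[OF t0 F]
  have contb: "continuous_on UNIV \<beta>"
    using \<beta>(1) by (meson DERIV_isCont continuous_at_imp_continuous_on)
  have [measurable]: "\<beta> \<in> borel_measurable borel" "\<beta>' \<in> borel_measurable borel"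
    using contb \<beta>(2) by (auto intro: borel_measurable_continuous_onI)
  define e where "e n z = norm (moll (t n) F z - F z) + (norm (moll (t n) A' z - A' z) + norm (moll (t n) B' z - B' z))" for n z
  have [measurable]: "e n \<in> borel_measurable lborel" for n unfolding e_def[abs_def] by measurable
  have e_nonneg: "0 \<le> e n z" for n z by (simp add: e_def)
  have e_lim: "(\<lambda>n. \<integral>\<^sup>+z. e n z \<partial>lborel) \<longlonglongrightarrow> 0"
  proof -
    have "(\<integral>\<^sup>+z. e n z \<partial>lborel) = (\<integral>\<^sup>+z. norm (moll (t n) F z - F z) \<partial>lborel) +
      ((\<integral>\<^sup>+z. norm (moll (t n) A' z - A' z) \<partial>lborel) + (\<integral>\<^sup>+z. norm (moll (t n) B' z - B' z) \<partial>lborel))" for n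
      unfolding e_def by (simp add: nn_integral_add)
    then show ?thesis
      using moll_L1_integrable[OF t0 tlim iA] moll_L1_integrable[OF t0 tlim iB] moll_L1_integrable[OF t0 tlim F]
      unfolding moll_L1_def by (simp only:) (intro tendsto_add_zero_ennreal)
  qed
  obtain r G0 where r: "strict_mono r" and G0: "integrable lborel G0"
    and G0b: "AE z in lborel. \<forall>n. e (r n) z \<le> G0 z" and elim0: "AE z in lborel. (\<lambda>n. e (r n) z) \<longlonglongrightarrow> 0"
    by (rule L1_subseq_dominated[where e = e, OF _ e_nonneg e_lim]) auto
  define Fn where "Fn n = moll (t (r n)) F" for n
  define Px where "Px n = conv (mollifier_x (t (r n))) F" for n
  define Py where "Py n = conv (mollifier_y (t (r n))) F" for n
  have near: "Px n z = moll (t (r n)) A' z" "Py n z = moll (t (r n)) B' z" if "z \<in> cball 0 R" for n z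
  proof -
    have sub: "w \<in> cball 0 R'" if "w \<in> cball z (t (r n))" for w
    proof -
      have "cmod w \<le> cmod z + dist z w" using norm_triangle_ineq2[of w z] by (simp add: dist_norm norm_minus_commute)
      then show ?thesis using that \<open>z \<in> cball 0 R\<close> tle[of "r n"] by simp
    qed
    then have cb: "cball z (t (r n)) \<subseteq> disk" using R' by fastforce
    have "conv (mollifier (t (r n))) G1 z = conv (mollifier (t (r n))) A' z" "conv (mollifier (t (r n))) G2 z = conv (mollifier (t (r n))) B' z"
      by (rule conv_cong_near[where d = "t (r n)"]; use sub mollifier_eq_0[OF t0] in \<open>simp add: A'_def B'_def dist_norm\<close>)+
    then show "Px n z = moll (t (r n)) A' z" "Py n z = moll (t (r n)) B' z"
      using cx[OF t0 cb] cy[OF t0 cb] by (simp_all add: moll_eq_conv Px_def Py_def)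
  qed
  have dFn: "(Fn n has_derivative (\<lambda>v. Re v *\<^sub>R Px n z + Im v *\<^sub>R Py n z)) (at z)" for n z
    unfolding Fn_def Px_def Py_def by (rule has_derivative_moll(1)[OF t0 F])
  have contP: "continuous_on UNIV (Px n)" "continuous_on UNIV (Py n)" "continuous_on UNIV (Fn n)" for n
    unfolding Px_def Py_def Fn_def by (rule continuous_on_conv_mollifier_derivs[OF t0 F] continuous_on_moll[OF t0 F])+
  have [measurable]: "Px n \<in> borel_measurable borel" "Py n \<in> borel_measurable borel" "Fn n \<in> borel_measurable borel" for n
    using contP by (auto intro: borel_measurable_continuous_onI)
  \<comment> \<open>\<open>px\<close> and \<open>py\<close> are the partial derivatives of the test
    function times the step of the smooth approximant. The product has compact support, so both
    integrals vanish; in the limit only the term without \<open>\<beta>'\<close> remains.\<close>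
  define px where "px n z = - mollifier_x d (x - z) * \<beta> (coord b (Fn n z)) + mollifier d (x - z) * (\<beta>' (coord b (Fn n z)) * coord b (Px n z))" for n z
  define py where "py n z = - mollifier_y d (x - z) * \<beta> (coord b (Fn n z)) + mollifier d (x - z) * (\<beta>' (coord b (Fn n z)) * coord b (Py n z))" for n z
  have far: "d \<le> cmod (x - z)" if "R \<le> cmod z" for z
    using that norm_triangle_ineq2[of z x] by (simp add: R_def norm_minus_commute)
  have D: "((\<lambda>z. mollifier d (x - z) * \<beta> (coord b (Fn n z))) has_derivative (\<lambda>v. Re v * px n z + Im v * py n z)) (at z)" for n z
  proof -
    have "((\<lambda>z. x - z) has_derivative (\<lambda>v. - v)) (at z)" by (auto intro!: derivative_eq_intros)
    note d1 = has_derivative_compose[OF this has_derivative_mollifier[of d]]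
    have "(\<beta> has_derivative (*) (\<beta>' (coord b (Fn n z)))) (at (coord b (Fn n z)))"
      using \<beta>(1) by (simp add: has_field_derivative_def)
    note d2 = has_derivative_compose[OF has_derivative_coord[OF dFn] this]
    show ?thesis
      by (rule has_derivative_eq_rhs[OF has_derivative_mult[OF d1 d2]])
         (simp add: px_def py_def fun_eq_iff algebra_simps)
  qed
  have contk: "continuous_on UNIV (\<lambda>z. mollifier d (x - z))" "continuous_on UNIV (\<lambda>z. mollifier_x d (x - z))" "continuous_on UNIV (\<lambda>z. mollifier_y d (x - z))"
    unfolding mollifier_x_def mollifier_y_def by (intro continuous_intros)+
  have contc: "continuous_on UNIV (\<lambda>z. \<beta> (coord b (Fn n z)))" "continuous_on UNIV (\<lambda>z. \<beta>' (coord b (Fn n z)))"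
    "continuous_on UNIV (\<lambda>z. coord b (Px n z))" "continuous_on UNIV (\<lambda>z. coord b (Py n z))" for n
  proof -
    have c: "continuous_on UNIV (\<lambda>z. coord b (Fn n z))" "continuous_on UNIV (\<lambda>z. coord b (Px n z))" "continuous_on UNIV (\<lambda>z. coord b (Py n z))"
      by (rule continuous_on_compose2[OF continuous_on_coord[of UNIV] contP(3) subset_UNIV]
        continuous_on_compose2[OF continuous_on_coord[of UNIV] contP(1) subset_UNIV]
        continuous_on_compose2[OF continuous_on_coord[of UNIV] contP(2) subset_UNIV])+
    show "continuous_on UNIV (\<lambda>z. \<beta> (coord b (Fn n z)))" by (rule continuous_on_compose2[OF contb c(1) subset_UNIV])
    show "continuous_on UNIV (\<lambda>z. \<beta>' (coord b (Fn n z)))" by (rule continuous_on_compose2[OF \<beta>(2) c(1) subset_UNIV])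
    show "continuous_on UNIV (\<lambda>z. coord b (Px n z))" "continuous_on UNIV (\<lambda>z. coord b (Py n z))" by (rule c)+
  qed
  have contp: "continuous_on UNIV (px n)" "continuous_on UNIV (py n)" for n
    unfolding px_def[abs_def] py_def[abs_def] by (intro continuous_intros contk contc)+
  have I0: "(LBINT z. px n z) = 0" "(LBINT z. py n z) = 0" for n
    by (rule integral_partial_derivs_eq_0_real[OF D contp, where s = R]; use far mollifier_eq_0[OF d(1)] in simp)+
  \<comment> \<open>One limit argument for both directions: \<open>k\<close> is the differentiated
    mollifier, \<open>P n\<close> the derivative of the approximant in that direction and
    \<open>Q\<close> its limit.\<close>
  have key: "(LBINT z. - k (x - z) * (indicator disk z * \<beta> (coord b (F z)))) = 0"
    if k: "continuous_on UNIV (\<lambda>z. k (x - z))" "\<And>z. d \<le> cmod z \<Longrightarrow> k z = 0" and kL: "\<And>z. \<bar>k z\<bar> \<le> L1"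
      and p: "\<And>n z. p n z = - k (x - z) * \<beta> (coord b (Fn n z)) + mollifier d (x - z) * (\<beta>' (coord b (Fn n z)) * coord b (P n z))"
      and p0: "\<And>n. (LBINT z. p n z) = 0" and contp: "\<And>n. continuous_on UNIV (p n)"
      and Q: "integrable lborel Q" and P: "\<And>n z. z \<in> cball 0 R \<Longrightarrow> cmod (P n z - Q z) \<le> e (r n) z"
    for k L1 p and P :: "nat \<Rightarrow> complex \<Rightarrow> complex" and Q :: "complex \<Rightarrow> complex"
  proof -
    have [measurable]: "p n \<in> borel_measurable borel" "(\<lambda>z. k (x - z)) \<in> borel_measurable borel" for n
      using contp k(1) by (auto intro: borel_measurable_continuous_onI)
    obtain L2 where L2: "\<And>z. \<bar>mollifier d z\<bar> \<le> L2" using mollifier_bounded[OF d(1)] by blast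
    have nn: "0 \<le> L1" "0 \<le> L2" "0 \<le> M" using kL[of 0] L2[of 0] M(1)[of 0] by linarith+
    let ?w = "\<lambda>z. indicator (cball x d) z * (L1 * M) + L2 * (M * (cmod (Q z) + G0 z))"
    have w: "integrable lborel ?w"
    proof -
      have "integrable lborel (indicator (cball x d) :: complex \<Rightarrow> real)"
        by (intro integrable_real_indicator emeasure_lborel_cball_finite) auto
      then show ?thesis using Q G0 by (intro Bochner_Integration.integrable_add integrable_mult_left integrable_mult_right integrable_norm)
    qed
    have l: "AE z in lborel. (\<lambda>n. p n z) \<longlonglongrightarrow> - k (x - z) * (indicator disk z * \<beta> (coord b (F z)))"
      using elim0 flat
    proof eventually_elim
      case (elim z)
      show ?case
      proof (cases "cmod (x - z) < d")
        case True
        then have zd: "z \<in> cball x d" "z \<in> cball 0 R" "z \<in> disk" using inR[of z] R(1) by (auto simp: dist_norm)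
        have "(\<lambda>n. norm (Fn n z - F z)) \<longlonglongrightarrow> 0"
          by (rule tendsto_sandwich[OF _ _ tendsto_const elim(1)]) (simp_all add: e_def Fn_def)
        then have lF: "(\<lambda>n. Fn n z) \<longlonglongrightarrow> F z" by (simp add: tendsto_norm_zero_iff LIM_zero_iff)
        have "(\<lambda>n. norm (P n z - Q z)) \<longlonglongrightarrow> 0"
          by (rule tendsto_sandwich[OF _ _ tendsto_const elim(1)]) (use P zd in simp_all)
        then have lP: "(\<lambda>n. P n z) \<longlonglongrightarrow> Q z" by (simp add: tendsto_norm_zero_iff LIM_zero_iff)
        have lc: "(\<lambda>n. coord b (Fn n z)) \<longlonglongrightarrow> coord b (F z)" "(\<lambda>n. coord b (P n z)) \<longlonglongrightarrow> coord b (Q z)"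
          using continuous_on_tendsto_compose[OF continuous_on_coord[of UNIV] lF] continuous_on_tendsto_compose[OF continuous_on_coord[of UNIV] lP] by auto
        have lb: "(\<lambda>n. \<beta> (coord b (Fn n z))) \<longlonglongrightarrow> \<beta> (coord b (F z))" "(\<lambda>n. \<beta>' (coord b (Fn n z))) \<longlonglongrightarrow> \<beta>' (coord b (F z))"
          using continuous_on_tendsto_compose[OF contb lc(1)] continuous_on_tendsto_compose[OF \<beta>(2) lc(1)] by auto
        have "(\<lambda>n. p n z) \<longlonglongrightarrow> - k (x - z) * \<beta> (coord b (F z)) + mollifier d (x - z) * (\<beta>' (coord b (F z)) * coord b (Q z))"
          unfolding p by (intro tendsto_add tendsto_mult tendsto_const lb lc)
        then show ?thesis using elim(2) zd by simp
      next
        case False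
        then show ?thesis using k(2)[of "x - z"] mollifier_eq_0[OF d(1), of "x - z"] by (simp add: p)
      qed
    qed
    have bd: "AE z in lborel. norm (p n z) \<le> ?w z" for n
      using G0b
    proof eventually_elim
      case (elim z)
      have g0: "0 \<le> G0 z" using elim e_nonneg[of "r n" z] by (meson order_trans)
      show ?case
      proof (cases "cmod (x - z) < d")
        case True
        then have zd: "z \<in> cball x d" "z \<in> cball 0 R" using inR[of z] by (auto simp: dist_norm)
        have "cmod (P n z) \<le> cmod (Q z) + cmod (P n z - Q z)" using norm_triangle_ineq[of "Q z" "P n z - Q z"] by simp
        also have "\<dots> \<le> cmod (Q z) + G0 z" using P[OF zd(2), of n] elim[rule_format, of n] by simp
        finally have cP: "\<bar>coord b (P n z)\<bar> \<le> cmod (Q z) + G0 z" using abs_coord_le[of b "P n z"] by simp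
        have "\<bar>k (x - z)\<bar> * \<bar>\<beta> (coord b (Fn n z))\<bar> \<le> L1 * M" by (intro mult_mono kL M) (use nn in auto)
        moreover have "\<bar>mollifier d (x - z)\<bar> * (\<bar>\<beta>' (coord b (Fn n z))\<bar> * \<bar>coord b (P n z)\<bar>) \<le> L2 * (M * (cmod (Q z) + G0 z))"
          by (intro mult_mono L2 M cP) (use nn g0 in auto)
        moreover have "norm (p n z) \<le> \<bar>k (x - z)\<bar> * \<bar>\<beta> (coord b (Fn n z))\<bar> + \<bar>mollifier d (x - z)\<bar> * (\<bar>\<beta>' (coord b (Fn n z))\<bar> * \<bar>coord b (P n z)\<bar>)"
          unfolding p real_norm_def by (rule order_trans[OF abs_triangle_ineq]) (simp add: abs_mult)
        ultimately show ?thesis using zd by simp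
      next
        case False
        then have "p n z = 0" using k(2)[of "x - z"] mollifier_eq_0[OF d(1), of "x - z"] by (simp add: p)
        moreover have "0 \<le> ?w z" using nn g0 by (intro add_nonneg_nonneg mult_nonneg_nonneg) auto
        ultimately show ?thesis by simp
      qed
    qed
    have "(\<lambda>n. LBINT z. p n z) \<longlonglongrightarrow> (LBINT z. - k (x - z) * (indicator disk z * \<beta> (coord b (F z))))"
    proof (rule integral_dominated_convergence[OF _ _ w l bd])
      have [measurable]: "disk \<in> sets borel" by simp
      show "(\<lambda>z. - k (x - z) * (indicator disk z * \<beta> (coord b (F z)))) \<in> borel_measurable lborel" by measurable
    qed auto
    then show ?thesis unfolding p0 using LIMSEQ_unique tendsto_const by blast
  qed
  obtain L1 where L1: "\<And>z. \<bar>mollifier_x d z\<bar> \<le> L1" using continuous_compact_support_bounded[OF continuous_on_mollifier_derivs(1) mollifier_derivs_eq_0(1)[OF d(1)]] by blast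
  obtain L2 where L2: "\<And>z. \<bar>mollifier_y d z\<bar> \<le> L2" using continuous_compact_support_bounded[OF continuous_on_mollifier_derivs(2) mollifier_derivs_eq_0(2)[OF d(1)]] by blast
  have "(LBINT z. - mollifier_x d (x - z) * (indicator disk z * \<beta> (coord b (F z)))) = 0"
    by (rule key[OF contk(2) mollifier_derivs_eq_0(1)[OF d(1)] L1 px_def I0(1) contp(1) iA]) (simp_all add: near e_def)
  moreover have "(LBINT z. - mollifier_y d (x - z) * (indicator disk z * \<beta> (coord b (F z)))) = 0"
    by (rule key[OF contk(3) mollifier_derivs_eq_0(2)[OF d(1)] L2 py_def I0(2) contp(2) iB]) (simp_all add: near e_def)
  ultimately show ?thesis by (simp add: conv_def)
qed

text \<open>The step is flat at almost every value of the coordinate on \<open>S\<close>, so its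
  composition with the coordinate has zero weak gradient there. Hence it is constant, and the two
  plateau values \<open>b0 < b1\<close> tell the sides apart.\<close>

theorem sobolev_values_connected:
  fixes f g1 g2 :: "complex \<Rightarrow> complex"
  assumes w: "has_weak_deriv disk 1 f g1" "has_weak_deriv disk \<i> f g2"
    and f: "\<And>z. z \<in> disk \<Longrightarrow> f z \<in> disk"
    and \<delta>: "0 < \<delta>" and S: "open S" "convex S" "S \<subseteq> disk"
    and gap: "AE z in lborel. z \<in> S \<longrightarrow> \<delta> < \<bar>coord b (f z) - c\<bar>"
  shows "(AE z in lborel. z \<in> S \<longrightarrow> coord b (f z) < c) \<or> (AE z in lborel. z \<in> S \<longrightarrow> c < coord b (f z))"
proof -
  have loc: "Lq_loc 1 disk f" "Lq_loc 1 disk g1" "Lq_loc 1 disk g2"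
    using w by (auto simp: has_weak_deriv_def)
  obtain F where F [measurable]: "F \<in> borel_measurable borel" and F0: "\<And>z. z \<notin> disk \<Longrightarrow> F z = 0" and Fae: "AE z in lborel. z \<in> disk \<longrightarrow> f z = F z"
    using Lq_loc_borel_representative[OF loc(1)] by blast
  obtain G1 where G1 [measurable]: "G1 \<in> borel_measurable borel" and G1ae: "AE z in lborel. z \<in> disk \<longrightarrow> g1 z = G1 z"
    using Lq_loc_borel_representative[OF loc(2)] by blast
  obtain G2 where G2 [measurable]: "G2 \<in> borel_measurable borel" and G2ae: "AE z in lborel. z \<in> disk \<longrightarrow> g2 z = G2 z"
    using Lq_loc_borel_representative[OF loc(3)] by blast
  have [measurable]: "disk \<in> sets borel" by simp
  have disk_int: "integrable lborel (indicator disk :: complex \<Rightarrow> real)"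
    by (intro integrable_real_indicator emeasure_lborel_ball_finite) auto
  have iF: "integrable lborel F"
  proof (rule Bochner_Integration.integrable_bound[OF disk_int])
    show "AE z in lborel. norm (F z) \<le> norm (indicator disk z :: real)"
      using Fae
    proof eventually_elim
      case (elim z)
      then show ?case using f[of z] F0[of z] by (cases "z \<in> disk") auto
    qed
  qed simp
  have iG: "integrable lborel (\<lambda>z. indicator (cball 0 R) z *\<^sub>R G z)"
    if "Lq_loc 1 disk g" and [measurable]: "G \<in> borel_measurable borel" and "AE z in lborel. z \<in> disk \<longrightarrow> g z = G z" "R < 1" for R and g G :: "complex \<Rightarrow> complex"
  proof -
    have [measurable]: "cball (0::complex) R \<in> sets borel" by simp
    show ?thesis
      by (rule Bochner_Integration.integrable_bound[OF Lq_loc_integrable[OF that]]) (auto simp: indicator_def)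
  qed
  obtain \<beta> \<beta>' :: "real \<Rightarrow> real" and b0 b1 M where \<beta>:
    "\<And>t. (\<beta> has_real_derivative \<beta>' t) (at t)" "continuous_on UNIV \<beta>'"
    "\<And>t. \<bar>\<beta>' t\<bar> \<le> M" "\<And>t. \<bar>\<beta> t\<bar> \<le> M" "b0 < b1"
    "\<And>t. t \<le> c - \<delta> \<Longrightarrow> \<beta> t = b0 \<and> \<beta>' t = 0" "\<And>t. c + \<delta> \<le> t \<Longrightarrow> \<beta> t = b1 \<and> \<beta>' t = 0"
    by (rule smooth_step[OF \<delta>, where c = c]) (rule that; assumption)
  define V where "V z = indicator disk z * \<beta> (coord b (F z))" for z
  have "continuous_on UNIV \<beta>" using \<beta>(1) by (meson DERIV_isCont continuous_at_imp_continuous_on)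
  then have [measurable]: "\<beta> \<in> borel_measurable borel" by (rule borel_measurable_continuous_onI)
  have iV: "integrable lborel V"
  proof (rule Bochner_Integration.integrable_bound[OF integrable_mult_right[OF disk_int, of M]])
    show "V \<in> borel_measurable lborel" unfolding V_def[abs_def] by measurable
    show "AE z in lborel. norm (V z) \<le> norm (M * indicator disk z)"
      using \<beta>(4) by (intro AE_I2) (auto simp: V_def indicator_def intro: order_trans[OF _ abs_ge_self])
  qed
  have gap': "AE z in lborel. z \<in> S \<longrightarrow> \<delta> < \<bar>coord b (F z) - c\<bar>"
    using gap Fae by eventually_elim (use S(3) in auto)
  have "\<exists>k. AE z in lborel. z \<in> S \<longrightarrow> V z = k"
  proof (rule AE_const_of_conv_deriv_eq_0[OF iV S(1,2)])
    fix x :: complex and d :: real assume d: "0 < d" "cball x d \<subseteq> S"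
    have "AE z in lborel. z \<in> cball x d \<longrightarrow> \<beta>' (coord b (F z)) = 0"
      using gap'
    proof eventually_elim
      case (elim z)
      show ?case
      proof
        assume "z \<in> cball x d"
        then have "\<delta> < \<bar>coord b (F z) - c\<bar>" using elim d(2) by blast
        then show "\<beta>' (coord b (F z)) = 0" using \<beta>(6)[of "coord b (F z)"] \<beta>(7)[of "coord b (F z)"] by linarith
      qed
    qed
    then show "conv (mollifier_x d) V x = 0 \<and> conv (mollifier_y d) V x = 0"
      unfolding V_def[abs_def]
      using d S(3) iG[OF loc(2) G1 G1ae] iG[OF loc(3) G2 G2ae]
        weak_deriv_conv(1)[OF w(1) F G1 Fae G1ae] weak_deriv_conv(2)[OF w(2) F G2 Fae G2ae]
      by (intro conv_deriv_step_eq_0[OF iF G1 G2 _ _ _ _ \<beta>(1-4)]) auto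
  qed
  then obtain k where k: "AE z in lborel. z \<in> S \<longrightarrow> V z = k" ..
  \<comment> \<open>The same constant \<open>k\<close> is compared with the plateau values at every
    point, which makes the choice of side uniform over \<open>S\<close>.\<close>
  have alt: "AE z in lborel. z \<in> S \<longrightarrow> (c < coord b (f z) \<and> k = b1) \<or> (coord b (f z) < c \<and> k = b0)"
    using k gap' Fae
  proof eventually_elim
    case (elim z)
    show ?case
    proof
      assume z: "z \<in> S"
      then have zd: "z \<in> disk" using S(3) by auto
      have "\<delta> < \<bar>coord b (F z) - c\<bar>" "V z = k" "f z = F z" using elim z zd by auto
      then show "(c < coord b (f z) \<and> k = b1) \<or> (coord b (f z) < c \<and> k = b0)"
        using \<beta>(6)[of "coord b (F z)"] \<beta>(7)[of "coord b (F z)"] zd \<delta>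
        by (cases "c < coord b (F z)") (auto simp: V_def)
    qed
  qed
  show ?thesis
  proof (cases "k = b1")
    case True
    then have "AE z in lborel. z \<in> S \<longrightarrow> c < coord b (f z)" using alt \<beta>(5) by (auto elim!: eventually_mono)
    then show ?thesis ..
  next
    case False
    then have "AE z in lborel. z \<in> S \<longrightarrow> coord b (f z) < c" using alt by (auto elim!: eventually_mono)
    then show ?thesis ..
  qed
qed

subsection \<open>The class of admissible maps\<close>

lemma weakly_differentiableD:
  assumes "weakly_differentiable U f"
  shows "has_weak_deriv U 1 f (weak_deriv U 1 f)" "has_weak_deriv U \<i> f (weak_deriv U \<i> f)"
  using assms someI_ex[of "has_weak_deriv U 1 f"] someI_ex[of "has_weak_deriv U \<i> f"]
  by (simp_all add: weakly_differentiable_def weak_deriv_def)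

lemma Jac_eq_jac: "Jac f z = jac (weak_deriv disk 1 f z) (weak_deriv disk \<i> f z)"
  unfolding Jac_def d_z_def d_zbar_def cmod_power2 jac_def
  by (simp add: power2_eq_square field_simps)

lemma norm_d_z_d_zbar:
  "(cmod (d_z f z))\<^sup>2 + (cmod (d_zbar f z))\<^sup>2 =
    ((cmod (weak_deriv disk 1 f z))\<^sup>2 + (cmod (weak_deriv disk \<i> f z))\<^sup>2) / 2"
  unfolding d_z_def d_zbar_def cmod_power2 by (simp add: power2_eq_square field_simps)

text \<open>The two partial derivatives are the values of the differential at the unit vectors 1 and
  i.\<close>

lemma weak_deriv_le_norm_D:
  "(cmod (weak_deriv disk 1 f z))\<^sup>2 + (cmod (weak_deriv disk \<i> f z))\<^sup>2 \<le> 2 * (norm_D f z)\<^sup>2"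
proof -
  let ?T = "\<lambda>v. d_z f z * v + d_zbar f z * cnj v"
  have bl: "bounded_linear ?T"
    by (intro bounded_linear_add bounded_linear_compose[OF bounded_linear_mult_right bounded_linear_cnj] bounded_linear_mult_right)
  have "cmod (?T 1) \<le> norm_D f z" "cmod (?T \<i>) \<le> norm_D f z"
    unfolding norm_D_def using onorm[OF bl, of 1] onorm[OF bl, of \<i>] by simp_all
  moreover have "?T 1 = weak_deriv disk 1 f z" "?T \<i> = weak_deriv disk \<i> f z"
    by (simp_all add: d_z_def d_zbar_def complex_eq_iff field_simps)
  ultimately have "(cmod (weak_deriv disk 1 f z))\<^sup>2 \<le> (norm_D f z)\<^sup>2" "(cmod (weak_deriv disk \<i> f z))\<^sup>2 \<le> (norm_D f z)\<^sup>2"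
    by (metis norm_ge_zero power_mono)+
  then show ?thesis by simp
qed

lemma AE_lebesgue_on_disk:
  "(AE z in lebesgue_on disk. P z) \<longleftrightarrow> (AE z in lborel. z \<in> disk \<longrightarrow> P z)"
  by (subst AE_restrict_space_iff) (auto simp: AE_completion_iff)

lemma nn_integral_lebesgue_on_disk:
  "(\<integral>\<^sup>+z. f z \<partial>lebesgue_on disk) = (\<integral>\<^sup>+z. indicator disk z * f z \<partial>lborel)"
  by (subst nn_integral_restrict_space) (auto simp: nn_integral_completion mult.commute)

lemma dist_K_ge_1:
  assumes "0 \<le> Jac f z" shows "1 \<le> dist_K f z"
proof (cases "Jac f z = 0")
  case False
  then have "0 < Jac f z" using assms by simp
  moreover have "dist_K f z = ((cmod (d_z f z))\<^sup>2 + (cmod (d_zbar f z))\<^sup>2) / Jac f z"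
    using False by (simp add: dist_K_def Jac_def[symmetric])
  moreover have "Jac f z \<le> (cmod (d_z f z))\<^sup>2 + (cmod (d_zbar f z))\<^sup>2"
    unfolding Jac_def using zero_le_power2[of "cmod (d_zbar f z)"] by linarith
  ultimately show ?thesis by (simp add: le_divide_eq)
qed (simp add: dist_K_def)

lemma dist_K_Jac:
  assumes "Jac f z \<noteq> 0"
  shows "2 * dist_K f z * Jac f z = (cmod (weak_deriv disk 1 f z))\<^sup>2 + (cmod (weak_deriv disk \<i> f z))\<^sup>2"
proof -
  have "dist_K f z * Jac f z = (cmod (d_z f z))\<^sup>2 + (cmod (d_zbar f z))\<^sup>2"
    using assms by (simp add: dist_K_def Jac_def[symmetric])
  then show ?thesis using norm_d_z_d_zbar[of f z] by simp
qed

lemma planar_mapI: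
  assumes cont: "continuous_on closed_disk u" and cl: "u ` closed_disk \<subseteq> closed_disk" and sp: "u ` sphere 0 1 \<subseteq> sphere 0 1"
    and wd: "weakly_differentiable disk u"
    and A: "A \<in> borel_measurable borel" "AE z in lborel. z \<in> disk \<longrightarrow> weak_deriv disk 1 u z = A z"
    and B: "B \<in> borel_measurable borel" "AE z in lborel. z \<in> disk \<longrightarrow> weak_deriv disk \<i> u z = B z"
    and A2: "\<And>R. R < 1 \<Longrightarrow> integrable lborel (\<lambda>z. indicator (cball 0 R) z *\<^sub>R (cmod (A z))\<^sup>2)"
    and B2: "\<And>R. R < 1 \<Longrightarrow> integrable lborel (\<lambda>z. indicator (cball 0 R) z *\<^sub>R (cmod (B z))\<^sup>2)"
    and nn: "AE z in lborel. z \<in> disk \<longrightarrow> 0 \<le> Jac u z"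
  shows "planar_map u A B"
proof
  have um: "(\<lambda>z. indicator disk z *\<^sub>R u z) \<in> borel_measurable borel"
    by (intro borel_measurable_continuous_on_indicator continuous_on_subset[OF cont]) auto
  have uae: "AE z in lborel. z \<in> disk \<longrightarrow> u z = indicator disk z *\<^sub>R u z" by simp
  show "conv (mollifier_x d) (\<lambda>z. indicator disk z *\<^sub>R u z) x = conv (mollifier d) A x"
    if "0 < d" "cball x d \<subseteq> disk" for d x
    by (rule weak_deriv_conv(1)[OF weakly_differentiableD(1)[OF wd] um A(1) uae A(2) that refl])
  show "conv (mollifier_y d) (\<lambda>z. indicator disk z *\<^sub>R u z) x = conv (mollifier d) B x"
    if "0 < d" "cball x d \<subseteq> disk" for d x
    by (rule weak_deriv_conv(2)[OF weakly_differentiableD(2)[OF wd] um B(1) uae B(2) that refl])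
  show "AE z in lborel. z \<in> disk \<longrightarrow> 0 \<le> jac (A z) (B z)"
    using nn A(2) B(2) by eventually_elim (auto simp: Jac_eq_jac)
  show "u z \<in> closed_disk" if "z \<in> closed_disk" for z using cl that by blast
  show "u z \<in> sphere 0 1" if "z \<in> sphere 0 1" for z using sp that by blast
qed (use cont A B A2 B2 in simp_all)

text \<open>Invariance of domain: the image of the open disk is open, hence inside the interior of
  the closed disk. Applied to the inverse, this shows that no boundary point is moved
  inside.\<close>

lemma homeomorphism_closed_disk:
  assumes "homeomorphism closed_disk closed_disk u g"
  shows "u ` disk \<subseteq> disk" "u ` sphere 0 1 \<subseteq> sphere 0 1"
proof -
  have half: "v ` disk \<subseteq> disk" if "homeomorphism closed_disk closed_disk v k" for v k :: "complex \<Rightarrow> complex"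
  proof -
    have "inj_on v closed_disk"
      by (rule inj_on_inverseI[of _ k]) (use that in \<open>simp add: homeomorphism_def\<close>)
    then have "inj_on v disk" by (rule inj_on_subset) auto
    moreover have "continuous_on disk v" using that by (auto simp: homeomorphism_def intro: continuous_on_subset)
    ultimately have "open (v ` disk)" by (intro invariance_of_domain) auto
    moreover have "v ` disk \<subseteq> closed_disk" using that by (auto simp: homeomorphism_def)
    ultimately have "v ` disk \<subseteq> interior closed_disk" by (rule interior_maximal[rotated])
    then show ?thesis by simp
  qed
  show "u ` disk \<subseteq> disk" by (rule half[OF assms])
  have g: "g ` disk \<subseteq> disk" by (rule half[OF homeomorphism_symD[OF assms]])
  show "u ` sphere 0 1 \<subseteq> sphere 0 1"
  proof
    fix w assume "w \<in> u ` sphere 0 1"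
    then obtain z where z: "z \<in> sphere 0 1" "w = u z" by blast
    then have w: "w \<in> closed_disk" "g w = z" using assms by (auto simp: homeomorphism_def)
    show "w \<in> sphere 0 1"
    proof (rule ccontr)
      assume "w \<notin> sphere 0 1"
      then have "w \<in> disk" using w(1) by auto
      then have "z \<in> disk" using g w(2) by blast
      then show False using z(1) by auto
    qed
  qed
qed

lemma cmod_powr_2: "cmod x powr 2 = (cmod x)\<^sup>2"
  by (cases "x = 0") (simp_all add: powr_numeral)

text \<open>In \<open>ennreal\<close> an upper bound \<open>energy p h0 + 1\<close> says something
  only if it is finite. Since 2 \<open>dist_K\<close> J = |h_x|^2 + |h_y|^2 <= 2 K J, the distortion
  is at most the constant \<open>K\<close> where J > 0, and the energy is at most K^p times the
  finite mass of the disk.\<close>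

lemma energy_qc_boundary_data_finite:
  assumes "qc_boundary_data h0" "0 \<le> p"
  shows "energy p h0 < \<infinity>"
proof -
  obtain g where hom: "homeomorphism closed_disk closed_disk h0 g" using assms(1) by (auto simp: qc_boundary_data_def)
  have qc: "quasiconformal h0" using assms(1) by (simp add: qc_boundary_data_def)
  obtain K where K: "1 \<le> K" "AE z in lborel. z \<in> disk \<longrightarrow> (norm_D h0 z)\<^sup>2 \<le> K * Jac h0 z"
    using qc by (auto simp: quasiconformal_def AE_lebesgue_on_disk)
  have W: "weakly_differentiable disk h0" "Lq_loc 2 disk (weak_deriv disk 1 h0)" "Lq_loc 2 disk (weak_deriv disk \<i> h0)"
    using qc by (auto simp: quasiconformal_def W1q_loc_def)
  obtain A where A: "A \<in> borel_measurable borel" "AE z in lborel. z \<in> disk \<longrightarrow> weak_deriv disk 1 h0 z = A z"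
    using Lq_loc_borel_representative[OF W(2)] by blast
  obtain B where B: "B \<in> borel_measurable borel" "AE z in lborel. z \<in> disk \<longrightarrow> weak_deriv disk \<i> h0 z = B z"
    using Lq_loc_borel_representative[OF W(3)] by blast
  have nn: "AE z in lborel. z \<in> disk \<longrightarrow> 0 \<le> Jac h0 z"
    using K(2)
  proof eventually_elim
    case (elim z)
    show ?case
    proof
      assume "z \<in> disk"
      then have "0 \<le> K * Jac h0 z" using elim by (meson order_trans zero_le_power2)
      then show "0 \<le> Jac h0 z" using K(1) by (simp add: zero_le_mult_iff)
    qed
  qed
  interpret planar_map h0 A B
  proof (rule planar_mapI[OF _ _ homeomorphism_closed_disk(2)[OF hom] W(1) A B _ _ nn])
    show "continuous_on closed_disk h0" "h0 ` closed_disk \<subseteq> closed_disk" using hom by (auto simp: homeomorphism_def)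
    show "integrable lborel (\<lambda>z. indicator (cball 0 R) z *\<^sub>R (cmod (A z))\<^sup>2)" if "R < 1" for R
      using Lq_loc_integrable[OF W(2) A that] by (simp add: cmod_powr_2)
    show "integrable lborel (\<lambda>z. indicator (cball 0 R) z *\<^sub>R (cmod (B z))\<^sup>2)" if "R < 1" for R
      using Lq_loc_integrable[OF W(3) B that] by (simp add: cmod_powr_2)
  qed
  from mass_open_bound obtain C :: ennreal where
    C: "C < \<infinity> \<and> (\<forall>S. open S \<longrightarrow> S \<subseteq> disk \<longrightarrow> mass S \<le> C * emeasure lborel S)" ..
  have mfin: "mass disk < \<infinity>"
  proof -
    have "mass disk \<le> C * emeasure lborel disk" using C by simp
    also have "\<dots> < \<infinity>" using C by (simp add: ennreal_mult_less_top emeasure_lborel_ball_finite[simplified])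
    finally show ?thesis .
  qed
  have "energy p h0 \<le> (\<integral>\<^sup>+z. ennreal (K powr p) * (indicator disk z * (indicator disk (h0 z) * ennreal (jac (A z) (B z)))) \<partial>lborel)"
    unfolding energy_def nn_integral_lebesgue_on_disk
  proof (rule nn_integral_mono_AE)
    show "AE z in lborel. indicator disk z * ennreal (dist_K h0 z powr p * Jac h0 z) \<le>
        ennreal (K powr p) * (indicator disk z * (indicator disk (h0 z) * ennreal (jac (A z) (B z))))"
      using K(2) nn A(2) B(2)
    proof eventually_elim
      case (elim z)
      show ?case
      proof (cases "z \<in> disk")
        case True
        then have hz: "h0 z \<in> disk" using homeomorphism_closed_disk(1)[OF hom] by blast
        have J: "0 \<le> Jac h0 z" "Jac h0 z = jac (A z) (B z)" using elim True by (auto simp: Jac_eq_jac)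
        have "dist_K h0 z powr p * Jac h0 z \<le> K powr p * Jac h0 z"
        proof (cases "Jac h0 z = 0")
          case False
          then have pos: "0 < Jac h0 z" using J by simp
          have "2 * dist_K h0 z * Jac h0 z \<le> 2 * (norm_D h0 z)\<^sup>2"
            unfolding dist_K_Jac[OF False] by (rule weak_deriv_le_norm_D)
          also have "\<dots> \<le> 2 * (K * Jac h0 z)" using elim True by simp
          finally have "dist_K h0 z \<le> K" using pos by simp
          then have "dist_K h0 z powr p \<le> K powr p"
            using dist_K_ge_1[OF J(1)] assms(2) by (intro powr_mono2) auto
          then show ?thesis using J(1) by (rule mult_right_mono)
        qed simp
        then have "ennreal (dist_K h0 z powr p * Jac h0 z) \<le> ennreal (K powr p * Jac h0 z)" by (rule ennreal_leI)
        also have "\<dots> = ennreal (K powr p) * ennreal (Jac h0 z)" by (rule ennreal_mult') simp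
        finally show ?thesis using True hz J(2) by simp
      qed simp
    qed
  qed
  also have "\<dots> = ennreal (K powr p) * mass disk"
  proof -
    have [measurable]: "A \<in> borel_measurable borel" "B \<in> borel_measurable borel" "disk \<in> sets borel" using A B by auto
    have "mass disk = (\<integral>\<^sup>+z. indicator disk z * (indicator disk (H z) * ennreal (jac (A z) (B z))) \<partial>lborel)"
      unfolding mass_def by (intro nn_integral_cong) (auto simp: indicator_def)
    also have "ennreal (K powr p) * \<dots> = (\<integral>\<^sup>+z. ennreal (K powr p) * (indicator disk z * (indicator disk (H z) * ennreal (jac (A z) (B z)))) \<partial>lborel)"
      by (rule nn_integral_cmult[symmetric]) measurable
    also have "\<dots> = (\<integral>\<^sup>+z. ennreal (K powr p) * (indicator disk z * (indicator disk (h0 z) * ennreal (jac (A z) (B z)))) \<partial>lborel)"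
      by (intro nn_integral_cong) (auto simp: indicator_def)
    finally show ?thesis by simp
  qed
  also have "\<dots> < \<infinity>" using mfin by (simp add: ennreal_mult_less_top)
  finally show ?thesis .
qed

text \<open>Almost everywhere the extended real \<open>K z\<close> is finite, and the distortion
  inequality becomes one between reals. Vanishing of the differential where
  \<open>Jac h z = 0\<close> extends |h_x|^2 + |h_y|^2 = 2 K J to the points at which
  \<open>dist_K\<close> is 1 by convention.\<close>

lemma finite_distortionD:
  assumes "finite_distortion h"
  shows "AE z in lborel. z \<in> disk \<longrightarrow> 0 \<le> Jac h z \<and> (Jac h z = 0 \<longrightarrow> norm_D h z = 0)"
proof -
  obtain K :: "complex \<Rightarrow> ereal" where K: "\<And>z. z \<in> disk \<Longrightarrow> 1 \<le> K z" "AE z in lborel. z \<in> disk \<longrightarrow> K z < \<infinity>"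
    "AE z in lborel. z \<in> disk \<longrightarrow> ereal ((norm_D h z)\<^sup>2) \<le> K z * ereal (Jac h z)"
    using assms unfolding finite_distortion_def AE_lebesgue_on_disk by blast
  show ?thesis
    using K(2,3)
  proof eventually_elim
    case (elim z)
    show ?case
    proof
      assume z: "z \<in> disk"
      then obtain k where k: "K z = ereal k" "1 \<le> k" using K(1)[OF z] elim(1) by (cases "K z") auto
      have le: "(norm_D h z)\<^sup>2 \<le> k * Jac h z" using elim(2) z k(1) by simp
      then have "0 \<le> k * Jac h z" by (meson order_trans zero_le_power2)
      then have "0 \<le> Jac h z" using k(2) by (simp add: zero_le_mult_iff)
      moreover have "norm_D h z = 0" if "Jac h z = 0" using le that by simp
      ultimately show "0 \<le> Jac h z \<and> (Jac h z = 0 \<longrightarrow> norm_D h z = 0)" by blast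
    qed
  qed
qed

theorem theorem6p2:
  fixes p :: real and h0 h :: "complex \<Rightarrow> complex"
  assumes "1 < p"
    and "qc_boundary_data h0"
    and "h \<in> H_class p h0"
    and "set_integrable lebesgue disk (\<lambda>w. dist_K h w)"
  shows "\<exists>g. homeomorphism closed_disk closed_disk h g"
proof -
  obtain g0 where hom: "homeomorphism closed_disk closed_disk h0 g0" using assms(2) by (auto simp: qc_boundary_data_def)
  have h: "h ` closed_disk \<subseteq> closed_disk" "continuous_on closed_disk h" "\<And>z. z \<in> sphere 0 1 \<Longrightarrow> h z = h0 z"
    "finite_distortion h" "energy p h \<le> energy p h0 + 1"
    using assms(3) by (auto simp: H_class_def)
  obtain f X where f: "f ` disk \<subseteq> disk" "weakly_differentiable disk f"
    and X: "X \<in> sets lebesgue" "X \<subseteq> disk" "emeasure lebesgue (disk - X) = 0" "\<And>z. z \<in> X \<Longrightarrow> h (f z) = z"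
    and JX: "AE w in lborel. w \<in> disk \<longrightarrow> w \<notin> f ` X \<longrightarrow> Jac h w = 0"
    using assms(3) unfolding H_class_def Let_def AE_lebesgue_on_disk W1q_def by blast
  note fd = finite_distortionD[OF h(4)]
  have W: "weakly_differentiable disk h" "Lq_loc 1 disk (weak_deriv disk 1 h)" "Lq_loc 1 disk (weak_deriv disk \<i> h)"
    using h(4) by (auto simp: finite_distortion_def W1q_loc_def)
  obtain A where A: "A \<in> borel_measurable borel" "AE z in lborel. z \<in> disk \<longrightarrow> weak_deriv disk 1 h z = A z"
    using Lq_loc_borel_representative[OF W(2)] by blast
  obtain B where B: "B \<in> borel_measurable borel" "AE z in lborel. z \<in> disk \<longrightarrow> weak_deriv disk \<i> h z = B z"
    using Lq_loc_borel_representative[OF W(3)] by blast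
  have [measurable]: "A \<in> borel_measurable borel" "B \<in> borel_measurable borel" "disk \<in> sets borel" using A B by auto
  have dist: "AE z in lborel. z \<in> disk \<longrightarrow> 0 \<le> Jac h z \<and> 1 \<le> dist_K h z \<and> Jac h z = jac (A z) (B z) \<and>
      (cmod (A z))\<^sup>2 + (cmod (B z))\<^sup>2 = 2 * dist_K h z * Jac h z"
    using fd A(2) B(2)
  proof eventually_elim
    case (elim z)
    show ?case
    proof
      assume z: "z \<in> disk"
      have J: "0 \<le> Jac h z" using elim z by blast
      have AB: "weak_deriv disk 1 h z = A z" "weak_deriv disk \<i> h z = B z" using elim z by auto
      have "(cmod (A z))\<^sup>2 + (cmod (B z))\<^sup>2 = 2 * dist_K h z * Jac h z"
      proof (cases "Jac h z = 0")
        case True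
        then have "norm_D h z = 0" using elim z by blast
        then have "(cmod (A z))\<^sup>2 + (cmod (B z))\<^sup>2 \<le> 0" using weak_deriv_le_norm_D[of h z] AB by simp
        then have "(cmod (A z))\<^sup>2 + (cmod (B z))\<^sup>2 = 0"
          by (rule order_antisym) (intro add_nonneg_nonneg zero_le_power2)
        then show ?thesis by (simp only: True mult_zero_right)
      next
        case False
        then show ?thesis using dist_K_Jac[OF False] AB by simp
      qed
      then show "0 \<le> Jac h z \<and> 1 \<le> dist_K h z \<and> Jac h z = jac (A z) (B z) \<and>
          (cmod (A z))\<^sup>2 + (cmod (B z))\<^sup>2 = 2 * dist_K h z * Jac h z"
        using J dist_K_ge_1[OF J] Jac_eq_jac[of h z] AB by simp
    qed
  qed
  have energy: "(\<integral>\<^sup>+z. indicator disk z * ennreal ((cmod (A z))\<^sup>2 + (cmod (B z))\<^sup>2) \<partial>lborel) < \<infinity>"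
  proof -
    have "(\<integral>\<^sup>+z. indicator disk z * ennreal ((cmod (A z))\<^sup>2 + (cmod (B z))\<^sup>2) \<partial>lborel) \<le>
        2 * (\<integral>\<^sup>+z. indicator disk z * ennreal (dist_K h z powr p * Jac h z) \<partial>lborel)"
    proof -
      \<comment> \<open>The factor 2 is pulled out of the integral on this side, where the integrand
        is Borel; the other integrand involves \<open>dist_K h\<close>, for which Borel
        measurability is not at hand.\<close>
      have "(\<integral>\<^sup>+z. indicator disk z * ennreal ((cmod (A z))\<^sup>2 + (cmod (B z))\<^sup>2) \<partial>lborel) =
          (\<integral>\<^sup>+z. 2 * (indicator disk z * ennreal (((cmod (A z))\<^sup>2 + (cmod (B z))\<^sup>2) / 2)) \<partial>lborel)"
      proof (rule nn_integral_cong)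
        fix z :: complex
        have "ennreal ((cmod (A z))\<^sup>2 + (cmod (B z))\<^sup>2) = ennreal (2 * (((cmod (A z))\<^sup>2 + (cmod (B z))\<^sup>2) / 2))"
          by (rule arg_cong[of _ _ ennreal]) simp
        also have "\<dots> = ennreal 2 * ennreal (((cmod (A z))\<^sup>2 + (cmod (B z))\<^sup>2) / 2)" by (rule ennreal_mult') simp
        finally show "indicator disk z * ennreal ((cmod (A z))\<^sup>2 + (cmod (B z))\<^sup>2) =
            2 * (indicator disk z * ennreal (((cmod (A z))\<^sup>2 + (cmod (B z))\<^sup>2) / 2))"
          by (simp add: indicator_def)
      qed
      also have "\<dots> = 2 * (\<integral>\<^sup>+z. indicator disk z * ennreal (((cmod (A z))\<^sup>2 + (cmod (B z))\<^sup>2) / 2) \<partial>lborel)"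
        by (rule nn_integral_cmult) measurable
      also have "\<dots> \<le> 2 * (\<integral>\<^sup>+z. indicator disk z * ennreal (dist_K h z powr p * Jac h z) \<partial>lborel)"
      proof (rule mult_left_mono[OF nn_integral_mono_AE])
        show "AE z in lborel. indicator disk z * ennreal (((cmod (A z))\<^sup>2 + (cmod (B z))\<^sup>2) / 2) \<le>
            indicator disk z * ennreal (dist_K h z powr p * Jac h z)"
          using dist
        proof eventually_elim
          case (elim z)
          show ?case
          proof (cases "z \<in> disk")
            case True
            have "dist_K h z \<le> dist_K h z powr p" using powr_mono[of 1 p "dist_K h z"] elim True assms(1) by simp
            then have "dist_K h z * Jac h z \<le> dist_K h z powr p * Jac h z" using elim True by (intro mult_right_mono) auto
            then have "((cmod (A z))\<^sup>2 + (cmod (B z))\<^sup>2) / 2 \<le> dist_K h z powr p * Jac h z" using elim True by simp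
            then show ?thesis by (intro mult_left_mono ennreal_leI) auto
          qed simp
        qed
      qed simp
      finally show ?thesis .
    qed
    also have "\<dots> = 2 * energy p h" by (simp add: energy_def nn_integral_lebesgue_on_disk)
    also have "\<dots> \<le> 2 * (energy p h0 + 1)" by (intro mult_left_mono h(5)) simp
    also have "\<dots> < \<infinity>"
      using energy_qc_boundary_data_finite[OF assms(2), of p] assms(1) by (simp add: ennreal_mult_less_top)
    finally show ?thesis .
  qed
  have int2: "integrable lborel (\<lambda>z. indicator (cball 0 R) z *\<^sub>R (cmod (G z))\<^sup>2)"
    if [measurable]: "G \<in> borel_measurable borel" and G: "\<And>z. (cmod (G z))\<^sup>2 \<le> (cmod (A z))\<^sup>2 + (cmod (B z))\<^sup>2" and R: "R < 1"
    for G :: "complex \<Rightarrow> complex" and R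
  proof (rule integrableI_bounded)
    have [measurable]: "cball (0::complex) R \<in> sets borel" by simp
    show "(\<lambda>z. indicator (cball 0 R) z *\<^sub>R (cmod (G z))\<^sup>2) \<in> borel_measurable lborel" by measurable
    have "(\<integral>\<^sup>+z. ennreal (norm (indicator (cball 0 R) z *\<^sub>R (cmod (G z))\<^sup>2)) \<partial>lborel) \<le>
        (\<integral>\<^sup>+z. indicator disk z * ennreal ((cmod (A z))\<^sup>2 + (cmod (B z))\<^sup>2) \<partial>lborel)"
    proof (rule nn_integral_mono)
      fix z :: complex
      show "ennreal (norm (indicator (cball 0 R) z *\<^sub>R (cmod (G z))\<^sup>2)) \<le> indicator disk z * ennreal ((cmod (A z))\<^sup>2 + (cmod (B z))\<^sup>2)"
      proof (cases "z \<in> cball 0 R")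
        case True
        then have "z \<in> disk" using R by auto
        then show ?thesis using True ennreal_leI[OF G[of z]] by (simp del: ennreal_plus)
      qed simp
    qed
    then show "(\<integral>\<^sup>+z. ennreal (norm (indicator (cball 0 R) z *\<^sub>R (cmod (G z))\<^sup>2)) \<partial>lborel) < \<infinity>"
      using energy by (rule order.strict_trans1)
  qed
  have sp: "h ` sphere 0 1 \<subseteq> sphere 0 1" using homeomorphism_closed_disk(2)[OF hom] h(3) by auto
  have pm: "planar_map h A B"
  proof (rule planar_mapI[OF h(2,1) sp W(1) A B])
    show "integrable lborel (\<lambda>z. indicator (cball 0 R) z *\<^sub>R (cmod (A z))\<^sup>2)" if "R < 1" for R
      by (rule int2[OF A(1) _ that]) simp
    show "integrable lborel (\<lambda>z. indicator (cball 0 R) z *\<^sub>R (cmod (B z))\<^sup>2)" if "R < 1" for R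
      by (rule int2[OF B(1) _ that]) simp
    show "AE z in lborel. z \<in> disk \<longrightarrow> 0 \<le> Jac h z" using dist by eventually_elim blast
  qed
  have ik: "integrable lebesgue (\<lambda>w. indicator disk w *\<^sub>R dist_K h w)" using assms(4) by (simp add: set_integrable_def)
  then obtain K where K: "K \<in> borel_measurable lborel" "AE w in lborel. indicator disk w *\<^sub>R dist_K h w = K w"
    using completion_ex_borel_measurable_real[OF borel_measurable_integrable[OF ik]] by blast
  have JX': "AE w in lborel. w \<in> disk \<longrightarrow> w \<notin> f ` X \<longrightarrow> jac (A w) (B w) = 0"
    using JX dist by eventually_elim auto
  \<comment> \<open>\<open>K\<close> is a Borel version of \<open>dist_K h\<close>, nonnegative only
    almost everywhere on the disk; the absolute value makes it nonnegative at every point.\<close>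
  have lm: "light_map h A B (\<lambda>z. \<bar>K z\<bar>)"
  proof (rule light_map.intro[OF pm], unfold_locales)
    show "(\<lambda>z. \<bar>K z\<bar>) \<in> borel_measurable borel" using K(1) by simp
    show "(\<integral>\<^sup>+z. indicator disk z * ennreal \<bar>K z\<bar> \<partial>lborel) < \<infinity>"
    proof -
      have "(\<integral>\<^sup>+z. indicator disk z * ennreal \<bar>K z\<bar> \<partial>lborel) \<le> (\<integral>\<^sup>+z. ennreal (norm (indicator disk z *\<^sub>R dist_K h z)) \<partial>lborel)"
        by (rule nn_integral_mono_AE) (use K(2) in \<open>eventually_elim, auto simp: indicator_def\<close>)
      also have "\<dots> = (\<integral>\<^sup>+z. ennreal (norm (indicator disk z *\<^sub>R dist_K h z)) \<partial>lebesgue)"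
        by (rule nn_integral_completion[symmetric])
      also have "\<dots> < \<infinity>" using ik unfolding integrable_iff_bounded by blast
      finally show ?thesis .
    qed
    show "AE z in lborel. z \<in> disk \<longrightarrow> (cmod (A z))\<^sup>2 + (cmod (B z))\<^sup>2 \<le> 2 * \<bar>K z\<bar> * jac (A z) (B z)"
      using dist K(2)
    proof eventually_elim
      case (elim z)
      show ?case
      proof
        assume z: "z \<in> disk"
        then have "K z = dist_K h z" using elim by simp
        then show "(cmod (A z))\<^sup>2 + (cmod (B z))\<^sup>2 \<le> 2 * \<bar>K z\<bar> * jac (A z) (B z)" using elim z by auto
      qed
    qed
    show "inj_on h (sphere 0 1)"
    proof (rule inj_onI)
      fix z w :: complex assume "z \<in> sphere 0 1" "w \<in> sphere 0 1" "h z = h w"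
      then have "h0 z = h0 w" "z \<in> closed_disk" "w \<in> closed_disk" using h(3) by auto
      then show "z = w" using hom unfolding homeomorphism_def by metis
    qed
    show "AE z in lborel. z \<in> disk \<longrightarrow> h z \<notin> disk \<longrightarrow> jac (A z) (B z) = 0"
      using JX'
    proof eventually_elim
      case (elim z)
      \<comment> \<open>Points in the image of \<open>X\<close> under \<open>f\<close> are sent back
        into \<open>X\<close>, inside the open disk, so a point that \<open>h\<close> sends to the
        circle is not among them.\<close>
      have "z \<notin> f ` X" if "h z \<notin> disk" using that X(2,4) by auto
      then show ?case using elim by blast
    qed
  qed simp
  interpret light_map h A B "\<lambda>z. \<bar>K z\<bar>" by (rule lm)
  have Xae: "AE z in lborel. z \<in> disk \<longrightarrow> z \<in> X"
  proof -
    have "disk - X \<in> null_sets lebesgue" using X(1,3) by (intro null_setsI) auto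
    then have "AE z in lebesgue. z \<notin> disk - X" by (rule AE_not_in)
    then show ?thesis unfolding AE_completion_iff by eventually_elim auto
  qed
  have fd: "f z \<in> disk" if "z \<in> disk" for z using f(1) that by blast
  have inj: "inj_on h closed_disk"
  proof (rule injective[OF X(2,4) Xae _ JX'])
    show "f z \<in> disk" if "z \<in> X" for z using that X(2) fd by blast
    show "(AE z in lborel. z \<in> S \<longrightarrow> coord b (f z) < c) \<or> (AE z in lborel. z \<in> S \<longrightarrow> c < coord b (f z))"
      if "0 < \<delta>" "open S" "convex S" "S \<subseteq> disk" "AE z in lborel. z \<in> S \<longrightarrow> \<delta> < \<bar>coord b (f z) - c\<bar>" for b c \<delta> S
      by (rule sobolev_values_connected[OF weakly_differentiableD[OF f(2)] fd that])
  qed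
  have surj: "h ` closed_disk = closed_disk"
  proof
    show "h ` closed_disk \<subseteq> closed_disk" by fact
    \<comment> \<open>The identity of \<open>h\<close> after \<open>f\<close> holds only on
      \<open>X\<close>, so the image covers almost all of the disk. Its complement in the disk is
      open by compactness of the image, and an open null set is empty.\<close>
    have comp: "compact (h ` closed_disk)" using h(2) by (intro compact_continuous_image) auto
    have "X \<subseteq> h ` closed_disk"
    proof
      fix z assume z: "z \<in> X"
      then have "f z \<in> closed_disk" using fd[of z] X(2) by auto
      then show "z \<in> h ` closed_disk" using X(4)[OF z] by (metis imageI)
    qed
    then have "AE z in lborel. z \<notin> disk - h ` closed_disk" using Xae by (auto elim!: eventually_mono)
    moreover have op: "open (disk - h ` closed_disk)" using comp by (intro open_Diff compact_imp_closed) auto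
    ultimately have "disk - h ` closed_disk \<in> null_sets lborel" by (subst AE_iff_null_sets) auto
    then have "disk - h ` closed_disk = {}"
      using open_not_negligible[OF op] negligible_iff_null_sets null_sets_completionI by blast
    then have "closure disk \<subseteq> h ` closed_disk" using comp by (intro closure_minimal compact_imp_closed) auto
    then show "closed_disk \<subseteq> h ` closed_disk" by simp
  qed
  show ?thesis
    using homeomorphism_compact[OF compact_cball h(2) surj inj] by blast
qed

end
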